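(* Assume the Young tower setting described in the context (in particular $\varphi\in L^1(Y)$). Suppose that $\mu(\varphi>n)=O((n\log n)^{-1})$. Then correlations decay at a uniform rate for $v\in\mathcal{B}(X)$, $w\in L^\infty(X)$; that is, there is a real sequence $a_n>0$ with $a_n\to0$ such that for every $v\in\mathcal{B}(X)$ there is a constant $C_v>0$ with $|\rho_{v,w}(n)|\le C_v|w|_\infty a_n$ for all $w\in L^\infty(X)$ and $n\ge1$.
   Context: Setting. $T:X\to X$ is a measurable transformation, $Y\subset X$ is measurable, $\varphi:Y\to\mathbb{Z}^+$ is a measurable return time (not necessarily the first return) with $F(y)=T^{\varphi(y)}(y)\in Y$ for $y\in Y$, and $\mu$ is an ergodic $F$-invariant probability measure on $Y$. It is assumed that $\varphi\in L^1(Y)=L^1(Y,\mu)$; put $\bar\varphi=\int_Y\varphi\,d\mu$. The tower is $\Delta=\{(y,\ell)\in Y\times\mathbb{Z}:0\le\ell\le\varphi(y)-1\}$ with map $f(y,\ell)=(y,\ell+1)$ for $\ell\le\varphi(y)-2$ and $f(y,\varphi(y)-1)=(Fy,0)$, and $f$-invariant probability measure $\mu_\Delta=(\mu\times\text{counting})/\bar\varphi$. The map $\pi:\Delta\to X$, $\pi(y,\ell)=T^\ell y$, is a semiconjugacy and $\mu_X=\pi_*\mu_\Delta$ is a $T$-invariant probability measure; $L^\infty(X)=L^\infty(X,\mu_X)$ with norm $|\cdot|_\infty$. The correlation function is $\rho_{v,w}(n)=\int_X v\,w\circ T^n\,d\mu_X-\int_X v\,d\mu_X\int_X w\,d\mu_X$.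 Write $\mu(\varphi>n)=\mu(\{y\in Y:\varphi(y)>n\})$. Young tower assumptions. There is an at most countable measurable partition $\alpha$ of $Y$ (mod null sets, elements of positive measure) such that $\varphi$ is constant on each $a\in\alpha$ and $F$ is Gibbs-Markov: (1) for each $a\in\alpha$, $F|_a$ is a bijection (mod null sets, bimeasurable and nonsingular) onto a union of elements of $\alpha$, and $\inf_{a\in\alpha}\mu(Fa)>0$; (2) the separation time $s(y,y')$, the least $n\ge0$ such that $F^ny,F^ny'$ lie in distinct elements of $\alpha$, is finite for $y\ne y'$; (3) for some $\theta\in(0,1)$, with $d_\theta(y,y')=\theta^{s(y,y')}$, the function $g=d\mu/d(\mu\circ F)$ satisfies $|\log g(y)-\log g(y')|\le C_0\,d_\theta(Fy,Fy')$ for all $y,y'\in a$, $a\in\alpha$. Function spaces. $\mathcal{B}(Y)$ is the space of (piecewise Hölder) functions $v:Y\to\mathbb{R}$ (complexified when needed) which are bounded and Lipschitz with respect to $d_\theta$, with norm the sum of sup norm and Lipschitz constant. $\mathcal{B}(X)$ is the space of piecewise Hölder observables $v:X\to\mathbb{R}$ with $$\|v\|=\sup_{a\in\alpha}\ \sup_{0\le\ell<\varphi(a)}\Bigl\{\sup_{y\in a}|v(T^\ell y)|+\sup_{y\neq y'\in a}\frac{|v(T^\ell y)-v(T^\ell y')|}{d_\theta(y,y')}\Bigr\}<\infty.$$ Aperiodicity. Let $R:L^1(Y)\to L^1(Y)$ be the transfer operator of $F$ ($\int_Y Rv\,w\,d\mu=\int_Y v\,w\circ F\,d\mu$), $R_nv=R(1_{\{\varphi=n\}}v)$,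 and $R(z)=\sum_{n\ge1}R_nz^n$ on $\mathcal{B}(Y)$ for $z\in\mathbb{C}$, $|z|\le1$. It is assumed that for every $z$ with $|z|\le 1$, $z\ne1$, the spectrum of $R(z):\mathcal{B}(Y)\to\mathcal{B}(Y)$ does not contain $1$. *)

theory Defs
  imports "HOL-Probability.Probability" "HOL-Library.Landau_Symbols" "HOL-Library.Extended_Nat"
begin

section \<open>Return maps and towers\<close>

definition return_map :: "('x \<Rightarrow> 'x) \<Rightarrow> ('x \<Rightarrow> nat) \<Rightarrow> 'x \<Rightarrow> 'x" where
  "return_map T \<phi> y = (T ^^ \<phi> y) y"

definition invariant_measure :: "'x measure \<Rightarrow> ('x \<Rightarrow> 'x) \<Rightarrow> bool" where
  "invariant_measure \<mu> F \<longleftrightarrow> F \<in> measurable \<mu> \<mu> \<and> distr \<mu> \<mu> F = \<mu>"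

definition ergodic_measure :: "'x measure \<Rightarrow> ('x \<Rightarrow> 'x) \<Rightarrow> bool" where
  "ergodic_measure \<mu> F \<longleftrightarrow> invariant_measure \<mu> F \<and>
     (\<forall>A\<in>sets \<mu>. F -` A \<inter> space \<mu> = A \<longrightarrow> measure \<mu> A = 0 \<or> measure \<mu> A = 1)"

definition tower :: "'x measure \<Rightarrow> ('x \<Rightarrow> nat) \<Rightarrow> ('x \<times> nat) set" where
  "tower \<mu> \<phi> = {(y, l). y \<in> space \<mu> \<and> l < \<phi> y}"

definition mean_return :: "'x measure \<Rightarrow> ('x \<Rightarrow> nat) \<Rightarrow> real" where
  "mean_return \<mu> \<phi> = (\<integral>y. real (\<phi> y) \<partial>\<mu>)"

definition tower_measure :: "'x measure \<Rightarrow> ('x \<Rightarrow> nat) \<Rightarrow> ('x \<times> nat) measure" where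
  "tower_measure \<mu> \<phi> =
     scale_measure (ennreal (1 / mean_return \<mu> \<phi>))
       (restrict_space (\<mu> \<Otimes>\<^sub>M count_space UNIV) (tower \<mu> \<phi>))"

definition tower_proj :: "('x \<Rightarrow> 'x) \<Rightarrow> 'x \<times> nat \<Rightarrow> 'x" where
  "tower_proj T = (\<lambda>(y, l). (T ^^ l) y)"

definition base_measure ::
  "'x measure \<Rightarrow> ('x \<Rightarrow> 'x) \<Rightarrow> 'x measure \<Rightarrow> ('x \<Rightarrow> nat) \<Rightarrow> 'x measure" where
  "base_measure M T \<mu> \<phi> = distr (tower_measure \<mu> \<phi>) M (tower_proj T)"

definition correlation ::
  "'x measure \<Rightarrow> ('x \<Rightarrow> 'x) \<Rightarrow> ('x \<Rightarrow> real) \<Rightarrow> ('x \<Rightarrow> real) \<Rightarrow> nat \<Rightarrow> real" where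
  "correlation \<mu>X T v w n =
     (\<integral>x. v x * w ((T ^^ n) x) \<partial>\<mu>X) - (\<integral>x. v x \<partial>\<mu>X) * (\<integral>x. w x \<partial>\<mu>X)"


section \<open>Gibbs-Markov maps\<close>

text \<open>The separation time is the infimum of the empty set, i.e. infinite, if the orbits never lie
  in distinct partition elements; \<open>sep_dist\<close> is then \<open>0\<close>.\<close>

definition sep_time :: "'x set set \<Rightarrow> ('x \<Rightarrow> 'x) \<Rightarrow> 'x \<Rightarrow> 'x \<Rightarrow> enat" where
  "sep_time \<alpha> F y y' =
     (INF n \<in> {n. \<exists>a\<in>\<alpha>. \<exists>b\<in>\<alpha>. a \<noteq> b \<and> (F ^^ n) y \<in> a \<and> (F ^^ n) y' \<in> b}. enat n)"

definition sep_dist :: "real \<Rightarrow> 'x set set \<Rightarrow> ('x \<Rightarrow> 'x) \<Rightarrow> 'x \<Rightarrow> 'x \<Rightarrow> real" where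
  "sep_dist \<theta> \<alpha> F y y' = (case sep_time \<alpha> F y y' of enat n \<Rightarrow> \<theta> ^ n | \<infinity> \<Rightarrow> 0)"

definition partition_mod_null :: "'x measure \<Rightarrow> 'x set set \<Rightarrow> bool" where
  "partition_mod_null \<mu> \<alpha> \<longleftrightarrow>
     countable \<alpha> \<and> \<alpha> \<subseteq> sets \<mu> \<and> (\<forall>a\<in>\<alpha>. emeasure \<mu> a > 0) \<and>
     (\<forall>a\<in>\<alpha>. \<forall>b\<in>\<alpha>. a \<noteq> b \<longrightarrow> a \<inter> b \<in> null_sets \<mu>) \<and>
     (AE y in \<mu>. y \<in> \<Union>\<alpha>)"

text \<open>The measure \<open>\<mu> \<circ> F\<close> is \<open>A \<mapsto> \<mu> (F A)\<close> on subsets of an element of the partition \<open>P\<close>, on which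
  \<open>F\<close> is injective, extended to all measurable sets by additivity.\<close>

definition comp_measure :: "'x measure \<Rightarrow> ('x \<Rightarrow> 'x) \<Rightarrow> 'x set set \<Rightarrow> 'x measure" where
  "comp_measure \<mu> F P =
     measure_of (space \<mu>) (sets \<mu>) (\<lambda>A. \<integral>\<^sup>+a. emeasure \<mu> (F ` (A \<inter> a)) \<partial>count_space P)"

text \<open>Being countably many, the null sets left out of the partition elements in the
  Gibbs-Markov conditions are collected in one null set \<open>N\<close>.\<close>

definition gibbs_markov :: "'x measure \<Rightarrow> ('x \<Rightarrow> 'x) \<Rightarrow> 'x set set \<Rightarrow> real \<Rightarrow> bool" where
  "gibbs_markov \<mu> F \<alpha> \<theta> \<longleftrightarrow>
     (\<exists>N\<in>null_sets \<mu>.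
        (\<forall>a\<in>\<alpha>. inj_on F (a - N)) \<and>
        (\<forall>a\<in>\<alpha>. \<forall>A\<in>sets \<mu>. A \<subseteq> a - N \<longrightarrow>
           F ` A \<in> sets \<mu> \<and> (emeasure \<mu> (F ` A) = 0 \<longleftrightarrow> emeasure \<mu> A = 0)) \<and>
        (\<forall>a\<in>\<alpha>. \<exists>\<beta>\<subseteq>\<alpha>. AE y in \<mu>. y \<in> F ` (a - N) \<longleftrightarrow> y \<in> \<Union>\<beta>) \<and>
        (\<exists>c>0. \<forall>a\<in>\<alpha>. c \<le> measure \<mu> (F ` (a - N))) \<and>
        (\<forall>y\<in>space \<mu> - N. \<forall>y'\<in>space \<mu> - N. y \<noteq> y' \<longrightarrow> sep_time \<alpha> F y y' \<noteq> \<infinity>) \<and>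
        (\<exists>g\<in>borel_measurable \<mu>. \<exists>C0::real.
           (\<forall>y\<in>space \<mu>. 0 < g y) \<and>
           density (comp_measure \<mu> F ((\<lambda>a. a - N) ` \<alpha>)) (\<lambda>y. ennreal (g y)) = \<mu> \<and>
           (\<forall>a\<in>\<alpha>. \<forall>y\<in>a - N. \<forall>y'\<in>a - N.
              \<bar>ln (g y) - ln (g y')\<bar> \<le> C0 * sep_dist \<theta> \<alpha> F (F y) (F y'))))"


section \<open>Function spaces\<close>

text \<open>For \<open>d y y' = 0\<close> the quotient below is \<open>0\<close>; by finiteness of the separation time this
  occurs for \<open>y \<noteq> y'\<close> only if one of the points is in a fixed null set.\<close>

definition lip_norm ::
  "'x set \<Rightarrow> ('x \<Rightarrow> 'x \<Rightarrow> real) \<Rightarrow> ('x \<Rightarrow> 'b::real_normed_vector) \<Rightarrow> ennreal" where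
  "lip_norm A d u =
     (SUP y\<in>A. ennreal (norm (u y))) +
     (SUP y\<in>A. SUP y'\<in>A - {y}. ennreal (norm (u y - u y') / d y y'))"

definition BX_norm ::
  "('x \<Rightarrow> 'x) \<Rightarrow> ('x \<Rightarrow> nat) \<Rightarrow> 'x set set \<Rightarrow> real \<Rightarrow> ('x \<Rightarrow> real) \<Rightarrow> ennreal" where
  "BX_norm T \<phi> \<alpha> \<theta> v =
     (SUP a\<in>\<alpha>. SUP l\<in>{l. \<exists>y\<in>a. l < \<phi> y}.
        lip_norm a (sep_dist \<theta> \<alpha> (return_map T \<phi>)) (\<lambda>y. v ((T ^^ l) y)))"

definition BX ::
  "'x measure \<Rightarrow> ('x \<Rightarrow> 'x) \<Rightarrow> ('x \<Rightarrow> nat) \<Rightarrow> 'x set set \<Rightarrow> real \<Rightarrow> ('x \<Rightarrow> real) set" where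
  "BX M T \<phi> \<alpha> \<theta> = {v \<in> borel_measurable M. BX_norm T \<phi> \<alpha> \<theta> v < \<infinity>}"

text \<open>Since the transfer operator acts on classes of functions mod null sets, so does \<open>BY_norm\<close>:
  it is the norm of the best representative, any null set may be disregarded.\<close>

definition BY_norm ::
  "'x measure \<Rightarrow> ('x \<Rightarrow> 'x) \<Rightarrow> 'x set set \<Rightarrow> real \<Rightarrow> ('x \<Rightarrow> complex) \<Rightarrow> ennreal" where
  "BY_norm \<mu> F \<alpha> \<theta> v =
     (INF N\<in>null_sets \<mu>. lip_norm (space \<mu> - N) (sep_dist \<theta> \<alpha> F) v)"

definition BY ::
  "'x measure \<Rightarrow> ('x \<Rightarrow> 'x) \<Rightarrow> 'x set set \<Rightarrow> real \<Rightarrow> ('x \<Rightarrow> complex) set" where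
  "BY \<mu> F \<alpha> \<theta> = {v \<in> borel_measurable \<mu>. BY_norm \<mu> F \<alpha> \<theta> v < \<infinity>}"

definition Linf_norm :: "'x measure \<Rightarrow> ('x \<Rightarrow> real) \<Rightarrow> ereal" where
  "Linf_norm \<mu> w = esssup \<mu> (\<lambda>x. ereal \<bar>w x\<bar>)"

definition Linf :: "'x measure \<Rightarrow> ('x \<Rightarrow> real) set" where
  "Linf \<mu> = {w \<in> borel_measurable \<mu>. Linf_norm \<mu> w < \<infinity>}"


section \<open>Transfer operators and aperiodicity\<close>

text \<open>The defining relation determines the transfer operator uniquely mod null sets, and only
  depends on \<open>v\<close> mod null sets.\<close>

definition transfer_op ::
  "'x measure \<Rightarrow> ('x \<Rightarrow> 'x) \<Rightarrow> ('x \<Rightarrow> complex) \<Rightarrow> 'x \<Rightarrow> complex" where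
  "transfer_op \<mu> F v =
     (SOME u. integrable \<mu> u \<and>
        (\<forall>w\<in>borel_measurable \<mu>. (\<exists>B. \<forall>y. norm (w y) \<le> B) \<longrightarrow>
           (\<integral>y. u y * w y \<partial>\<mu>) = (\<integral>y. v y * w (F y) \<partial>\<mu>)))"

definition transfer_part ::
  "'x measure \<Rightarrow> ('x \<Rightarrow> 'x) \<Rightarrow> ('x \<Rightarrow> nat) \<Rightarrow> nat \<Rightarrow> ('x \<Rightarrow> complex) \<Rightarrow> 'x \<Rightarrow> complex" where
  "transfer_part \<mu> F \<phi> n v = transfer_op \<mu> F (\<lambda>y. indicator {y. \<phi> y = n} y * v y)"

text \<open>For integrable \<open>v\<close> the \<open>L\<^sup>1\<close>-norms of the summands are summable when \<open>norm z \<le> 1\<close>, so the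
  series converges absolutely at almost every point.\<close>

definition transfer_series ::
  "'x measure \<Rightarrow> ('x \<Rightarrow> 'x) \<Rightarrow> ('x \<Rightarrow> nat) \<Rightarrow> complex \<Rightarrow> ('x \<Rightarrow> complex) \<Rightarrow> 'x \<Rightarrow> complex" where
  "transfer_series \<mu> F \<phi> z v y = (\<Sum>n. z ^ Suc n * transfer_part \<mu> F \<phi> (Suc n) v y)"

text \<open>The spectrum of an operator \<open>A\<close> on the normed space of classes mod null sets of functions in
  \<open>B\<close>: those \<open>c\<close> for which \<open>c - A\<close> is not a bijection with bounded inverse.\<close>

definition spectrum_on ::
  "'x measure \<Rightarrow> ('x \<Rightarrow> complex) set \<Rightarrow> (('x \<Rightarrow> complex) \<Rightarrow> ennreal) \<Rightarrow>
     (('x \<Rightarrow> complex) \<Rightarrow> 'x \<Rightarrow> complex) \<Rightarrow> complex set" where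
  "spectrum_on \<mu> B nrm A =
     {c. \<not> (\<exists>K::real. \<forall>u\<in>B. \<exists>v\<in>B.
            (AE y in \<mu>. c * v y - A v y = u y) \<and>
            nrm v \<le> ennreal K * nrm u \<and>
            (\<forall>v'\<in>B. (AE y in \<mu>. c * v' y - A v' y = u y) \<longrightarrow> (AE y in \<mu>. v' y = v y)))}"

definition aperiodic ::
  "'x measure \<Rightarrow> ('x \<Rightarrow> 'x) \<Rightarrow> ('x \<Rightarrow> nat) \<Rightarrow> 'x set set \<Rightarrow> real \<Rightarrow> bool" where
  "aperiodic \<mu> F \<phi> \<alpha> \<theta> \<longleftrightarrow>
     (\<forall>z. norm z \<le> 1 \<and> z \<noteq> 1 \<longrightarrow>
        1 \<notin> spectrum_on \<mu> (BY \<mu> F \<alpha> \<theta>) (BY_norm \<mu> F \<alpha> \<theta>) (transfer_series \<mu> F \<phi> z))"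

end

theory Submission
  imports Defs "HOL-Complex_Analysis.Great_Picard"
begin

text \<open>
  Correlations on \<open>X\<close> are correlations on the tower, between the lift \<open>H\<close> of \<open>v\<close> and the lift \<open>W\<close>
  of \<open>w\<close>. Let \<open>f\<close> be the tower map and \<open>L\<close> the adjoint of composition with \<open>f\<close>. Then
  \<open>\<integral> H * (W \<circ> f ^^ n) = \<integral> (L ^^ n) H * W\<close>, so a bound that is uniform in \<open>\<bar>w\<bar> \<le> 1\<close> amounts to the
  convergence of \<open>(L ^^ n) H\<close> to its mean in \<open>L\<^sup>1\<close>.

  \<^emph>\<open>Compactness.\<close> Inverse branches contract the separation metric, and the weight \<open>g\<close> has bounded
  distortion. Hence all iterates \<open>(L ^^ n) H\<close> satisfy the same multiplicative Lipschitz bound on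
  partition elements (\<open>tower_op_power_regular\<close>). Functions with such a bound are compact for pointwise
  convergence, because there are countably many cylinders (\<open>regular_convergent_subsequence\<close>).

  \<^emph>\<open>Limits satisfy an exact equation.\<close> Composition with \<open>f\<close> is an isometry of \<open>L\<^sup>2\<close>, so the squared
  norm of \<open>L H \<circ> f - H\<close> is the loss of squared norm from \<open>H\<close> to \<open>L H\<close>. Along an orbit these losses
  are summable and tend to zero (\<open>koopman_defect_tendsto_0\<close>). Along a subsequence, the base values of
  all time shifts of \<open>(L ^^ n) H\<close> therefore converge to functions \<open>\<psi> i\<close>, \<open>i\<close> an integer, with
  \<open>\<psi> i \<circ> F = \<psi> (i - \<phi>)\<close> (\<open>limit_cocycle\<close>).

  \<^emph>\<open>Rigidity.\<close> Pulling this equation back along inverse branches improves the Lipschitz constant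
  indefinitely, so each \<open>\<psi> i\<close> is constant on partition elements
  (\<open>cocycle_constant_on_elements\<close>). By ergodicity every element returns to itself and reaches every
  other one, and moving along an orbit only shifts the index; so \<open>i \<mapsto> \<psi> i\<close> is periodic. Its
  discrete Fourier coefficient \<open>h\<close> at a root of unity \<open>z\<close> satisfies \<open>h \<circ> F = z ^ \<phi> * h\<close>, which says
  that \<open>h\<close> is a fixed point of \<open>R(z)\<close>. By aperiodicity \<open>h = 0\<close> unless \<open>z = 1\<close>, and the family is one
  constant (\<open>cocycle_constant\<close>), namely the mean of \<open>H\<close>. Since every subsequence of the iterates has
  a further one that converges to the mean, the whole sequence does
  (\<open>tower_op_power_tendsto_mean\<close>).

  \<^emph>\<open>One rate for all observables.\<close> The class of regular functions is itself compact, and the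
  correlations depend on \<open>H\<close> continuously in \<open>L\<^sup>1\<close>, uniformly in time; so the convergence is uniform
  over the class (\<open>tower_corr_uniform\<close>). Every observable belongs to it after scaling and adding a
  constant (\<open>correlation_normalized\<close>); the scaling factor, essentially its norm, becomes the constant
  in front of the common rate.
\<close>

section \<open>Transfer operator and good points of a Gibbs-Markov map\<close>

text \<open>The Gibbs-Markov conditions with the exceptional set \<open>N\<close>, the weight \<open>g\<close> and the distortion
  constant \<open>C0\<close> fixed by name, together with the return time.\<close>

locale gibbs_markov_tower = prob_space \<mu>
  for \<mu> :: "'x measure" +
  fixes F :: "'x \<Rightarrow> 'x" and \<phi> :: "'x \<Rightarrow> nat" and \<alpha> :: "'x set set" and \<theta> :: real
    and N :: "'x set" and g :: "'x \<Rightarrow> real" and C0 :: real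
  assumes ergodic: "ergodic_measure \<mu> F"
    and partition: "partition_mod_null \<mu> \<alpha>"
    and theta: "0 < \<theta>" "\<theta> < 1"
    and N_null: "N \<in> null_sets \<mu>"
    and branch_inj: "\<And>a. a \<in> \<alpha> \<Longrightarrow> inj_on F (a - N)"
    and branch_image: "\<And>a A. a \<in> \<alpha> \<Longrightarrow> A \<in> sets \<mu> \<Longrightarrow> A \<subseteq> a - N \<Longrightarrow> F ` A \<in> sets \<mu>"
    and branch_nonsingular:
      "\<And>a A. a \<in> \<alpha> \<Longrightarrow> A \<in> null_sets \<mu> \<Longrightarrow> A \<subseteq> a - N \<Longrightarrow> F ` A \<in> null_sets \<mu>"
    and branch_markov:
      "\<And>a. a \<in> \<alpha> \<Longrightarrow> \<exists>\<beta>\<subseteq>\<alpha>. AE y in \<mu>. y \<in> F ` (a - N) \<longleftrightarrow> y \<in> \<Union>\<beta>"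
    and sep_finite:
      "\<And>y y'. y \<in> space \<mu> - N \<Longrightarrow> y' \<in> space \<mu> - N \<Longrightarrow> y \<noteq> y' \<Longrightarrow> sep_time \<alpha> F y y' \<noteq> \<infinity>"
    and g_measurable [measurable]: "g \<in> borel_measurable \<mu>"
    and g_pos: "\<And>y. y \<in> space \<mu> \<Longrightarrow> 0 < g y"
    and g_density: "density (comp_measure \<mu> F ((\<lambda>a. a - N) ` \<alpha>)) (\<lambda>y. ennreal (g y)) = \<mu>"
    and g_distortion: "\<And>a y y'. a \<in> \<alpha> \<Longrightarrow> y \<in> a - N \<Longrightarrow> y' \<in> a - N \<Longrightarrow>
      \<bar>ln (g y) - ln (g y')\<bar> \<le> C0 * sep_dist \<theta> \<alpha> F (F y) (F y')"
    and phi_measurable [measurable]: "\<phi> \<in> measurable \<mu> (count_space UNIV)"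
    and phi_pos: "\<And>y. y \<in> space \<mu> \<Longrightarrow> 1 \<le> \<phi> y"
    and phi_const: "\<And>a. a \<in> \<alpha> \<Longrightarrow> \<exists>k. \<forall>y\<in>a. \<phi> y = k"
    and phi_integrable: "integrable \<mu> (\<lambda>y. real (\<phi> y))"
begin

lemma F_measurable [measurable]: "F \<in> measurable \<mu> \<mu>"
  using ergodic by (simp add: ergodic_measure_def invariant_measure_def)

lemma F_invariant: "distr \<mu> \<mu> F = \<mu>"
  using ergodic by (simp add: ergodic_measure_def invariant_measure_def)

lemma F_space: "y \<in> space \<mu> \<Longrightarrow> F y \<in> space \<mu>"
  by (rule measurable_space[OF F_measurable])

lemma F_power_measurable [measurable]: "F ^^ n \<in> measurable \<mu> \<mu>"
proof (induction n)
  case (Suc n)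
  then show ?case
    using measurable_comp[OF Suc F_measurable] by simp
qed (simp add: id_def)

lemma null_vimage: "Z \<in> null_sets \<mu> \<Longrightarrow> F -` Z \<inter> space \<mu> \<in> null_sets \<mu>"
  using emeasure_distr[OF F_measurable, of Z] by (auto simp: F_invariant null_sets_def)

lemma countable_alpha: "countable \<alpha>"
  and alpha_sets: "\<And>a. a \<in> \<alpha> \<Longrightarrow> a \<in> sets \<mu>"
  and alpha_pos: "\<And>a. a \<in> \<alpha> \<Longrightarrow> emeasure \<mu> a > 0"
  and alpha_overlap: "\<And>a b. a \<in> \<alpha> \<Longrightarrow> b \<in> \<alpha> \<Longrightarrow> a \<noteq> b \<Longrightarrow> a \<inter> b \<in> null_sets \<mu>"
  and alpha_cover: "AE y in \<mu>. y \<in> \<Union>\<alpha>"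
  using partition unfolding partition_mod_null_def by auto

lemma alpha_not_null:
  assumes a: "a \<in> \<alpha>"
  shows "\<not> (AE y in \<mu>. y \<notin> a)"
proof
  assume "AE y in \<mu>. y \<notin> a"
  moreover have "{y \<in> space \<mu>. \<not> y \<notin> a} = a"
    using sets.sets_into_space[OF alpha_sets[OF a]] by auto
  ultimately have "emeasure \<mu> a = 0"
    using AE_iff_measurable[of a \<mu> "\<lambda>y. y \<notin> a"] alpha_sets[OF a] by blast
  then show False using alpha_pos[OF a] by simp
qed

lemma N_sets [measurable]: "N \<in> sets \<mu>"
  using N_null by auto

lemma branch_sets: "a \<in> \<alpha> \<Longrightarrow> a - N \<in> sets \<mu>"
  using alpha_sets by auto

lemma branch_image_sets: "a \<in> \<alpha> \<Longrightarrow> F ` (a - N) \<in> sets \<mu>"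
  using branch_image[OF _ branch_sets] by auto


definition inv_branch :: "'x set \<Rightarrow> 'x \<Rightarrow> 'x" where
  "inv_branch a = the_inv_into (a - N) F"

definition branch_op :: "'x set \<Rightarrow> ('x \<Rightarrow> ennreal) \<Rightarrow> 'x \<Rightarrow> ennreal" where
  "branch_op a q y =
     indicator (F ` (a - N)) y * (ennreal (g (inv_branch a y)) * q (inv_branch a y))"

text \<open>The sum of \<open>g x * q x\<close> over the preimages \<open>x\<close> of \<open>y\<close>: a pointwise version of the transfer
  operator. Values in \<open>ennreal\<close> make it meaningful without any summability hypothesis.\<close>

definition ruelle :: "('x \<Rightarrow> ennreal) \<Rightarrow> 'x \<Rightarrow> ennreal" where
  "ruelle q y = (\<integral>\<^sup>+a. branch_op a q y \<partial>count_space \<alpha>)"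

lemma inv_branch_F: "a \<in> \<alpha> \<Longrightarrow> x \<in> a - N \<Longrightarrow> inv_branch a (F x) = x"
  unfolding inv_branch_def by (rule the_inv_into_f_f[OF branch_inj])

lemma F_inv_branch: "a \<in> \<alpha> \<Longrightarrow> y \<in> F ` (a - N) \<Longrightarrow> F (inv_branch a y) = y"
  unfolding inv_branch_def by (rule f_the_inv_into_f[OF branch_inj])

lemma inv_branch_in: "a \<in> \<alpha> \<Longrightarrow> y \<in> F ` (a - N) \<Longrightarrow> inv_branch a y \<in> a - N"
  using inv_branch_F by auto

lemma inv_branch_vimage:
  assumes "a \<in> \<alpha>" "A \<subseteq> a - N"
  shows "inv_branch a -` A \<inter> F ` (a - N) = F ` A"
  using assms inv_branch_F[OF assms(1)] by (auto simp: image_iff subset_eq)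

lemma inv_branch_measurable:
  assumes a: "a \<in> \<alpha>"
  shows "inv_branch a \<in> measurable (restrict_space \<mu> (F ` (a - N))) \<mu>"
proof (rule measurableI)
  have sp: "space (restrict_space \<mu> (F ` (a - N))) = F ` (a - N)"
    using sets.sets_into_space[OF branch_image_sets[OF a]] by (auto simp: space_restrict_space)
  show "inv_branch a x \<in> space \<mu>" if "x \<in> space (restrict_space \<mu> (F ` (a - N)))" for x
    using that inv_branch_in[OF a, of x] sets.sets_into_space[OF branch_sets[OF a]] sp by auto
  fix A assume A: "A \<in> sets \<mu>"
  have "inv_branch a -` A \<inter> F ` (a - N) = inv_branch a -` (A \<inter> (a - N)) \<inter> F ` (a - N)"
    using inv_branch_in[OF a] by auto
  also have "\<dots> = F ` (A \<inter> (a - N))"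
    by (rule inv_branch_vimage[OF a]) auto
  finally show "inv_branch a -` A \<inter> space (restrict_space \<mu> (F ` (a - N)))
      \<in> sets (restrict_space \<mu> (F ` (a - N)))"
    using branch_image[OF a, of "A \<inter> (a - N)"] A branch_sets[OF a] branch_image_sets[OF a]
    by (auto simp: sp sets_restrict_space_iff)
qed

lemma branch_op_measurable [measurable]:
  assumes a: "a \<in> \<alpha>" and [measurable]: "q \<in> borel_measurable \<mu>"
  shows "branch_op a q \<in> borel_measurable \<mu>"
proof -
  note [measurable] = inv_branch_measurable[OF a]
  have "(\<lambda>y. ennreal (g (inv_branch a y)) * q (inv_branch a y))
      \<in> borel_measurable (restrict_space \<mu> (F ` (a - N)))"
    by measurable
  then show ?thesis
    unfolding branch_op_def using branch_image_sets[OF a]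
    by (subst (asm) borel_measurable_restrict_space_iff_ennreal) (auto simp: mult.commute)
qed

lemma sets_comp_measure [measurable_cong]:
  "sets (comp_measure \<mu> F ((\<lambda>a. a - N) ` \<alpha>)) = sets \<mu>"
  unfolding comp_measure_def by (simp add: sets.sigma_sets_eq sets.space_closed)

text \<open>The images of disjoint sets under one branch are disjoint, so that \<open>comp_measure\<close> is indeed
  given by the set function in its definition.\<close>

lemma emeasure_comp_measure:
  assumes A: "A \<in> sets \<mu>"
  shows "emeasure (comp_measure \<mu> F ((\<lambda>a. a - N) ` \<alpha>)) A =
    (\<integral>\<^sup>+c. emeasure \<mu> (F ` (A \<inter> c)) \<partial>count_space ((\<lambda>a. a - N) ` \<alpha>))"
  (is "_ = ?e A")
proof -
  let ?P = "(\<lambda>a. a - N) ` \<alpha>"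
  have pos: "positive (sets \<mu>) ?e"
    by (auto simp: positive_def)
  have add: "countably_additive (sets \<mu>) ?e"
    unfolding countably_additive_def
  proof (intro allI impI)
    fix B :: "nat \<Rightarrow> 'x set"
    assume B: "range B \<subseteq> sets \<mu>" "disjoint_family B"
    have "emeasure \<mu> (F ` (\<Union>(range B) \<inter> c)) = (\<Sum>i. emeasure \<mu> (F ` (B i \<inter> c)))" if "c \<in> ?P" for c
    proof -
      from that obtain a where a: "a \<in> \<alpha>" "c = a - N" by auto
      have s: "range (\<lambda>i. F ` (B i \<inter> c)) \<subseteq> sets \<mu>"
        using branch_image[OF a(1)] B(1) branch_sets[OF a(1)] a(2) by auto
      have "disjoint_family (\<lambda>i. F ` (B i \<inter> c))"
        using B(2) branch_inj[OF a(1)] a(2)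
        unfolding disjoint_family_on_def inj_on_def by (fastforce simp: image_iff)
      from suminf_emeasure[OF s this] have "(\<Sum>i. emeasure \<mu> (F ` (B i \<inter> c))) =
          emeasure \<mu> (\<Union>i. F ` (B i \<inter> c))" .
      also have "(\<Union>i. F ` (B i \<inter> c)) = F ` (\<Union>(range B) \<inter> c)" by auto
      finally show ?thesis ..
    qed
    then have "?e (\<Union>(range B)) = (\<integral>\<^sup>+c. (\<Sum>i. emeasure \<mu> (F ` (B i \<inter> c))) \<partial>count_space ?P)"
      by (intro nn_integral_cong) auto
    also have "\<dots> = (\<Sum>i. ?e (B i))"
      by (rule nn_integral_suminf) auto
    finally show "(\<Sum>i. ?e (B i)) = ?e (\<Union>(range B))" ..
  qed
  show ?thesis
    by (rule emeasure_measure_of[OF comp_measure_def])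
      (use pos add A in \<open>auto simp: sets_comp_measure sets.space_closed\<close>)
qed

text \<open>The other branches meet \<open>A\<close> in null sets, which \<open>F\<close> maps to null sets; so no overlap of the
  partition elements is counted.\<close>

lemma emeasure_comp_measure_branch:
  assumes a: "a \<in> \<alpha>" and A: "A \<in> sets \<mu>" "A \<subseteq> a - N"
  shows "emeasure (comp_measure \<mu> F ((\<lambda>a. a - N) ` \<alpha>)) A = emeasure \<mu> (F ` A)"
proof -
  have "emeasure \<mu> (F ` (A \<inter> c)) = emeasure \<mu> (F ` A) * indicator {a - N} c"
    if c: "c \<in> (\<lambda>a. a - N) ` \<alpha>" for c
  proof (cases "c = a - N")
    case True
    then show ?thesis using A by (simp add: Int_absorb2)
  next
    case False
    then obtain b where b: "b \<in> \<alpha>" "c = b - N" "b \<noteq> a" using c by auto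
    have "A \<inter> c \<in> null_sets \<mu>"
      by (rule null_sets_subset[OF alpha_overlap[OF a b(1)]])
        (use b A branch_sets[OF b(1)] in auto)
    then have "F ` (A \<inter> c) \<in> null_sets \<mu>"
      by (rule branch_nonsingular[OF a]) (use A in auto)
    then show ?thesis using False by auto
  qed
  then have "emeasure (comp_measure \<mu> F ((\<lambda>a. a - N) ` \<alpha>)) A =
      (\<integral>\<^sup>+c. emeasure \<mu> (F ` A) * indicator {a - N} c \<partial>count_space ((\<lambda>a. a - N) ` \<alpha>))"
    by (subst emeasure_comp_measure[OF A(1)]) (auto intro!: nn_integral_cong)
  also have "\<dots> = emeasure \<mu> (F ` A)"
    using a by (subst nn_integral_cmult_indicator) auto
  finally show ?thesis .
qed

text \<open>Change of variables: the inverse branch carries \<open>\<mu>\<close> on the image of \<open>a\<close> to the restriction of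
  \<open>\<mu> \<circ> F\<close> to \<open>a\<close>, with respect to which \<open>\<mu>\<close> has density \<open>g\<close>.\<close>

lemma nn_integral_branch:
  assumes a: "a \<in> \<alpha>" and q[measurable]: "q \<in> borel_measurable \<mu>"
  shows "(\<integral>\<^sup>+x. q x * indicator (a - N) x \<partial>\<mu>) = (\<integral>\<^sup>+y. branch_op a q y \<partial>\<mu>)"
proof -
  let ?\<nu> = "comp_measure \<mu> F ((\<lambda>a. a - N) ` \<alpha>)"
  let ?R = "restrict_space \<mu> (F ` (a - N))"
  note [measurable] = branch_sets[OF a] branch_image_sets[OF a] inv_branch_measurable[OF a]
  have sp: "space ?R = F ` (a - N)"
    using sets.sets_into_space[OF branch_image_sets[OF a]] by (auto simp: space_restrict_space)
  have eq: "distr ?R \<mu> (inv_branch a) = density ?\<nu> (indicator (a - N))"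
  proof (rule measure_eqI)
    show "sets (distr ?R \<mu> (inv_branch a)) = sets (density ?\<nu> (indicator (a - N)))"
      by (simp add: sets_comp_measure)
    fix A assume "A \<in> sets (distr ?R \<mu> (inv_branch a))"
    then have A[measurable]: "A \<in> sets \<mu>" by simp
    have "inv_branch a -` A \<inter> F ` (a - N) = inv_branch a -` (A \<inter> (a - N)) \<inter> F ` (a - N)"
      using inv_branch_in[OF a] by auto
    also have "\<dots> = F ` (A \<inter> (a - N))"
      by (rule inv_branch_vimage[OF a]) auto
    finally have "emeasure (distr ?R \<mu> (inv_branch a)) A = emeasure ?R (F ` (A \<inter> (a - N)))"
      by (subst emeasure_distr) (auto simp: sp)
    also have "\<dots> = emeasure \<mu> (F ` (A \<inter> (a - N)))"
      by (rule emeasure_restrict_space) auto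
    also have "\<dots> = emeasure ?\<nu> (A \<inter> (a - N))"
      by (rule emeasure_comp_measure_branch[OF a, symmetric]) auto
    also have "\<dots> = emeasure (density ?\<nu> (indicator (a - N))) A"
      by (subst emeasure_density) (auto simp: sets_comp_measure nn_integral_indicator Int_commute
          simp flip: indicator_inter_arith)
    finally show "emeasure (distr ?R \<mu> (inv_branch a)) A =
        emeasure (density ?\<nu> (indicator (a - N))) A" .
  qed
  have "(\<integral>\<^sup>+x. q x * indicator (a - N) x \<partial>\<mu>) =
      (\<integral>\<^sup>+x. q x * indicator (a - N) x \<partial>density ?\<nu> (\<lambda>y. ennreal (g y)))"
    by (simp add: g_density)
  also have "\<dots> = (\<integral>\<^sup>+x. ennreal (g x) * (q x * indicator (a - N) x) \<partial>?\<nu>)"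
    by (rule nn_integral_density) measurable
  also have "\<dots> = (\<integral>\<^sup>+x. indicator (a - N) x * (ennreal (g x) * q x) \<partial>?\<nu>)"
    by (simp add: ac_simps)
  also have "\<dots> = (\<integral>\<^sup>+x. ennreal (g x) * q x \<partial>density ?\<nu> (indicator (a - N)))"
    by (rule nn_integral_density[symmetric]) measurable
  also have "\<dots> = (\<integral>\<^sup>+x. ennreal (g x) * q x \<partial>distr ?R \<mu> (inv_branch a))"
    by (simp add: eq)
  also have "\<dots> = (\<integral>\<^sup>+y. ennreal (g (inv_branch a y)) * q (inv_branch a y) \<partial>?R)"
    by (rule nn_integral_distr) measurable
  also have "\<dots> = (\<integral>\<^sup>+y. branch_op a q y \<partial>\<mu>)"
    using branch_image_sets[OF a]
    by (subst nn_integral_restrict_space) (auto simp: branch_op_def[abs_def] mult.commute)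
  finally show ?thesis .
qed

lemma branch_op_mult:
  "a \<in> \<alpha> \<Longrightarrow> branch_op a (\<lambda>x. q x * w (F x)) y = branch_op a q y * w y"
  by (cases "y \<in> F ` (a - N)") (auto simp: branch_op_def F_inv_branch ac_simps)

text \<open>A function of \<open>F x\<close> has the same value at all preimages of a point, so it can be pulled out.\<close>

lemma ruelle_mult: "ruelle (\<lambda>x. q x * w (F x)) y = ruelle q y * w y"
  unfolding ruelle_def by (subst nn_integral_multc[symmetric]) (auto simp: branch_op_mult intro!: nn_integral_cong)

lemma ruelle_measurable [measurable]:
  assumes [measurable]: "q \<in> borel_measurable \<mu>"
  shows "ruelle q \<in> borel_measurable \<mu>"
proof -
  have "(\<lambda>y. \<integral>\<^sup>+a. branch_op a q y \<partial>count_space \<alpha>) \<in> borel_measurable \<mu>"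
  proof (cases "finite \<alpha>")
    case True
    then show ?thesis
      by (simp add: nn_integral_count_space_finite)
  next
    case False
    note * = bij_betw_from_nat_into[OF countable_alpha False]
    have "\<alpha> \<noteq> {}" using False by auto
    then show ?thesis
      by (simp add: nn_integral_bij_count_space[symmetric, OF *] nn_integral_count_space_nat)
        (intro borel_measurable_suminf_order branch_op_measurable from_nat_into, auto)
  qed
  then show ?thesis unfolding ruelle_def[abs_def] .
qed

lemma AE_alpha_disjoint: "AE x in \<mu>. \<forall>a\<in>\<alpha>. \<forall>b\<in>\<alpha>. a \<noteq> b \<longrightarrow> x \<notin> a \<inter> b"
  unfolding AE_ball_countable[OF countable_alpha]
proof (intro ballI)
  fix a b assume "a \<in> \<alpha>" "b \<in> \<alpha>"
  then show "AE x in \<mu>. a \<noteq> b \<longrightarrow> x \<notin> a \<inter> b"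
    by (cases "a = b") (simp_all del: Int_iff add: AE_not_in alpha_overlap)
qed

lemma AE_branch_unique: "AE x in \<mu>. (\<integral>\<^sup>+a. indicator (a - N) x \<partial>count_space \<alpha>) = (1::ennreal)"
  using alpha_cover AE_not_in[OF N_null] AE_alpha_disjoint
proof eventually_elim
  case (elim x)
  then obtain a where a: "a \<in> \<alpha>" "x \<in> a" by auto
  have "(\<integral>\<^sup>+b. indicator (b - N) x \<partial>count_space \<alpha>) = (\<integral>\<^sup>+b. indicator {a} b \<partial>count_space \<alpha>)"
    by (rule nn_integral_cong) (use elim a in \<open>auto simp: indicator_def\<close>)
  also have "\<dots> = 1" using a by simp
  finally show ?case .
qed

lemma nn_integral_ruelle:
  assumes [measurable]: "q \<in> borel_measurable \<mu>"
  shows "(\<integral>\<^sup>+y. ruelle q y \<partial>\<mu>) = (\<integral>\<^sup>+x. q x \<partial>\<mu>)"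
proof -
  have "(\<integral>\<^sup>+y. ruelle q y \<partial>\<mu>) = (\<integral>\<^sup>+a. \<integral>\<^sup>+y. branch_op a q y \<partial>\<mu> \<partial>count_space \<alpha>)"
    unfolding ruelle_def by (rule nn_integral_count_space_nn_integral[OF countable_alpha]) measurable
  also have "\<dots> = (\<integral>\<^sup>+a. \<integral>\<^sup>+x. q x * indicator (a - N) x \<partial>\<mu> \<partial>count_space \<alpha>)"
    by (rule nn_integral_cong) (rule nn_integral_branch[symmetric, OF _ assms], simp)
  also have "\<dots> = (\<integral>\<^sup>+x. \<integral>\<^sup>+a. q x * indicator (a - N) x \<partial>count_space \<alpha> \<partial>\<mu>)"
    by (rule nn_integral_count_space_nn_integral[OF countable_alpha, symmetric])
      (intro borel_measurable_times_ennreal assms borel_measurable_indicator branch_sets)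
  also have "\<dots> = (\<integral>\<^sup>+x. q x * (\<integral>\<^sup>+a. indicator (a - N) x \<partial>count_space \<alpha>) \<partial>\<mu>)"
    by (simp add: nn_integral_cmult)
  also have "\<dots> = (\<integral>\<^sup>+x. q x \<partial>\<mu>)"
    by (rule nn_integral_cong_AE) (use AE_branch_unique in eventually_elim, simp)
  finally show ?thesis .
qed

lemma ruelle_duality:
  assumes [measurable]: "q \<in> borel_measurable \<mu>" "w \<in> borel_measurable \<mu>"
  shows "(\<integral>\<^sup>+x. q x * w (F x) \<partial>\<mu>) = (\<integral>\<^sup>+y. ruelle q y * w y \<partial>\<mu>)"
  using nn_integral_ruelle[of "\<lambda>x. q x * w (F x)"] by (simp add: ruelle_mult)

lemma nn_integral_F:
  assumes [measurable]: "w \<in> borel_measurable \<mu>"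
  shows "(\<integral>\<^sup>+x. w (F x) \<partial>\<mu>) = (\<integral>\<^sup>+x. w x \<partial>\<mu>)"
  using nn_integral_distr[OF F_measurable, of w] by (simp add: F_invariant)

text \<open>By duality, invariance of \<open>\<mu>\<close> says that the transfer operator fixes the constant \<open>1\<close>.\<close>

lemma AE_ruelle_one: "AE y in \<mu>. ruelle (\<lambda>_. 1) y = 1"
proof (rule density_unique_finite_measure)
  fix A assume [measurable]: "A \<in> sets \<mu>"
  show "(\<integral>\<^sup>+x. ruelle (\<lambda>_. 1) x * indicator A x \<partial>\<mu>) = (\<integral>\<^sup>+x. 1 * indicator A x \<partial>\<mu>)"
    using ruelle_duality[of "\<lambda>_. 1" "indicator A"] nn_integral_F[of "indicator A"] by simp
qed auto


text \<open>The hypotheses hold up to null sets only. On a good set they hold everywhere, and since it is closed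
  under \<open>F\<close> and under the inverse branches, neither orbits nor the preimages that enter the transfer
  operator leave it.\<close>

definition good :: "'x set \<Rightarrow> bool" where
  "good G \<longleftrightarrow> G \<in> sets \<mu> \<and> (AE y in \<mu>. y \<in> G) \<and>
     (\<forall>y\<in>G. F y \<in> G) \<and> (\<forall>a\<in>\<alpha>. \<forall>x\<in>a - N. F x \<in> G \<longrightarrow> x \<in> G) \<and>
     G \<inter> N = {} \<and> (\<forall>y\<in>G. \<exists>!a. a \<in> \<alpha> \<and> y \<in> a) \<and>
     (\<forall>a\<in>\<alpha>. \<forall>b\<in>\<alpha>. \<forall>y\<in>b \<inter> G. \<forall>y'\<in>b \<inter> G. y \<in> F ` (a - N) \<longrightarrow> y' \<in> F ` (a - N)) \<and>
     (\<forall>y\<in>G. ruelle (\<lambda>_. 1) y = 1)"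

definition null_step :: "'x set \<Rightarrow> 'x set" where
  "null_step Z = Z \<union> (F -` Z \<inter> space \<mu>) \<union> (\<Union>a\<in>\<alpha>. F ` (Z \<inter> (a - N)))"

lemma null_step_null:
  assumes Z: "Z \<in> null_sets \<mu>"
  shows "null_step Z \<in> null_sets \<mu>"
  unfolding null_step_def
proof (intro null_sets.Un null_sets_UN' countable_alpha Z null_vimage)
  fix a assume a: "a \<in> \<alpha>"
  have "Z \<inter> (a - N) \<in> null_sets \<mu>"
    using null_set_Int2[OF Z branch_sets[OF a]] by (simp add: Int_commute)
  then show "F ` (Z \<inter> (a - N)) \<in> null_sets \<mu>"
    by (rule branch_nonsingular[OF a]) auto
qed

text \<open>Null sets are carried to null sets by \<open>F\<close>, by its preimage and by its branches, so
  saturating a null set under all of them leaves a null set.\<close>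

lemma good_exists:
  assumes Z: "Z \<in> null_sets \<mu>"
  obtains G where "good G" "G \<inter> Z = {}"
proof -
  have "\<forall>a\<in>\<alpha>. \<exists>\<beta>. \<beta> \<subseteq> \<alpha> \<and> (AE y in \<mu>. y \<in> F ` (a - N) \<longleftrightarrow> y \<in> \<Union>\<beta>)"
    using branch_markov by blast
  then obtain \<beta> where \<beta>: "\<And>a. a \<in> \<alpha> \<Longrightarrow> \<beta> a \<subseteq> \<alpha>"
    "\<And>a. a \<in> \<alpha> \<Longrightarrow> AE y in \<mu>. y \<in> F ` (a - N) \<longleftrightarrow> y \<in> \<Union>(\<beta> a)"
    by metis
  have markov: "AE y in \<mu>. \<forall>a\<in>\<alpha>. y \<in> F ` (a - N) \<longleftrightarrow> y \<in> \<Union>(\<beta> a)"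
    using \<beta>(2) unfolding AE_ball_countable[OF countable_alpha] by blast
  define P where "P y \<longleftrightarrow> y \<notin> Z \<and> y \<notin> N \<and> y \<in> \<Union>\<alpha> \<and> (\<forall>a\<in>\<alpha>. \<forall>b\<in>\<alpha>. a \<noteq> b \<longrightarrow> y \<notin> a \<inter> b) \<and>
    (\<forall>a\<in>\<alpha>. y \<in> F ` (a - N) \<longleftrightarrow> y \<in> \<Union>(\<beta> a)) \<and> ruelle (\<lambda>_. 1) y = 1" for y
  have "AE y in \<mu>. P y"
    using AE_not_in[OF Z] AE_not_in[OF N_null] alpha_cover AE_alpha_disjoint markov AE_ruelle_one
    unfolding P_def by eventually_elim blast
  then obtain Z0 where Z0: "Z0 \<in> null_sets \<mu>" "{y \<in> space \<mu>. \<not> P y} \<subseteq> Z0"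
    by (auto elim!: AE_E simp: null_sets_def)
  define Z1 where "Z1 = (\<Union>n. (null_step ^^ n) Z0)"
  have "(null_step ^^ n) Z0 \<in> null_sets \<mu>" for n
    by (induction n) (auto simp: Z0(1) intro: null_step_null)
  then have Z1: "Z1 \<in> null_sets \<mu>"
    unfolding Z1_def by (intro null_sets_UN) auto
  have step: "null_step Z1 \<subseteq> Z1"
  proof
    fix y assume "y \<in> null_step Z1"
    then obtain n where "y \<in> null_step ((null_step ^^ n) Z0)"
      unfolding null_step_def Z1_def by blast
    then have "y \<in> (null_step ^^ Suc n) Z0" by simp
    then show "y \<in> Z1" unfolding Z1_def by blast
  qed
  have "Z0 \<subseteq> Z1"
    unfolding Z1_def by (rule order_trans[OF _ UN_upper[of 0]]) auto
  define G where "G = space \<mu> - Z1"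
  have P_notin: "y \<notin> Z" "y \<notin> N" and P_cover: "\<exists>a\<in>\<alpha>. y \<in> a"
    and P_unique: "\<And>a b. a \<in> \<alpha> \<Longrightarrow> b \<in> \<alpha> \<Longrightarrow> y \<in> a \<Longrightarrow> y \<in> b \<Longrightarrow> a = b"
    and P_markov: "\<And>a. a \<in> \<alpha> \<Longrightarrow> y \<in> F ` (a - N) \<longleftrightarrow> y \<in> \<Union>(\<beta> a)"
    and P_one: "ruelle (\<lambda>_. 1) y = 1" if "P y" for y
    using that unfolding P_def by (fast, fast, fast, fast, metis, fast)
  have GP: "P y" if "y \<in> G" for y
    using that Z0(2) \<open>Z0 \<subseteq> Z1\<close> by (auto simp: G_def)
  have "good G"
    unfolding good_def
  proof (intro conjI ballI impI)
    show "G \<in> sets \<mu>"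
      unfolding G_def using Z1 by auto
    show "AE y in \<mu>. y \<in> G"
      using AE_not_in[OF Z1] AE_space unfolding G_def by eventually_elim auto
    show "F y \<in> G" if "y \<in> G" for y
    proof -
      have "F y \<notin> Z1"
      proof
        assume "F y \<in> Z1"
        with that have "y \<in> null_step Z1" by (simp add: G_def null_step_def)
        with step that show False by (auto simp: G_def)
      qed
      with that F_space show ?thesis by (simp add: G_def)
    qed
    show "x \<in> G" if "a \<in> \<alpha>" "x \<in> a - N" "F x \<in> G" for a x
    proof -
      have "x \<notin> Z1"
      proof
        assume "x \<in> Z1"
        with that have "F x \<in> null_step Z1" by (auto simp: null_step_def)
        with step that show False by (auto simp: G_def)
      qed
      with that sets.sets_into_space[OF alpha_sets[OF that(1)]] show ?thesis by (auto simp: G_def)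
    qed
    show "G \<inter> N = {}"
      using GP P_notin by blast
    show "\<exists>!a. a \<in> \<alpha> \<and> y \<in> a" if "y \<in> G" for y
      using P_cover[OF GP[OF that]] P_unique[OF GP[OF that]] by blast
    show "y' \<in> F ` (a - N)"
      if a: "a \<in> \<alpha>" "b \<in> \<alpha>" "y \<in> b \<inter> G" "y' \<in> b \<inter> G" "y \<in> F ` (a - N)" for a b y y'
    proof -
      have "P y" "P y'" using a GP by auto
      from P_markov[OF this(1) a(1)] a(5) obtain c where c: "c \<in> \<beta> a" "y \<in> c" by blast
      then have "c = b" using P_unique[OF \<open>P y\<close>, of c b] a(2,3) \<beta>(1)[OF a(1)] by auto
      with c a(4) P_markov[OF \<open>P y'\<close> a(1)] show ?thesis by blast
    qed
    show "ruelle (\<lambda>_. 1) y = 1" if "y \<in> G" for y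
      using P_one[OF GP[OF that]] .
  qed
  moreover have "G \<inter> Z = {}"
    using GP P_notin by blast
  ultimately show thesis by (rule that)
qed

lemma goodD:
  assumes "good G"
  shows "G \<in> sets \<mu>" "AE y in \<mu>. y \<in> G" "\<And>y. y \<in> G \<Longrightarrow> F y \<in> G"
    "\<And>a x. a \<in> \<alpha> \<Longrightarrow> x \<in> a - N \<Longrightarrow> F x \<in> G \<Longrightarrow> x \<in> G"
    "\<And>y. y \<in> G \<Longrightarrow> y \<notin> N" "\<And>y. y \<in> G \<Longrightarrow> \<exists>a\<in>\<alpha>. y \<in> a"
    "\<And>y a b. y \<in> G \<Longrightarrow> a \<in> \<alpha> \<Longrightarrow> b \<in> \<alpha> \<Longrightarrow> y \<in> a \<Longrightarrow> y \<in> b \<Longrightarrow> a = b"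
    "\<And>a b y y'. a \<in> \<alpha> \<Longrightarrow> b \<in> \<alpha> \<Longrightarrow> y \<in> b \<Longrightarrow> y \<in> G \<Longrightarrow> y' \<in> b \<Longrightarrow> y' \<in> G \<Longrightarrow>
      y \<in> F ` (a - N) \<Longrightarrow> y' \<in> F ` (a - N)"
    "\<And>y. y \<in> G \<Longrightarrow> ruelle (\<lambda>_. 1) y = 1" "\<And>y. y \<in> G \<Longrightarrow> y \<in> space \<mu>"
proof -
  have G: "G \<in> sets \<mu>" "AE y in \<mu>. y \<in> G" "\<forall>y\<in>G. F y \<in> G"
    "\<forall>a\<in>\<alpha>. \<forall>x\<in>a - N. F x \<in> G \<longrightarrow> x \<in> G" "G \<inter> N = {}" "\<forall>y\<in>G. \<exists>!a. a \<in> \<alpha> \<and> y \<in> a"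
    "\<forall>a\<in>\<alpha>. \<forall>b\<in>\<alpha>. \<forall>y\<in>b \<inter> G. \<forall>y'\<in>b \<inter> G. y \<in> F ` (a - N) \<longrightarrow> y' \<in> F ` (a - N)"
    "\<forall>y\<in>G. ruelle (\<lambda>_. 1) y = 1"
    using assms unfolding good_def by - (elim conjE, assumption)+
  show "G \<in> sets \<mu>" "AE y in \<mu>. y \<in> G" by (rule G(1), rule G(2))
  show "\<And>y. y \<in> G \<Longrightarrow> F y \<in> G" using G(3) by simp
  show "\<And>a x. a \<in> \<alpha> \<Longrightarrow> x \<in> a - N \<Longrightarrow> F x \<in> G \<Longrightarrow> x \<in> G" using G(4) by simp
  show "\<And>y. y \<in> G \<Longrightarrow> y \<notin> N" using G(5) by (simp add: disjoint_iff)
  show "\<And>y. y \<in> G \<Longrightarrow> ruelle (\<lambda>_. 1) y = 1" using G(8) by simp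
  show "\<And>y. y \<in> G \<Longrightarrow> y \<in> space \<mu>" by (rule subsetD[OF sets.sets_into_space[OF G(1)]])
  show "\<exists>a\<in>\<alpha>. y \<in> a" if "y \<in> G" for y
    using bspec[OF G(6) that] by (elim ex1E conjE) (rule bexI)
  show "a = b" if "y \<in> G" "a \<in> \<alpha>" "b \<in> \<alpha>" "y \<in> a" "y \<in> b" for y a b
    by (rule ex1E[OF bspec[OF G(6) that(1)]]) (use that(2-) in metis)
  show "y' \<in> F ` (a - N)" if "a \<in> \<alpha>" "b \<in> \<alpha>" "y \<in> b" "y \<in> G" "y' \<in> b" "y' \<in> G" "y \<in> F ` (a - N)"
    for a b y y'
    using G(7)[rule_format, OF that(1,2), of y y'] that(3-) by simp
qed

text \<open>Whatever holds almost everywhere may hence be assumed to hold everywhere on a good set.\<close>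

lemma good_subset_exists:
  assumes "AE y in \<mu>. P y"
  obtains G where "good G" "\<And>y. y \<in> G \<Longrightarrow> P y"
proof -
  from assms obtain Z where Z: "Z \<in> null_sets \<mu>" "{y \<in> space \<mu>. \<not> P y} \<subseteq> Z"
    by (auto elim!: AE_E simp: null_sets_def)
  obtain G where G: "good G" "G \<inter> Z = {}" by (rule good_exists[OF Z(1)])
  show thesis
  proof (rule that[OF G(1)])
    show "P y" if "y \<in> G" for y
    proof (rule ccontr)
      assume "\<not> P y"
      with goodD(10)[OF G(1) that] Z(2) have "y \<in> Z" by (simp add: subset_eq)
      with that G(2) show False by (simp add: disjoint_iff)
    qed
  qed
qed

text \<open>At a point without preimages the transfer operator of \<open>1\<close> would vanish.\<close>

lemma good_branch:
  assumes "good G" "y \<in> G"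
  obtains a x where "a \<in> \<alpha>" "x \<in> a" "x \<in> G" "F x = y"
proof -
  have "\<exists>a\<in>\<alpha>. y \<in> F ` (a - N)"
  proof (rule ccontr)
    assume "\<not> ?thesis"
    then have "ruelle (\<lambda>_. 1) y = (\<integral>\<^sup>+a. 0 \<partial>count_space \<alpha>)"
      unfolding ruelle_def by (intro nn_integral_cong) (simp add: branch_op_def)
    then show False using goodD(9)[OF assms] by simp
  qed
  then obtain a x where x: "a \<in> \<alpha>" "x \<in> a - N" "y = F x" by (elim bexE imageE)
  show thesis
    using x goodD(4)[OF assms(1) x(1,2)] assms(2) by (intro that[of a x]) simp_all
qed

end

section \<open>Separation metric and distortion\<close>

definition separated_at :: "'x set set \<Rightarrow> ('x \<Rightarrow> 'x) \<Rightarrow> 'x \<Rightarrow> 'x \<Rightarrow> nat \<Rightarrow> bool" where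
  "separated_at \<alpha> F y y' n \<longleftrightarrow> (\<exists>a\<in>\<alpha>. \<exists>b\<in>\<alpha>. a \<noteq> b \<and> (F ^^ n) y \<in> a \<and> (F ^^ n) y' \<in> b)"

lemma sep_dist_eq:
  "sep_dist \<theta> \<alpha> F y y' =
    (if \<exists>n. separated_at \<alpha> F y y' n then \<theta> ^ (LEAST n. separated_at \<alpha> F y y' n) else 0)"
proof -
  let ?P = "separated_at \<alpha> F y y'"
  have "sep_time \<alpha> F y y' = (INF n\<in>{n. ?P n}. enat n)"
    by (simp add: sep_time_def separated_at_def)
  also have "\<dots> = (if \<exists>n. ?P n then enat (LEAST n. ?P n) else \<infinity>)"
  proof (cases "\<exists>n. ?P n")
    case True
    have "(INF n\<in>{n. ?P n}. enat n) = enat (LEAST n. ?P n)"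
    proof (rule antisym)
      show "(INF n\<in>{n. ?P n}. enat n) \<le> enat (LEAST n. ?P n)"
        by (rule INF_lower) (use LeastI_ex[OF True] in simp)
      show "enat (LEAST n. ?P n) \<le> (INF n\<in>{n. ?P n}. enat n)"
        by (rule INF_greatest) (simp add: Least_le)
    qed
    with True show ?thesis by simp
  qed (simp add: Inf_enat_def)
  finally show ?thesis
    by (simp add: sep_dist_def)
qed

context gibbs_markov_tower
begin

abbreviation d :: "'x \<Rightarrow> 'x \<Rightarrow> real" where
  "d \<equiv> sep_dist \<theta> \<alpha> F"

lemma dist_nonneg: "0 \<le> d y y'"
  using theta by (simp add: sep_dist_eq)

lemma dist_le_1: "d y y' \<le> 1"
  using theta by (simp add: sep_dist_eq power_le_one)

context
  fixes G assumes G: "good G"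
begin

lemma F_power_good: "y \<in> G \<Longrightarrow> (F ^^ n) y \<in> G"
  by (induction n) (auto intro: goodD(3)[OF G])

lemma dist_pos:
  assumes "y \<in> G" "y' \<in> G" "y \<noteq> y'"
  shows "0 < d y y'"
proof -
  have "sep_time \<alpha> F y y' \<noteq> \<infinity>"
    using assms goodD(5,10)[OF G] by (intro sep_finite) auto
  then show ?thesis
    using theta by (cases "sep_time \<alpha> F y y'") (auto simp: sep_dist_def)
qed

text \<open>Points of one element are not separated at time \<open>0\<close>, so they separate one step later than their
  images do.\<close>

lemma dist_step:
  assumes a: "a \<in> \<alpha>" "y \<in> a" "y' \<in> a" and y: "y \<in> G" "y' \<in> G"
  shows "d y y' = \<theta> * d (F y) (F y')"
proof -
  let ?P = "separated_at \<alpha> F"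
  have 0: "\<not> ?P y y' 0"
  proof
    assume "?P y y' 0"
    then obtain b c where bc: "b \<in> \<alpha>" "c \<in> \<alpha>" "b \<noteq> c" "y \<in> b" "y' \<in> c" by (auto simp: separated_at_def)
    have "b = a" "c = a"
      using goodD(7)[OF G y(1) bc(1) a(1)] goodD(7)[OF G y(2) bc(2) a(1)] bc a by simp_all
    with bc show False by simp
  qed
  have Suc: "?P y y' (Suc n) = ?P (F y) (F y') n" for n
    by (simp add: separated_at_def funpow_Suc_right del: funpow.simps)
  show ?thesis
  proof (cases "\<exists>n. ?P y y' n")
    case True
    then obtain n where n: "?P y y' n" by blast
    have "(LEAST n. ?P y y' n) = Suc (LEAST n. ?P (F y) (F y') n)"
      using Least_Suc[OF n 0] by (simp add: Suc)
    moreover have "\<exists>n. ?P (F y) (F y') n"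
      using n 0 Suc by (cases n) auto
    ultimately show ?thesis using True by (simp add: sep_dist_eq)
  next
    case False
    then have "\<not> (\<exists>n. ?P (F y) (F y') n)" by (simp flip: Suc)
    with False show ?thesis by (simp add: sep_dist_eq)
  qed
qed

lemma dist_le_power:
  assumes y: "y \<in> G" "y' \<in> G"
    and same: "\<And>j. j < k \<Longrightarrow> \<exists>a\<in>\<alpha>. (F ^^ j) y \<in> a \<and> (F ^^ j) y' \<in> a"
  shows "d y y' \<le> \<theta> ^ k"
proof -
  let ?P = "separated_at \<alpha> F y y'"
  have "k \<le> n" if "?P n" for n
  proof (rule ccontr)
    assume "\<not> k \<le> n"
    then obtain c where c: "c \<in> \<alpha>" "(F ^^ n) y \<in> c" "(F ^^ n) y' \<in> c" using same[of n] by (auto simp: not_le)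
    obtain a b where ab: "a \<in> \<alpha>" "b \<in> \<alpha>" "a \<noteq> b" "(F ^^ n) y \<in> a" "(F ^^ n) y' \<in> b"
      using \<open>?P n\<close> by (auto simp: separated_at_def)
    have "a = c" "b = c"
      using goodD(7)[OF G F_power_good[OF y(1)] ab(1) c(1)]
        goodD(7)[OF G F_power_good[OF y(2)] ab(2) c(1)] ab c by simp_all
    with ab show False by simp
  qed
  then have "k \<le> (LEAST n. ?P n)" if "\<exists>n. ?P n"
    using LeastI_ex[OF that] by blast
  then show ?thesis
    using theta by (auto simp: sep_dist_eq intro: power_decreasing)
qed

text \<open>There are only countably many cylinders, so one point from each cylinder meeting \<open>G\<close>
  gives a countable dense set.\<close>

lemma countable_dense:
  obtains D where "countable D" "D \<subseteq> G"
    "\<And>y k. y \<in> G \<Longrightarrow> \<exists>x\<in>D. (\<exists>a\<in>\<alpha>. x \<in> a \<and> y \<in> a) \<and> d y x \<le> \<theta> ^ k"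
proof -
  define elt where "elt y = (SOME a. a \<in> \<alpha> \<and> y \<in> a)" for y
  have elt: "elt y \<in> \<alpha>" "y \<in> elt y" if "y \<in> G" for y
  proof -
    have "\<exists>a. a \<in> \<alpha> \<and> y \<in> a" using goodD(6)[OF G that] by blast
    from someI_ex[OF this] show "elt y \<in> \<alpha>" "y \<in> elt y" by (auto simp: elt_def)
  qed
  define itin where "itin k y = map (\<lambda>j. elt ((F ^^ j) y)) [0..<k]" for k y
  define rep where "rep k w = (SOME y. y \<in> G \<and> itin k y = w)" for k w
  have rep: "rep k (itin k y) \<in> G" "itin k (rep k (itin k y)) = itin k y" if "y \<in> G" for k y
  proof -
    have "\<exists>z. z \<in> G \<and> itin k z = itin k y" using that by blast
    from someI_ex[OF this] show "rep k (itin k y) \<in> G" "itin k (rep k (itin k y)) = itin k y"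
      by (auto simp: rep_def)
  qed
  define D where "D = (\<Union>k. rep k ` itin k ` G)"
  have "itin k ` G \<subseteq> lists \<alpha>" for k
    using elt(1) F_power_good by (auto simp: itin_def)
  then have cI: "countable (itin k ` G)" for k
    by (rule countable_subset[OF _ countable_lists[OF countable_alpha]])
  have "countable D"
    unfolding D_def by (rule countable_UN) (simp, rule countable_image, rule cI)
  moreover have "D \<subseteq> G" unfolding D_def using rep(1) by (intro UN_least image_subsetI) (elim imageE, simp)
  moreover have "\<exists>x\<in>D. (\<exists>a\<in>\<alpha>. x \<in> a \<and> y \<in> a) \<and> d y x \<le> \<theta> ^ k" if y: "y \<in> G" for y k
  proof -
    define x where "x = rep (Suc k) (itin (Suc k) y)"
    have x: "x \<in> G" "itin (Suc k) x = itin (Suc k) y"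
      unfolding x_def using rep[OF y, of "Suc k"] by blast+
    have "x \<in> D" unfolding D_def x_def using y by (intro UN_I[of "Suc k"] imageI) simp_all
    have "elt ((F ^^ j) x) = elt ((F ^^ j) y)" if "j < Suc k" for j
      using arg_cong[OF x(2), of "\<lambda>w. w ! j"] that unfolding itin_def
      by (simp del: upt_Suc)
    then have same: "\<exists>a\<in>\<alpha>. (F ^^ j) y \<in> a \<and> (F ^^ j) x \<in> a" if "j < Suc k" for j
      using elt[OF F_power_good[OF y, of j]] elt(2)[OF F_power_good[OF x(1), of j]] that by auto
    have "d y x \<le> \<theta> ^ Suc k"
      by (rule dist_le_power[OF y x(1) same])
    also have "\<dots> \<le> \<theta> ^ k" using theta by (intro power_decreasing) auto
    finally show ?thesis
      using same[of 0] \<open>x \<in> D\<close> by auto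
  qed
  ultimately show thesis by (rule that)
qed

lemma inv_branch_good:
  assumes "a \<in> \<alpha>" "y \<in> G" "y \<in> F ` (a - N)"
  shows "inv_branch a y \<in> G" "inv_branch a y \<in> a" "F (inv_branch a y) = y"
  using goodD(4)[OF G assms(1) inv_branch_in[OF assms(1,3)]] inv_branch_in[OF assms(1,3)]
    F_inv_branch[OF assms(1,3)] assms(2) by auto

lemma ruelle_mono:
  assumes "y \<in> G" and "\<And>x. x \<in> G \<Longrightarrow> q x \<le> q' x"
  shows "ruelle q y \<le> ruelle q' y"
  unfolding ruelle_def
proof (rule nn_integral_mono)
  fix a assume "a \<in> space (count_space \<alpha>)"
  then have "a \<in> \<alpha>" by simp
  with assms(2) inv_branch_good(1)[OF _ assms(1)] show "branch_op a q y \<le> branch_op a q' y"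
    by (cases "y \<in> F ` (a - N)") (auto simp: branch_op_def intro!: mult_left_mono)
qed

lemma ruelle_const: "y \<in> G \<Longrightarrow> ruelle (\<lambda>_. c) y = c"
  using ruelle_mult[of "\<lambda>_. 1" "\<lambda>_. c" y] goodD(9)[OF G] by simp

lemma g_ratio:
  assumes "a \<in> \<alpha>" "x \<in> a" "x' \<in> a" "x \<in> G" "x' \<in> G"
  shows "g x \<le> exp (C0 * d (F x) (F x')) * g x'"
proof -
  have pos: "0 < g x" "0 < g x'" using g_pos goodD(10)[OF G] assms by auto
  have "ln (g x) \<le> C0 * d (F x) (F x') + ln (g x')"
    using g_distortion[of a x x'] assms goodD(5)[OF G] by (simp add: abs_le_iff)
  then have "exp (ln (g x)) \<le> exp (C0 * d (F x) (F x') + ln (g x'))" by simp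
  then show ?thesis using pos by (simp add: exp_add)
qed

text \<open>One application of the transfer operator contracts distances along every branch by \<open>\<theta>\<close> and
  adds the distortion of the weight, which is why the constant \<open>K\<close> turns into \<open>C0 + \<theta> * K\<close>.\<close>

lemma ruelle_regular:
  assumes K: "0 \<le> K" and nonneg: "\<And>x. x \<in> G \<Longrightarrow> 0 \<le> q x"
    and q: "\<And>a x x'. a \<in> \<alpha> \<Longrightarrow> x \<in> a \<Longrightarrow> x' \<in> a \<Longrightarrow> x \<in> G \<Longrightarrow> x' \<in> G \<Longrightarrow> q x \<le> exp (K * d x x') * q x'"
    and b: "b \<in> \<alpha>" "y \<in> b" "y' \<in> b" "y \<in> G" "y' \<in> G"
  shows "ruelle (\<lambda>x. ennreal (q x)) y \<le>
    ennreal (exp ((C0 + \<theta> * K) * d y y')) * ruelle (\<lambda>x. ennreal (q x)) y'"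
proof -
  let ?e = "ennreal (exp ((C0 + \<theta> * K) * d y y'))"
  have "branch_op a (\<lambda>x. ennreal (q x)) y \<le> ?e * branch_op a (\<lambda>x. ennreal (q x)) y'"
    if a: "a \<in> \<alpha>" for a
  proof (cases "y \<in> F ` (a - N)")
    case True
    then have True': "y' \<in> F ` (a - N)"
      by (rule goodD(8)[OF G a b(1,2,4,3,5)])
    let ?x = "inv_branch a y" and ?x' = "inv_branch a y'"
    note x = inv_branch_good[OF a b(4) True] and x' = inv_branch_good[OF a b(5) True']
    have gx: "0 < g ?x" "0 < g ?x'" using g_pos goodD(10)[OF G] x(1) x'(1) by auto
    have "d ?x ?x' = \<theta> * d y y'"
      using dist_step[OF a x(2) x'(2) x(1) x'(1)] x(3) x'(3) by simp
    then have "g ?x * q ?x \<le> (exp (C0 * d y y') * g ?x') * (exp (K * (\<theta> * d y y')) * q ?x')"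
      using g_ratio[OF a x(2) x'(2) x(1) x'(1)] q[OF a x(2) x'(2) x(1) x'(1)] gx x(1,3) x'(1,3)
        nonneg by (intro mult_mono) auto
    also have "\<dots> = exp ((C0 + \<theta> * K) * d y y') * (g ?x' * q ?x')"
      by (simp add: exp_add algebra_simps)
    finally have "ennreal (g ?x * q ?x) \<le> ennreal (exp ((C0 + \<theta> * K) * d y y') * (g ?x' * q ?x'))"
      by (rule ennreal_leI)
    then show ?thesis
      using True True' gx nonneg[OF x(1)] nonneg[OF x'(1)]
      by (simp add: branch_op_def ennreal_mult)
  qed (simp add: branch_op_def)
  then have "ruelle (\<lambda>x. ennreal (q x)) y \<le> (\<integral>\<^sup>+a. ?e * branch_op a (\<lambda>x. ennreal (q x)) y' \<partial>count_space \<alpha>)"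
    unfolding ruelle_def by (intro nn_integral_mono) auto
  also have "\<dots> = ?e * ruelle (\<lambda>x. ennreal (q x)) y'"
    unfolding ruelle_def by (rule nn_integral_cmult) simp
  finally show ?thesis .
qed

end

definition real_ruelle :: "('x \<Rightarrow> real) \<Rightarrow> 'x \<Rightarrow> real" where
  "real_ruelle q y = enn2real (ruelle (\<lambda>x. ennreal (q x)) y)"

lemma real_ruelle_measurable [measurable]:
  "q \<in> borel_measurable \<mu> \<Longrightarrow> real_ruelle q \<in> borel_measurable \<mu>"
  unfolding real_ruelle_def[abs_def] by measurable

lemma real_ruelle_nonneg: "0 \<le> real_ruelle q y"
  by (simp add: real_ruelle_def)

context
  fixes G assumes G: "good G"
begin

lemma ennreal_real_ruelle:
  assumes "y \<in> G" "\<And>x. x \<in> G \<Longrightarrow> q x \<le> B"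
  shows "ennreal (real_ruelle q y) = ruelle (\<lambda>x. ennreal (q x)) y"
proof -
  have "ruelle (\<lambda>x. ennreal (q x)) y \<le> ruelle (\<lambda>_. ennreal B) y"
    by (rule ruelle_mono[OF G assms(1)]) (use assms(2) in \<open>auto intro: ennreal_leI\<close>)
  also have "\<dots> = ennreal B" by (rule ruelle_const[OF G assms(1)])
  finally have "ruelle (\<lambda>x. ennreal (q x)) y < top"
    by (rule le_less_trans) simp
  then show ?thesis by (simp add: real_ruelle_def)
qed

lemma real_ruelle_le:
  assumes "y \<in> G" "\<And>x. x \<in> G \<Longrightarrow> q x \<le> B" "0 \<le> B"
  shows "real_ruelle q y \<le> B"
proof -
  have "ennreal (real_ruelle q y) \<le> ruelle (\<lambda>_. ennreal B) y"
    by (subst ennreal_real_ruelle[of y q B], rule assms, erule assms, rule ruelle_mono[OF G assms(1)]) (use assms(2) in \<open>auto intro: ennreal_leI\<close>)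
  then show ?thesis using assms(3) by (simp add: ruelle_const[OF G assms(1)])
qed

lemma real_ruelle_ge:
  assumes "y \<in> G" "\<And>x. x \<in> G \<Longrightarrow> b \<le> q x" "\<And>x. x \<in> G \<Longrightarrow> q x \<le> B"
  shows "b \<le> real_ruelle q y"
proof -
  have "ruelle (\<lambda>_. ennreal b) y \<le> ennreal (real_ruelle q y)"
    by (subst ennreal_real_ruelle[of y q B], rule assms, erule assms, rule ruelle_mono[OF G assms(1)]) (use assms(2) in \<open>auto intro: ennreal_leI\<close>)
  then show ?thesis
    by (simp add: ruelle_const[OF G assms(1)] ennreal_le_iff2 real_ruelle_nonneg)
       (metis real_ruelle_nonneg order_trans)
qed

lemma real_ruelle_regular:
  assumes K: "0 \<le> K" and bounds: "\<And>x. x \<in> G \<Longrightarrow> 0 \<le> q x" "\<And>x. x \<in> G \<Longrightarrow> q x \<le> B"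
    and q: "\<And>a x x'. a \<in> \<alpha> \<Longrightarrow> x \<in> a \<Longrightarrow> x' \<in> a \<Longrightarrow> x \<in> G \<Longrightarrow> x' \<in> G \<Longrightarrow> q x \<le> exp (K * d x x') * q x'"
    and b: "b \<in> \<alpha>" "y \<in> b" "y' \<in> b" "y \<in> G" "y' \<in> G"
  shows "real_ruelle q y \<le> exp ((C0 + \<theta> * K) * d y y') * real_ruelle q y'"
proof -
  have "ennreal (real_ruelle q y) \<le> ennreal (exp ((C0 + \<theta> * K) * d y y')) * ennreal (real_ruelle q y')"
    using ruelle_regular[OF G K bounds(1) q b]
    by (simp add: ennreal_real_ruelle[OF _ bounds(2)] b)
  then show ?thesis
    by (simp add: real_ruelle_nonneg flip: ennreal_mult)
qed

lemma bounded_integrable: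
  fixes f :: "'x \<Rightarrow> real"
  assumes [measurable]: "f \<in> borel_measurable \<mu>" and "\<And>y. y \<in> G \<Longrightarrow> \<bar>f y\<bar> \<le> B"
  shows "integrable \<mu> f"
proof (rule integrable_const_bound[where B=B])
  show "AE x in \<mu>. norm (f x) \<le> B"
    using goodD(2)[OF G] by eventually_elim (use assms(2) in simp)
qed simp

lemma real_ruelle_duality:
  assumes [measurable]: "q \<in> borel_measurable \<mu>" "w \<in> borel_measurable \<mu>"
    and q: "\<And>x. x \<in> G \<Longrightarrow> 0 \<le> q x" "\<And>x. x \<in> G \<Longrightarrow> q x \<le> B"
    and w: "\<And>x. x \<in> G \<Longrightarrow> 0 \<le> w x"
  shows "(\<integral>x. q x * w (F x) \<partial>\<mu>) = (\<integral>y. real_ruelle q y * w y \<partial>\<mu>)"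
proof -
  have AEG: "AE x in \<mu>. x \<in> G" by (rule goodD(2)[OF G])
  have "(\<integral>x. q x * w (F x) \<partial>\<mu>) = enn2real (\<integral>\<^sup>+x. ennreal (q x * w (F x)) \<partial>\<mu>)"
    by (rule integral_eq_nn_integral) 
      (use AEG goodD(3)[OF G] q w in \<open>auto elim!: eventually_mono\<close>)
  also have "(\<integral>\<^sup>+x. ennreal (q x * w (F x)) \<partial>\<mu>) = (\<integral>\<^sup>+x. ennreal (q x) * ennreal (w (F x)) \<partial>\<mu>)"
    by (rule nn_integral_cong_AE)
      (use AEG goodD(3)[OF G] q w in \<open>auto elim!: eventually_mono simp: ennreal_mult\<close>)
  also have "\<dots> = (\<integral>\<^sup>+y. ruelle (\<lambda>x. ennreal (q x)) y * ennreal (w y) \<partial>\<mu>)"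
    by (rule ruelle_duality) measurable
  also have "\<dots> = (\<integral>\<^sup>+y. ennreal (real_ruelle q y * w y) \<partial>\<mu>)"
    by (rule nn_integral_cong_AE)
      (use AEG w in \<open>auto elim!: eventually_mono
        simp: ennreal_mult real_ruelle_nonneg ennreal_real_ruelle[OF _ q(2)]\<close>)
  also have "enn2real \<dots> = (\<integral>y. real_ruelle q y * w y \<partial>\<mu>)"
    by (rule integral_eq_nn_integral[symmetric])
      (use AEG w real_ruelle_nonneg in \<open>auto elim!: eventually_mono\<close>)
  finally show ?thesis .
qed

end

end

section \<open>Functions on the tower\<close>

context gibbs_markov_tower
begin

text \<open>A function on the tower depends on the base point \<open>y\<close> and the level \<open>l < \<phi> y\<close>; it is
  extended arbitrarily to all levels.\<close>

definition tower_int :: "('x \<Rightarrow> nat \<Rightarrow> real) \<Rightarrow> real" where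
  "tower_int H = (\<integral>y. (\<Sum>l<\<phi> y. H y l) \<partial>\<mu>)"

definition koopman :: "('x \<Rightarrow> nat \<Rightarrow> real) \<Rightarrow> 'x \<Rightarrow> nat \<Rightarrow> real" where
  "koopman W y l = (if Suc l < \<phi> y then W y (Suc l) else W (F y) 0)"

text \<open>The transfer operator of the tower map. A point of positive level has only one preimage, on the level
  below; a base point is reached from the top levels over its preimages under \<open>F\<close>.\<close>

fun tower_op :: "('x \<Rightarrow> nat \<Rightarrow> real) \<Rightarrow> 'x \<Rightarrow> nat \<Rightarrow> real" where
  "tower_op H y 0 = real_ruelle (\<lambda>x. H x (\<phi> x - 1)) y"
| "tower_op H y (Suc l) = H y l"

definition tower_bounded :: "'x set \<Rightarrow> ('x \<Rightarrow> nat \<Rightarrow> real) \<Rightarrow> bool" where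
  "tower_bounded G H \<longleftrightarrow> (\<forall>l. (\<lambda>y. H y l) \<in> borel_measurable \<mu>) \<and>
     (\<exists>B. \<forall>y\<in>G. \<forall>l<\<phi> y. \<bar>H y l\<bar> \<le> B)"

text \<open>Multiplicative Lipschitz bounds are preserved by sums over branches with the same constant, whatever
  the weights of the branches. The bounds \<open>1\<close> and \<open>3\<close> arise from adding \<open>2\<close> to an observable bounded
  by \<open>1\<close>.\<close>

definition regular_functions :: "real \<Rightarrow> 'x set \<Rightarrow> ('x \<Rightarrow> nat \<Rightarrow> real) set" where
  "regular_functions K G = {H. (\<forall>l. (\<lambda>y. H y l) \<in> borel_measurable \<mu>) \<and>
     (\<forall>y\<in>G. \<forall>l<\<phi> y. 1 \<le> H y l \<and> H y l \<le> 3) \<and>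
     (\<forall>a\<in>\<alpha>. \<forall>y\<in>a \<inter> G. \<forall>y'\<in>a \<inter> G. \<forall>l<\<phi> y. H y l \<le> exp (K * d y y') * H y' l)}"

lemma tower_boundedE:
  assumes "tower_bounded G H"
  obtains B where "\<And>l. (\<lambda>y. H y l) \<in> borel_measurable \<mu>"
    "\<And>y l. y \<in> G \<Longrightarrow> l < \<phi> y \<Longrightarrow> \<bar>H y l\<bar> \<le> B"
  using assms unfolding tower_bounded_def by blast

lemma regular_functionsD:
  assumes "H \<in> regular_functions K G"
  shows "(\<lambda>y. H y l) \<in> borel_measurable \<mu>"
    and "y \<in> G \<Longrightarrow> l < \<phi> y \<Longrightarrow> 1 \<le> H y l"
    and "y \<in> G \<Longrightarrow> l < \<phi> y \<Longrightarrow> H y l \<le> 3"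
    and "a \<in> \<alpha> \<Longrightarrow> y \<in> a \<Longrightarrow> y' \<in> a \<Longrightarrow> y \<in> G \<Longrightarrow> y' \<in> G \<Longrightarrow> l < \<phi> y \<Longrightarrow>
      H y l \<le> exp (K * d y y') * H y' l"
  using assms by (auto simp: regular_functions_def)

lemma phi_eq: "a \<in> \<alpha> \<Longrightarrow> y \<in> a \<Longrightarrow> y' \<in> a \<Longrightarrow> \<phi> y = \<phi> y'"
  using phi_const[of a] by auto

lemma tower_sum_measurable:
  assumes "\<And>l. (\<lambda>y. H y l) \<in> borel_measurable \<mu>"
  shows "(\<lambda>y. \<Sum>l<\<phi> y. H y l :: real) \<in> borel_measurable \<mu>"
  by (rule measurable_compose_countable[of "\<lambda>i y. \<Sum>l<i. H y l"]) (use assms in auto)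

lemma top_measurable:
  assumes "\<And>l. (\<lambda>y. H y l) \<in> borel_measurable \<mu>"
  shows "(\<lambda>y. H y (\<phi> y - 1) :: real) \<in> borel_measurable \<mu>"
  by (rule measurable_compose_countable[of "\<lambda>i y. H y (i - 1)"]) (use assms in auto)

lemma tower_op_measurable:
  assumes "\<And>l. (\<lambda>y. H y l) \<in> borel_measurable \<mu>"
  shows "(\<lambda>y. tower_op H y l) \<in> borel_measurable \<mu>"
  using top_measurable[OF assms] by (cases l) (auto intro: assms real_ruelle_measurable)

lemma koopman_measurable:
  assumes [measurable]: "\<And>l. (\<lambda>y. W y l) \<in> borel_measurable \<mu>"
  shows "(\<lambda>y. koopman W y l) \<in> borel_measurable \<mu>"
proof -
  have [measurable]: "(\<lambda>y. W (F y) 0) \<in> borel_measurable \<mu>"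
    by (rule measurable_compose[OF F_measurable assms])
  show ?thesis unfolding koopman_def by measurable
qed

lemma phi_integral_pos: "0 < (\<integral>y. real (\<phi> y) \<partial>\<mu>)"
proof -
  have "(\<integral>y. 1 \<partial>\<mu>) \<le> (\<integral>y. real (\<phi> y) \<partial>\<mu>)"
    using phi_pos by (intro integral_mono phi_integrable) (auto simp: Suc_le_eq)
  then show ?thesis by (simp add: prob_space)
qed

context
  fixes G assumes G: "good G"
begin

lemma phi_good: "y \<in> G \<Longrightarrow> 0 < \<phi> y"
  using phi_pos[OF goodD(10)[OF G]] by (simp add: Suc_le_eq)

lemma phi_dominated_integrable:
  fixes S :: "'x \<Rightarrow> real"
  assumes [measurable]: "S \<in> borel_measurable \<mu>" and S: "\<And>y. y \<in> G \<Longrightarrow> \<bar>S y\<bar> \<le> B * real (\<phi> y)"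
  shows "integrable \<mu> S"
proof (rule Bochner_Integration.integrable_bound)
  show "integrable \<mu> (\<lambda>y. B * real (\<phi> y))"
    using phi_integrable by simp
  show "AE y in \<mu>. norm (S y) \<le> norm (B * real (\<phi> y))"
    using goodD(2)[OF G]
  proof eventually_elim
    case (elim y)
    then show ?case using S[of y] by (simp add: order_trans[OF _ abs_ge_self])
  qed
qed simp

lemma tower_bounded_integrable:
  assumes "tower_bounded G H"
  shows "integrable \<mu> (\<lambda>y. \<Sum>l<\<phi> y. H y l)"
proof -
  from assms obtain B where H: "\<And>l. (\<lambda>y. H y l) \<in> borel_measurable \<mu>"
    and B: "\<And>y l. y \<in> G \<Longrightarrow> l < \<phi> y \<Longrightarrow> \<bar>H y l\<bar> \<le> B"
    by (auto simp: tower_bounded_def)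
  have "\<bar>\<Sum>l<\<phi> y. H y l\<bar> \<le> B * real (\<phi> y)" if "y \<in> G" for y
  proof -
    have "\<bar>\<Sum>l<\<phi> y. H y l\<bar> \<le> (\<Sum>l<\<phi> y. \<bar>H y l\<bar>)" by (rule sum_abs)
    also have "\<dots> \<le> (\<Sum>l<\<phi> y. B)" using B[OF that] by (intro sum_mono) auto
    finally show ?thesis by (simp add: mult.commute)
  qed
  from phi_dominated_integrable[OF tower_sum_measurable[OF H] this] show ?thesis .
qed

lemma tower_bounded_const: "tower_bounded G (\<lambda>_ _. c)"
  by (auto simp: tower_bounded_def)

lemma tower_bounded_add:
  assumes "tower_bounded G H" "tower_bounded G H'"
  shows "tower_bounded G (\<lambda>y l. H y l + H' y l)"
proof -
  from assms(1) obtain B where "\<And>y l. y \<in> G \<Longrightarrow> l < \<phi> y \<Longrightarrow> \<bar>H y l\<bar> \<le> B"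
    by (rule tower_boundedE) blast
  moreover from assms(2) obtain B' where "\<And>y l. y \<in> G \<Longrightarrow> l < \<phi> y \<Longrightarrow> \<bar>H' y l\<bar> \<le> B'"
    by (rule tower_boundedE) blast
  ultimately have "\<forall>y\<in>G. \<forall>l<\<phi> y. \<bar>H y l + H' y l\<bar> \<le> B + B'"
    by (metis abs_triangle_ineq add_mono order_trans)
  then show ?thesis using assms by (auto simp: tower_bounded_def intro: borel_measurable_add)
qed

lemma tower_bounded_mult:
  assumes "tower_bounded G H" "tower_bounded G H'"
  shows "tower_bounded G (\<lambda>y l. H y l * H' y l)"
proof -
  from assms(1) obtain B where B: "\<And>y l. y \<in> G \<Longrightarrow> l < \<phi> y \<Longrightarrow> \<bar>H y l\<bar> \<le> B"
    by (rule tower_boundedE) blast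
  from assms(2) obtain B' where B': "\<And>y l. y \<in> G \<Longrightarrow> l < \<phi> y \<Longrightarrow> \<bar>H' y l\<bar> \<le> B'"
    by (rule tower_boundedE) blast
  have "\<forall>y\<in>G. \<forall>l<\<phi> y. \<bar>H y l * H' y l\<bar> \<le> B * B'"
    using B B' by (auto simp: abs_mult intro!: mult_mono intro: order_trans[OF abs_ge_zero])
  then show ?thesis using assms by (auto simp: tower_bounded_def intro: borel_measurable_times)
qed

lemma tower_bounded_cmult: "tower_bounded G H \<Longrightarrow> tower_bounded G (\<lambda>y l. c * H y l)"
  by (rule tower_bounded_mult[OF tower_bounded_const])

lemma tower_bounded_diff:
  "tower_bounded G H \<Longrightarrow> tower_bounded G H' \<Longrightarrow> tower_bounded G (\<lambda>y l. H y l - H' y l)"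
  using tower_bounded_add[of H "\<lambda>y l. - 1 * H' y l"] tower_bounded_cmult[of H' "- 1"] by simp

lemma tower_bounded_abs: "tower_bounded G H \<Longrightarrow> tower_bounded G (\<lambda>y l. \<bar>H y l\<bar>)"
  by (auto simp: tower_bounded_def intro: borel_measurable_abs)

lemma tower_bounded_koopman:
  assumes "tower_bounded G W"
  shows "tower_bounded G (koopman W)"
proof -
  obtain B where "\<And>y l. y \<in> G \<Longrightarrow> l < \<phi> y \<Longrightarrow> \<bar>W y l\<bar> \<le> B"
    using assms by (auto simp: tower_bounded_def)
  then have "\<forall>y\<in>G. \<forall>l<\<phi> y. \<bar>koopman W y l\<bar> \<le> B"
    using phi_good goodD(3)[OF G] by (simp add: koopman_def)
  then show ?thesis using assms koopman_measurable[of W] by (auto simp: tower_bounded_def)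
qed

lemma regular_functions_bounded: "H \<in> regular_functions K G \<Longrightarrow> tower_bounded G H"
  unfolding tower_bounded_def
proof (intro conjI allI exI[of _ 3] ballI impI)
  fix y l assume H: "H \<in> regular_functions K G" "y \<in> G" "l < \<phi> y"
  from regular_functionsD(2,3)[OF this] show "\<bar>H y l\<bar> \<le> 3" by simp
qed (rule regular_functionsD(1))

lemma tower_int_cong:
  assumes "\<And>y l. y \<in> G \<Longrightarrow> l < \<phi> y \<Longrightarrow> H y l = H' y l"
    and "\<And>l. (\<lambda>y. H y l) \<in> borel_measurable \<mu>" "\<And>l. (\<lambda>y. H' y l) \<in> borel_measurable \<mu>"
  shows "tower_int H = tower_int H'"
  unfolding tower_int_def
proof (rule integral_cong_AE)
  show "AE y in \<mu>. (\<Sum>l<\<phi> y. H y l) = (\<Sum>l<\<phi> y. H' y l)"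
    using goodD(2)[OF G] by eventually_elim (simp add: assms(1))
qed (intro tower_sum_measurable assms)+

lemma tower_int_add:
  "tower_bounded G H \<Longrightarrow> tower_bounded G H' \<Longrightarrow>
    tower_int (\<lambda>y l. H y l + H' y l) = tower_int H + tower_int H'"
  by (simp add: tower_int_def sum.distrib tower_bounded_integrable)

lemma tower_int_diff:
  "tower_bounded G H \<Longrightarrow> tower_bounded G H' \<Longrightarrow>
    tower_int (\<lambda>y l. H y l - H' y l) = tower_int H - tower_int H'"
  by (simp add: tower_int_def sum_subtractf tower_bounded_integrable)

lemma tower_int_cmult:
  "tower_bounded G H \<Longrightarrow> tower_int (\<lambda>y l. c * H y l) = c * tower_int H"
  by (simp add: tower_int_def tower_bounded_integrable flip: sum_distrib_left)

lemma tower_int_const: "tower_int (\<lambda>_ _. c) = c * (\<integral>y. real (\<phi> y) \<partial>\<mu>)"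
  by (simp add: tower_int_def mult.commute)

lemma tower_int_mono:
  assumes "tower_bounded G H" "tower_bounded G H'"
    and "\<And>y l. y \<in> G \<Longrightarrow> l < \<phi> y \<Longrightarrow> H y l \<le> H' y l"
  shows "tower_int H \<le> tower_int H'"
  unfolding tower_int_def
proof (rule integral_mono_AE)
  show "AE y in \<mu>. (\<Sum>l<\<phi> y. H y l) \<le> (\<Sum>l<\<phi> y. H' y l)"
    using goodD(2)[OF G] by eventually_elim (intro sum_mono assms(3); simp)
qed (intro tower_bounded_integrable assms)+

lemma tower_int_nonneg:
  "tower_bounded G H \<Longrightarrow> (\<And>y l. y \<in> G \<Longrightarrow> l < \<phi> y \<Longrightarrow> 0 \<le> H y l) \<Longrightarrow> 0 \<le> tower_int H"
  using tower_int_mono[of "\<lambda>_ _. 0" H] by (simp add: tower_bounded_const tower_int_const)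

lemma tower_int_abs: "tower_bounded G H \<Longrightarrow> \<bar>tower_int H\<bar> \<le> tower_int (\<lambda>y l. \<bar>H y l\<bar>)"
  using tower_int_mono[of H "\<lambda>y l. \<bar>H y l\<bar>"] tower_int_mono[of "\<lambda>y l. (- 1) * H y l" "\<lambda>y l. \<bar>H y l\<bar>"]
    tower_int_cmult[of H "- 1"] tower_bounded_cmult[of H "- 1"]
  by (simp add: tower_bounded_abs abs_le_iff)

text \<open>Levels above the base are only shifted by the tower map, so the duality between the transfer
  operator of the tower and composition with the tower map reduces to that on the base.\<close>

lemma koopman_duality:
  assumes H: "tower_bounded G H" and W: "tower_bounded G W"
    and H0: "\<And>y l. y \<in> G \<Longrightarrow> l < \<phi> y \<Longrightarrow> 0 \<le> H y l"
    and W0: "\<And>y l. y \<in> G \<Longrightarrow> l < \<phi> y \<Longrightarrow> 0 \<le> W y l"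
  shows "tower_int (\<lambda>y l. H y l * koopman W y l) = tower_int (\<lambda>y l. tower_op H y l * W y l)"
proof -
  obtain B where mH: "\<And>l. (\<lambda>y. H y l) \<in> borel_measurable \<mu>"
    and B: "\<And>y l. y \<in> G \<Longrightarrow> l < \<phi> y \<Longrightarrow> \<bar>H y l\<bar> \<le> B"
    using H by (rule tower_boundedE) blast
  obtain C where mW: "\<And>l. (\<lambda>y. W y l) \<in> borel_measurable \<mu>"
    and C: "\<And>y l. y \<in> G \<Longrightarrow> l < \<phi> y \<Longrightarrow> \<bar>W y l\<bar> \<le> C"
    using W by (rule tower_boundedE) blast
  define q where "q x = H x (\<phi> x - 1)" for x
  define A where "A y = (\<Sum>l<\<phi> y - 1. H y l * W y (Suc l))" for y
  have q: "0 \<le> q x" "q x \<le> B" if "x \<in> G" for x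
    using H0[OF that, of "\<phi> x - 1"] B[OF that, of "\<phi> x - 1"] phi_good[OF that] by (auto simp: q_def)
  have B0: "0 \<le> B" if "x \<in> G" for x
    using q[OF that] by linarith
  have w: "0 \<le> W x 0" "W x 0 \<le> C" if "x \<in> G" for x
    using W0[OF that, of 0] C[OF that, of 0] phi_good[OF that] by auto
  have mq [measurable]: "q \<in> borel_measurable \<mu>"
    unfolding q_def[abs_def] by (rule top_measurable[OF mH])
  have mw [measurable]: "(\<lambda>y. W y 0) \<in> borel_measurable \<mu>" by (rule mW)
  have mwF [measurable]: "(\<lambda>y. W (F y) 0) \<in> borel_measurable \<mu>"
    by (rule measurable_compose[OF F_measurable mw])
  have mA: "A \<in> borel_measurable \<mu>"
    unfolding A_def[abs_def]
    by (rule measurable_compose_countable[of "\<lambda>i y. \<Sum>l<i - 1. H y l * W y (Suc l)"])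
      (use mH mW in auto)
  have "integrable \<mu> A"
  proof (rule phi_dominated_integrable[OF mA])
    fix y assume y: "y \<in> G"
    have "\<bar>A y\<bar> \<le> (\<Sum>l<\<phi> y - 1. \<bar>H y l * W y (Suc l)\<bar>)" unfolding A_def by (rule sum_abs)
    also have "\<dots> \<le> (\<Sum>l<\<phi> y - 1. B * C)"
      unfolding abs_mult
      by (intro sum_mono mult_mono B C y order_trans[OF abs_ge_zero B[OF y phi_good[OF y]]]) auto
    also have "\<dots> \<le> B * C * real (\<phi> y)"
      using order_trans[OF abs_ge_zero B[OF y phi_good[OF y]]]
        order_trans[OF abs_ge_zero C[OF y phi_good[OF y]]]
      by (simp add: mult.commute mult_left_mono)
    finally show "\<bar>A y\<bar> \<le> B * C * real (\<phi> y)" .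
  qed
  have i1: "integrable \<mu> (\<lambda>y. q y * W (F y) 0)"
    by (rule bounded_integrable[OF G, where B="B * C"])
      (use q w goodD(3)[OF G] B0 in \<open>auto simp: abs_mult intro!: mult_mono\<close>)
  have Rq: "0 \<le> real_ruelle q y" "real_ruelle q y \<le> B" if "y \<in> G" for y
    using real_ruelle_le[OF G that, of q B] q order_trans[OF q(1)[OF that] q(2)[OF that]]
    by (auto simp: real_ruelle_nonneg)
  have i2: "integrable \<mu> (\<lambda>y. real_ruelle q y * W y 0)"
    by (rule bounded_integrable[OF G, where B="B * C"])
      (use Rq w B0 in \<open>auto simp: abs_mult intro!: mult_mono\<close>)
  have s1: "(\<Sum>l<\<phi> y. H y l * koopman W y l) = A y + q y * W (F y) 0"
    and s2: "(\<Sum>l<\<phi> y. tower_op H y l * W y l) = A y + real_ruelle q y * W y 0"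
    if y: "y \<in> space \<mu>" for y
  proof -
    obtain p where p: "\<phi> y = Suc p" using phi_pos[OF y] by (cases "\<phi> y") auto
    show "(\<Sum>l<\<phi> y. H y l * koopman W y l) = A y + q y * W (F y) 0"
      by (simp add: p A_def q_def koopman_def)
    show "(\<Sum>l<\<phi> y. tower_op H y l * W y l) = A y + real_ruelle q y * W y 0"
      unfolding p sum.lessThan_Suc_shift by (simp add: p A_def q_def[abs_def])
  qed
  have "tower_int (\<lambda>y l. H y l * koopman W y l) = (\<integral>y. A y + q y * W (F y) 0 \<partial>\<mu>)"
    unfolding tower_int_def by (intro Bochner_Integration.integral_cong refl s1)
  also have "\<dots> = (\<integral>y. A y \<partial>\<mu>) + (\<integral>y. q y * W (F y) 0 \<partial>\<mu>)"
    using \<open>integrable \<mu> A\<close> i1 by simp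
  also have "(\<integral>y. q y * W (F y) 0 \<partial>\<mu>) = (\<integral>y. real_ruelle q y * W y 0 \<partial>\<mu>)"
    by (rule real_ruelle_duality[OF G mq mw q w(1)])
  also have "(\<integral>y. A y \<partial>\<mu>) + (\<integral>y. real_ruelle q y * W y 0 \<partial>\<mu>) =
      (\<integral>y. A y + real_ruelle q y * W y 0 \<partial>\<mu>)"
    using \<open>integrable \<mu> A\<close> i2 by simp
  also have "\<dots> = tower_int (\<lambda>y l. tower_op H y l * W y l)"
    unfolding tower_int_def by (intro Bochner_Integration.integral_cong refl s2[symmetric])
  finally show ?thesis .
qed

lemma tower_op_const: "0 \<le> c \<Longrightarrow> y \<in> G \<Longrightarrow> tower_op (\<lambda>_ _. c) y l = c"
  using ruelle_const[OF G, of y "ennreal c"] by (cases l) (auto simp: real_ruelle_def)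

lemma tower_int_koopman:
  assumes W: "tower_bounded G W" and W0: "\<And>y l. y \<in> G \<Longrightarrow> l < \<phi> y \<Longrightarrow> 0 \<le> W y l"
  shows "tower_int (koopman W) = tower_int W"
proof -
  have "tower_int (\<lambda>y l. 1 * koopman W y l) = tower_int (\<lambda>y l. tower_op (\<lambda>_ _. 1) y l * W y l)"
    by (rule koopman_duality[OF tower_bounded_const W]) (use W0 in auto)
  also have "\<dots> = tower_int W"
  proof (rule tower_int_cong)
    show "(\<lambda>y. tower_op (\<lambda>_ _. 1) y l * W y l) \<in> borel_measurable \<mu>" for l
      using W by (intro borel_measurable_times tower_op_measurable) (auto simp: tower_bounded_def)
  qed (use W in \<open>auto simp: tower_op_const tower_bounded_def\<close>)
  finally show ?thesis by simp
qed

text \<open>The hypothesis on \<open>K\<close> absorbs the constant \<open>C0 + \<theta> * K\<close> that appears at the base; on the other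
  levels nothing changes.\<close>

lemma tower_op_regular:
  assumes H: "H \<in> regular_functions K G" and K: "0 \<le> K" "C0 + \<theta> * K \<le> K"
  shows "tower_op H \<in> regular_functions K G"
  unfolding regular_functions_def
proof (intro CollectI conjI allI ballI impI)
  let ?q = "\<lambda>x. H x (\<phi> x - 1)"
  have q: "1 \<le> ?q x" "?q x \<le> 3" if "x \<in> G" for x
    using regular_functionsD(2,3)[OF H that] phi_good[OF that] by auto
  show "(\<lambda>y. tower_op H y l) \<in> borel_measurable \<mu>" for l
    by (rule tower_op_measurable[OF regular_functionsD(1)[OF H]])
  fix y l assume l: "l < \<phi> y"
  {
    assume y: "y \<in> G"
    show "1 \<le> tower_op H y l"
      using l real_ruelle_ge[OF G y, of 1 ?q 3] q regular_functionsD(2)[OF H y] by (cases l) auto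
    show "tower_op H y l \<le> 3"
      using l real_ruelle_le[OF G y, of ?q 3] q regular_functionsD(3)[OF H y] by (cases l) auto
  }
  fix a y' assume a: "a \<in> \<alpha>" and "y \<in> a \<inter> G" "y' \<in> a \<inter> G"
  then have y: "y \<in> a" "y' \<in> a" "y \<in> G" "y' \<in> G" by auto
  show "tower_op H y l \<le> exp (K * d y y') * tower_op H y' l"
  proof (cases l)
    case 0
    have "real_ruelle ?q y \<le> exp ((C0 + \<theta> * K) * d y y') * real_ruelle ?q y'"
    proof (rule real_ruelle_regular[OF G K(1) _ q(2) _ a y])
      show "0 \<le> ?q x" if "x \<in> G" for x using q(1)[OF that] by simp
      show "?q x \<le> exp (K * d x x') * ?q x'"
        if b: "b \<in> \<alpha>" "x \<in> b" "x' \<in> b" "x \<in> G" "x' \<in> G" for b x x'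
        using regular_functionsD(4)[OF H b, of "\<phi> x - 1"] phi_good[OF b(4)] phi_eq[OF b(1-3)] by simp
    qed
    also have "\<dots> \<le> exp (K * d y y') * real_ruelle ?q y'"
      using K by (intro mult_right_mono) (auto simp: real_ruelle_nonneg dist_nonneg mult_right_mono)
    finally show ?thesis using 0 by simp
  next
    case (Suc k)
    then show ?thesis using regular_functionsD(4)[OF H a y, of k] l by simp
  qed
qed

lemma tower_op_power_regular:
  assumes "H \<in> regular_functions K G" "0 \<le> K" "C0 + \<theta> * K \<le> K"
  shows "(tower_op ^^ n) H \<in> regular_functions K G"
  using assms by (induction n) (auto intro: tower_op_regular)

lemma tower_bounded_koopman_power:
  "tower_bounded G W \<Longrightarrow> tower_bounded G ((koopman ^^ n) W)"
  by (induction n) (auto intro: tower_bounded_koopman)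

lemma koopman_power_nonneg:
  assumes "\<And>y l. y \<in> G \<Longrightarrow> l < \<phi> y \<Longrightarrow> 0 \<le> W y l" "y \<in> G" "l < \<phi> y"
  shows "0 \<le> (koopman ^^ n) W y l"
  using assms(2,3)
  by (induction n arbitrary: y l) (auto simp: assms(1) koopman_def phi_good goodD(3)[OF G])

lemma koopman_power_duality:
  assumes H: "H \<in> regular_functions K G" and K: "0 \<le> K" "C0 + \<theta> * K \<le> K"
    and W: "tower_bounded G W" and W0: "\<And>y l. y \<in> G \<Longrightarrow> l < \<phi> y \<Longrightarrow> 0 \<le> W y l"
  shows "tower_int (\<lambda>y l. H y l * (koopman ^^ n) W y l) =
    tower_int (\<lambda>y l. (tower_op ^^ n) H y l * W y l)"
  using H
proof (induction n arbitrary: H)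
  case (Suc n)
  have "tower_int (\<lambda>y l. H y l * (koopman ^^ Suc n) W y l) =
      tower_int (\<lambda>y l. tower_op H y l * (koopman ^^ n) W y l)"
  proof (simp, rule koopman_duality[OF regular_functions_bounded[OF Suc.prems] tower_bounded_koopman_power[OF W]])
    show "0 \<le> H y l" if "y \<in> G" "l < \<phi> y" for y l
      using regular_functionsD(2)[OF Suc.prems that] by simp
  qed (rule koopman_power_nonneg[OF W0])
  also have "\<dots> = tower_int (\<lambda>y l. (tower_op ^^ n) (tower_op H) y l * W y l)"
    by (rule Suc.IH[OF tower_op_regular[OF Suc.prems K]])
  finally show ?case by (simp add: funpow_swap1)
qed simp

lemma tower_int_tower_op_power:
  assumes "H \<in> regular_functions K G" "0 \<le> K" "C0 + \<theta> * K \<le> K"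
  shows "tower_int ((tower_op ^^ n) H) = tower_int H"
proof -
  have "(koopman ^^ n) (\<lambda>_ _. 1) = (\<lambda>_ _. 1)"
    by (induction n) (auto simp: koopman_def fun_eq_iff)
  then show ?thesis
    using koopman_power_duality[OF assms tower_bounded_const, of 1 n] by simp
qed

text \<open>Expanding the square and using duality twice: the transfer operator is the adjoint of an
  isometry of \<open>L\<^sup>2\<close>, and the loss of norm measures how far \<open>H\<close> is from its range.\<close>

lemma koopman_defect:
  assumes H: "H \<in> regular_functions K G" and K: "0 \<le> K" "C0 + \<theta> * K \<le> K"
  shows "tower_int (\<lambda>y l. (koopman (tower_op H) y l - H y l)\<^sup>2) =
    tower_int (\<lambda>y l. (H y l)\<^sup>2) - tower_int (\<lambda>y l. (tower_op H y l)\<^sup>2)"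
proof -
  let ?L = "tower_op H"
  note bH = regular_functions_bounded[OF H] and bL = regular_functions_bounded[OF tower_op_regular[OF H K]]
  note bK = tower_bounded_koopman[OF bL]
  have L0: "0 \<le> ?L y l" if "y \<in> G" "l < \<phi> y" for y l
    using regular_functionsD(2)[OF tower_op_regular[OF H K] that] by simp
  have H0: "0 \<le> H y l" if "y \<in> G" "l < \<phi> y" for y l
    using regular_functionsD(2)[OF H that] by simp
  have "tower_int (\<lambda>y l. (koopman ?L y l - H y l)\<^sup>2) =
      tower_int (\<lambda>y l. (koopman ?L y l * koopman ?L y l + H y l * H y l) - 2 * (H y l * koopman ?L y l))"
    by (simp add: power2_eq_square algebra_simps)
  also have "\<dots> = tower_int (\<lambda>y l. koopman ?L y l * koopman ?L y l) + tower_int (\<lambda>y l. H y l * H y l)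
      - 2 * tower_int (\<lambda>y l. H y l * koopman ?L y l)"
    by (simp add: tower_int_diff tower_int_add tower_int_cmult tower_bounded_add tower_bounded_mult
        tower_bounded_cmult bH bK)
  also have "tower_int (\<lambda>y l. H y l * koopman ?L y l) = tower_int (\<lambda>y l. ?L y l * ?L y l)"
    by (rule koopman_duality[OF bH bL H0 L0])
  also have "(\<lambda>y l. koopman ?L y l * koopman ?L y l) = koopman (\<lambda>y l. ?L y l * ?L y l)"
    by (simp add: koopman_def fun_eq_iff)
  also have "tower_int (koopman (\<lambda>y l. ?L y l * ?L y l)) = tower_int (\<lambda>y l. ?L y l * ?L y l)"
    by (rule tower_int_koopman[OF tower_bounded_mult[OF bL bL]]) simp
  finally show ?thesis by (simp add: power2_eq_square)
qed

text \<open>The defects are the decrements of a decreasing sequence of squared norms, which converges.\<close>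

lemma koopman_defect_tendsto_0:
  assumes H: "H \<in> regular_functions K G" and K: "0 \<le> K" "C0 + \<theta> * K \<le> K"
  shows "(\<lambda>n. tower_int (\<lambda>y l. (koopman ((tower_op ^^ Suc n) H) y l - (tower_op ^^ n) H y l)\<^sup>2))
    \<longlonglongrightarrow> 0"
proof -
  define E where "E n = tower_int (\<lambda>y l. ((tower_op ^^ n) H y l)\<^sup>2)" for n
  define J where "J n = tower_int (\<lambda>y l. (koopman ((tower_op ^^ Suc n) H) y l - (tower_op ^^ n) H y l)\<^sup>2)" for n
  note C = tower_op_power_regular[OF H K]
  have J: "J n = E n - E (Suc n)" for n
    using koopman_defect[OF C[of n] K] by (simp add: J_def E_def)
  have b: "tower_bounded G (\<lambda>y l. (koopman ((tower_op ^^ Suc n) H) y l - (tower_op ^^ n) H y l)\<^sup>2)" for n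
    unfolding power2_eq_square
    by (intro tower_bounded_mult tower_bounded_diff tower_bounded_koopman regular_functions_bounded[OF C])
  have "0 \<le> J n" for n
    unfolding J_def by (rule tower_int_nonneg[OF b]) simp
  then have "decseq E"
    by (intro decseq_SucI) (simp add: J)
  moreover have "0 \<le> E n" for n
  proof -
    have "tower_bounded G (\<lambda>y l. ((tower_op ^^ n) H y l)\<^sup>2)"
      unfolding power2_eq_square by (intro tower_bounded_mult regular_functions_bounded[OF C])
    then show ?thesis unfolding E_def by (rule tower_int_nonneg) simp
  qed
  ultimately obtain e where e: "E \<longlonglongrightarrow> e"
    using decseq_convergent[of E 0] by blast
  have "(\<lambda>n. E n - E (Suc n)) \<longlonglongrightarrow> e - e"
    by (intro tendsto_diff e LIMSEQ_Suc)
  then have "J \<longlonglongrightarrow> 0" by (simp add: J[symmetric])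
  then show ?thesis unfolding J_def .
qed

end

end

section \<open>Ergodic connections and limits along subsequences\<close>

lemma convergent_if_approximable:
  fixes f :: "nat \<Rightarrow> real"
  assumes "\<And>e. e > 0 \<Longrightarrow> \<exists>h. convergent h \<and> (\<forall>n. \<bar>f n - h n\<bar> \<le> e)"
  shows "convergent f"
proof -
  have "Cauchy f"
  proof (rule CauchyI)
    fix e :: real assume e: "0 < e"
    then obtain h where h: "convergent h" "\<And>n. \<bar>f n - h n\<bar> \<le> e / 4"
      using assms[of "e / 4"] by auto
    then obtain M where M: "\<forall>m\<ge>M. \<forall>n\<ge>M. norm (h m - h n) < e / 4"
      using CauchyD[OF convergent_Cauchy[OF h(1)], of "e / 4"] e by auto
    have "norm (f m - f n) < e" if "m \<ge> M" "n \<ge> M" for m n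
    proof -
      have "norm (h m - h n) < e / 4" using M that by blast
      then show ?thesis using h(2)[of m] h(2)[of n] e unfolding real_norm_def by linarith
    qed
    then show "\<exists>M. \<forall>m\<ge>M. \<forall>n\<ge>M. norm (f m - f n) < e" by blast
  qed
  then show ?thesis by (rule Cauchy_convergent)
qed

context gibbs_markov_tower
begin

lemma dist_commute: "d y y' = d y' y"
proof -
  have "separated_at \<alpha> F y y' = separated_at \<alpha> F y' y"
    by (auto simp: separated_at_def fun_eq_iff)
  then show ?thesis by (simp add: sep_dist_eq)
qed

lemma emeasure_vimage_power:
  assumes "b \<in> sets \<mu>"
  shows "emeasure \<mu> ((F ^^ n) -` b \<inter> space \<mu>) = emeasure \<mu> b"
proof (induction n)
  case 0
  then show ?case using sets.sets_into_space[OF assms] by (simp add: Int_absorb2)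
next
  case (Suc n)
  have "(F ^^ Suc n) -` b \<inter> space \<mu> = F -` ((F ^^ n) -` b \<inter> space \<mu>) \<inter> space \<mu>"
    using F_space by (auto simp: funpow_Suc_right simp del: funpow.simps)
  then have "emeasure \<mu> ((F ^^ Suc n) -` b \<inter> space \<mu>) =
      emeasure (distr \<mu> \<mu> F) ((F ^^ n) -` b \<inter> space \<mu>)"
    using assms by (subst emeasure_distr) (auto intro: measurable_sets[OF F_power_measurable])
  also have "\<dots> = emeasure \<mu> b" using Suc by (simp add: F_invariant)
  finally show ?case .
qed

text \<open>The points that return to \<open>b\<close> infinitely often form an \<open>F\<close>-invariant set, of measure at
  least that of \<open>b\<close>; by ergodicity it has full measure.\<close>

lemma ergodic_connects:
  assumes G: "good G" and a: "a \<in> \<alpha>" and b: "b \<in> \<alpha>"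
  obtains y n where "y \<in> a" "y \<in> G" "1 \<le> n" "(F ^^ n) y \<in> b"
proof -
  define B where "B m = (\<Union>n\<in>{m..}. (F ^^ n) -` b \<inter> space \<mu>)" for m
  define E where "E = (\<Inter>m. B m)"
  have E: "y \<in> E \<longleftrightarrow> y \<in> space \<mu> \<and> (\<forall>m. \<exists>n\<ge>m. (F ^^ n) y \<in> b)" for y
    by (auto simp: E_def B_def)
  have B_sets: "B m \<in> sets \<mu>" for m
    unfolding B_def using measurable_sets[OF F_power_measurable alpha_sets[OF b]]
    by (intro sets.countable_UN') auto
  then have E_sets: "E \<in> sets \<mu>" unfolding E_def by auto
  have inv: "F -` E \<inter> space \<mu> = E"
  proof (intro set_eqI iffI)
    fix y assume "y \<in> F -` E \<inter> space \<mu>"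
    then have y: "y \<in> space \<mu>" and *: "\<And>m. \<exists>n\<ge>m. (F ^^ n) (F y) \<in> b" by (auto simp: E)
    have "\<exists>n\<ge>m. (F ^^ n) y \<in> b" for m
    proof -
      obtain n where "n \<ge> m" "(F ^^ n) (F y) \<in> b" using * by blast
      then have "Suc n \<ge> m" "(F ^^ Suc n) y \<in> b" by (auto simp: funpow_Suc_right simp del: funpow.simps)
      then show ?thesis by blast
    qed
    with y show "y \<in> E" by (simp add: E)
  next
    fix y assume "y \<in> E"
    then have y: "y \<in> space \<mu>" and *: "\<And>m. \<exists>n\<ge>m. (F ^^ n) y \<in> b" by (auto simp: E)
    have "\<exists>n\<ge>m. (F ^^ n) (F y) \<in> b" for m
    proof -
      obtain n where n: "n \<ge> Suc m" "(F ^^ n) y \<in> b" using * by blast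
      then obtain k where "n = Suc k" by (cases n) auto
      with n have "k \<ge> m" "(F ^^ k) (F y) \<in> b" by (auto simp: funpow_Suc_right simp del: funpow.simps)
      then show ?thesis by blast
    qed
    with y F_space show "y \<in> F -` E \<inter> space \<mu>" by (simp add: E)
  qed
  have "measure \<mu> b \<le> measure \<mu> (B m)" for m
  proof -
    have "measure \<mu> b = measure \<mu> ((F ^^ m) -` b \<inter> space \<mu>)"
      using emeasure_vimage_power[OF alpha_sets[OF b]] by (simp add: measure_def)
    also have "\<dots> \<le> measure \<mu> (B m)"
      by (rule finite_measure_mono[OF _ B_sets]) (auto simp: B_def)
    finally show ?thesis .
  qed
  moreover have "(\<lambda>m. measure \<mu> (B m)) \<longlonglongrightarrow> measure \<mu> E"
    unfolding E_def
  proof (rule finite_Lim_measure_decseq)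
    show "decseq B" unfolding decseq_def B_def by (intro allI impI UN_mono) auto
  qed (use B_sets in auto)
  ultimately have "measure \<mu> b \<le> measure \<mu> E"
    by (intro LIMSEQ_le_const) auto
  moreover have "0 < measure \<mu> b"
    using alpha_pos[OF b] by (simp add: emeasure_eq_measure)
  ultimately have "measure \<mu> E = 1"
    using ergodic E_sets inv unfolding ergodic_measure_def by (metis not_less)
  then have "AE y in \<mu>. y \<in> E" by (rule AE_prob_1)
  with goodD(2)[OF G] have "AE y in \<mu>. y \<in> E \<and> y \<in> G" by eventually_elim simp
  moreover have "\<not> (AE y in \<mu>. y \<notin> a)"
    by (rule alpha_not_null[OF a])
  ultimately obtain y where y: "y \<in> a" "y \<in> E" "y \<in> G"
    by (metis (mono_tags, lifting) eventually_mono)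
  then obtain n where "n \<ge> 1" "(F ^^ n) y \<in> b" by (auto simp: E)
  with y show thesis by (intro that)
qed

context
  fixes G assumes G: "good G"
begin

lemma regular_diff_le:
  assumes "q y \<le> exp (K * d y y') * q y'" "q y' \<le> exp (K * d y' y) * q y"
    and "0 \<le> q y" "q y \<le> B" "0 \<le> q y'" "q y' \<le> B" and "0 \<le> K"
  shows "\<bar>q y - q y'\<bar> \<le> B * (exp (K * d y y') - 1)"
proof -
  let ?e = "exp (K * d y y') - 1"
  have e: "0 \<le> ?e" using assms(7) dist_nonneg[of y y'] by simp
  have "q y - q y' \<le> q y' * ?e" "q y' - q y \<le> q y * ?e"
    using assms(1,2) dist_commute[of y' y] by (simp_all add: algebra_simps)
  moreover have "q y' * ?e \<le> B * ?e" "q y * ?e \<le> B * ?e"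
    using assms(4,6) e by (intro mult_right_mono; simp)+
  ultimately show ?thesis by (simp add: abs_le_iff)
qed

text \<open>Arzela-Ascoli: a diagonal subsequence converges on the countable dense set, and uniform
  regularity extends the convergence to all of \<open>G\<close>.\<close>

lemma regular_convergent_subsequence:
  fixes f :: "nat \<Rightarrow> 'i::countable \<Rightarrow> 'x \<Rightarrow> real"
  assumes K: "0 \<le> K"
    and bounds: "\<And>n i y. y \<in> G \<Longrightarrow> 0 \<le> f n i y" "\<And>n i y. y \<in> G \<Longrightarrow> f n i y \<le> B"
    and reg: "\<And>n i a y y'. a \<in> \<alpha> \<Longrightarrow> y \<in> a \<Longrightarrow> y' \<in> a \<Longrightarrow> y \<in> G \<Longrightarrow> y' \<in> G \<Longrightarrow>
      f n i y \<le> exp (K * d y y') * f n i y'"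
  obtains r where "strict_mono r" "\<And>i y. y \<in> G \<Longrightarrow> convergent (\<lambda>n. f (r n) i y)"
proof -
  obtain D where D: "countable D" "D \<subseteq> G"
    "\<And>y k. y \<in> G \<Longrightarrow> \<exists>x\<in>D. (\<exists>a\<in>\<alpha>. x \<in> a \<and> y \<in> a) \<and> d y x \<le> \<theta> ^ k"
    using countable_dense[OF G] by blast
  let ?S = "(UNIV :: 'i set) \<times> D"
  have "countable ?S" using D(1) by auto
  moreover have "norm (case p of (i, x) \<Rightarrow> f n i x) \<le> B" if "p \<in> ?S" for n p
    using that D(2) bounds by (auto simp: subset_eq)
  ultimately obtain r where r: "strict_mono r"
    "\<And>p. p \<in> ?S \<Longrightarrow> \<exists>l. (\<lambda>n. case p of (i, x) \<Rightarrow> f (r n) i x) \<longlonglongrightarrow> l"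
    using function_convergent_subsequence[of ?S "\<lambda>n p. case p of (i, x) \<Rightarrow> f n i x" B] by metis
  have "convergent (\<lambda>n. f (r n) i y)" if y: "y \<in> G" for i y
  proof (rule convergent_if_approximable)
    fix e :: real assume "e > 0"
    have B: "0 \<le> B" using bounds[OF y, of 0 i] by linarith
    have "(\<lambda>k. B * (exp (K * \<theta> ^ k) - 1)) \<longlonglongrightarrow> B * (exp (K * 0) - 1)"
      using theta by (intro tendsto_intros LIMSEQ_power_zero) auto
    then have "\<forall>\<^sub>F k in sequentially. B * (exp (K * \<theta> ^ k) - 1) < e"
      using \<open>e > 0\<close> by (intro order_tendstoD(2)) auto
    then obtain k where k: "B * (exp (K * \<theta> ^ k) - 1) < e"
      by (auto simp: eventually_sequentially)
    obtain x a where x: "x \<in> D" "a \<in> \<alpha>" "x \<in> a" "y \<in> a" "d y x \<le> \<theta> ^ k"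
      using D(3)[OF y, of k] by blast
    have xG: "x \<in> G" using x(1) D(2) by auto
    have "\<bar>f (r n) i y - f (r n) i x\<bar> \<le> e" for n
    proof -
      have "\<bar>f (r n) i y - f (r n) i x\<bar> \<le> B * (exp (K * d y x) - 1)"
        by (rule regular_diff_le[OF reg[OF x(2,4,3) y xG] reg[OF x(2,3,4) xG y]])
          (use bounds y xG K in auto)
      also have "\<dots> \<le> B * (exp (K * \<theta> ^ k) - 1)"
        using B K x(5) by (intro mult_left_mono) (auto intro: mult_left_mono)
      finally show ?thesis using k by simp
    qed
    moreover have "convergent (\<lambda>n. f (r n) i x)"
      using r(2)[of "(i, x)"] x(1) by (auto simp: convergent_def)
    ultimately show "\<exists>h. convergent h \<and> (\<forall>n. \<bar>f (r n) i y - h n\<bar> \<le> e)"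
      by (intro exI[of _ "\<lambda>n. f (r n) i x"]) simp
  qed
  with r(1) show thesis by (rule that)
qed

lemma tower_op_power_level:
  "l \<le> m \<Longrightarrow> (tower_op ^^ m) H y l = (tower_op ^^ (m - l)) H y 0"
proof (induction l arbitrary: m)
  case (Suc l)
  then obtain k where "m = Suc k" by (cases m) auto
  with Suc show ?case by simp
qed simp

text \<open>Along a subsequence, all time shifts of the base values of \<open>(tower_op ^^ n) H\<close> converge. Since
  the defect tends to zero, the limits are related by the return map without averaging.\<close>

lemma limit_cocycle:
  assumes H: "H \<in> regular_functions K G" and K: "0 \<le> K" "C0 + \<theta> * K \<le> K"
    and s: "strict_mono (s :: nat \<Rightarrow> nat)"
  obtains r \<psi> G' where "strict_mono (r :: nat \<Rightarrow> nat)" "good G'" "G' \<subseteq> G"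
    "\<And>y (i :: int). y \<in> G' \<Longrightarrow>
      (\<lambda>n. (tower_op ^^ nat (int (s (r n)) + i)) H y 0) \<longlonglongrightarrow> \<psi> i y"
    "\<And>i. \<psi> i \<in> borel_measurable \<mu>" "\<And>y i. y \<in> G' \<Longrightarrow> \<bar>\<psi> i y\<bar> \<le> 3"
    "\<And>y i. y \<in> G' \<Longrightarrow> \<psi> i (F y) = \<psi> (i - int (\<phi> y)) y"
    "\<And>a y y' i. a \<in> \<alpha> \<Longrightarrow> y \<in> a \<Longrightarrow> y' \<in> a \<Longrightarrow> y \<in> G' \<Longrightarrow> y' \<in> G' \<Longrightarrow>
      \<bar>\<psi> i y - \<psi> i y'\<bar> \<le> 3 * (exp (K * d y y') - 1)"
proof -
  define u where "u m y = (tower_op ^^ m) H y 0" for m y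
  note C = tower_op_power_regular[OF G H K]
  have u_bounds: "1 \<le> u m y" "u m y \<le> 3" if "y \<in> G" for m y
    using regular_functionsD(2,3)[OF C that phi_good[OF G that]] by (auto simp: u_def)
  have u_reg: "u m y \<le> exp (K * d y y') * u m y'"
    if "a \<in> \<alpha>" "y \<in> a" "y' \<in> a" "y \<in> G" "y' \<in> G" for m a y y'
    using regular_functionsD(4)[OF C that phi_good[OF G that(4)]] by (auto simp: u_def)
  obtain r where r: "strict_mono r"
    and conv: "\<And>i y. y \<in> G \<Longrightarrow> convergent (\<lambda>n. u (nat (int (s (r n)) + i)) y)"
  proof (rule regular_convergent_subsequence[of K "\<lambda>n (i::int) y. u (nat (int (s n) + i)) y" 3])
    show "0 \<le> u (nat (int (s n) + i)) y" if "y \<in> G" for n i y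
      using u_bounds(1)[OF that, of "nat (int (s n) + i)"] by linarith
  qed (use K u_bounds u_reg in \<open>auto intro: that\<close>)
  define \<psi> where "\<psi> i y = lim (\<lambda>n. u (nat (int (s (r n)) + i)) y)" for i y
  have lim: "(\<lambda>n. u (nat (int (s (r n)) + i)) y) \<longlonglongrightarrow> \<psi> i y" if "y \<in> G" for i y
    using conv[OF that, of i] unfolding \<psi>_def by (simp add: convergent_LIMSEQ_iff)
  have t: "strict_mono (\<lambda>n. s (r n))"
    using strict_mono_o[OF s r] by (simp add: o_def)
  have t_top: "filterlim (\<lambda>n. int (s (r n)) + i) at_top sequentially" for i
    unfolding filterlim_at_top
  proof
    fix Z
    show "\<forall>\<^sub>F n in sequentially. Z \<le> int (s (r n)) + i"
    proof (rule eventually_sequentiallyI)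
      fix n assume "nat (Z - i) \<le> n"
      with seq_suble[OF t, of n] show "Z \<le> int (s (r n)) + i" by linarith
    qed
  qed
  have rel: "AE y in \<mu>. \<psi> i (F y) = \<psi> (i - int (\<phi> y)) y" for i
  proof -
    \<comment> \<open>At time \<open>m n\<close> the top level over \<open>y\<close> is the last step before the base point \<open>F y\<close>.\<close>
    define m where "m n = nat (int (s (r n)) + (i - 1))" for n
    define W where "W k y l = (koopman ((tower_op ^^ Suc k) H) y l - (tower_op ^^ k) H y l)\<^sup>2" for k y l
    have m_top: "filterlim m at_top sequentially"
      unfolding m_def by (rule filterlim_compose[OF filterlim_nat_sequentially t_top])
    have W: "tower_bounded G (W k)" for k
      unfolding W_def power2_eq_square
      by (intro tower_bounded_mult[OF G] tower_bounded_diff[OF G] tower_bounded_koopman[OF G]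
          regular_functions_bounded[OF G C])
    have Wsum: "0 \<le> (\<Sum>l<\<phi> y. W k y l)" for k y by (intro sum_nonneg) (simp add: W_def)
    have "(\<lambda>n. tower_int (W (m n))) \<longlonglongrightarrow> 0"
      unfolding W_def using koopman_defect_tendsto_0[OF G H K] m_top by (rule filterlim_compose)
    then have "(\<lambda>n. \<integral>y. norm (\<Sum>l<\<phi> y. W (m n) y l) \<partial>\<mu>) \<longlonglongrightarrow> 0"
      using Wsum by (simp add: tower_int_def)
    from tendsto_L1_AE_subseq[OF tower_bounded_integrable[OF G W] this]
    obtain q where q: "strict_mono q" "AE y in \<mu>. (\<lambda>n. \<Sum>l<\<phi> y. W (m (q n)) y l) \<longlonglongrightarrow> 0"
      by blast
    show ?thesis using q(2) goodD(2)[OF G]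
    proof eventually_elim
      case (elim y)
      note y = elim(2)
      let ?p = "\<phi> y - 1"
      have p: "?p < \<phi> y" "Suc ?p = \<phi> y" using phi_good[OF G y] by auto
      have W_le: "(u (Suc k) (F y) - u (k - ?p) y)\<^sup>2 \<le> (\<Sum>l<\<phi> y. W k y l)" if "?p \<le> k" for k
      proof -
        have "(u (Suc k) (F y) - u (k - ?p) y)\<^sup>2 = W k y ?p"
          using p tower_op_power_level[OF that, of H y] by (simp add: W_def koopman_def u_def)
        also have "\<dots> \<le> (\<Sum>l<\<phi> y. W k y l)"
          by (rule member_le_sum) (use p in \<open>auto simp: W_def\<close>)
        finally show ?thesis .
      qed
      have ev: "\<forall>\<^sub>F n in sequentially. (u (nat (int (s (r (q n))) + i)) (F y) -
          u (nat (int (s (r (q n))) + (i - int (\<phi> y)))) y)\<^sup>2 \<le> (\<Sum>l<\<phi> y. W (m (q n)) y l)"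
      proof -
        have "filterlim (\<lambda>n. int (s (r (q n))) + (i - int (\<phi> y))) at_top sequentially"
          by (rule filterlim_compose[OF t_top filterlim_subseq[OF q(1)]])
        then have "\<forall>\<^sub>F n in sequentially. 0 \<le> int (s (r (q n))) + (i - int (\<phi> y))"
          by (simp add: filterlim_at_top)
        then show ?thesis
        proof eventually_elim
          case (elim n)
          have e: "?p \<le> m (q n)" "Suc (m (q n)) = nat (int (s (r (q n))) + i)"
            "m (q n) - ?p = nat (int (s (r (q n))) + (i - int (\<phi> y)))"
            using elim p by (auto simp: m_def)
          from W_le[OF e(1), unfolded e(2,3)] show ?case .
        qed
      qed
      have "(\<lambda>n. (u (nat (int (s (r (q n))) + i)) (F y) -
          u (nat (int (s (r (q n))) + (i - int (\<phi> y)))) y)\<^sup>2) \<longlonglongrightarrow> (\<psi> i (F y) - \<psi> (i - int (\<phi> y)) y)\<^sup>2"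
        by (intro tendsto_power tendsto_diff lim[THEN LIMSEQ_subseq_LIMSEQ[OF _ q(1)], unfolded o_def]
            y goodD(3)[OF G])
      moreover have "(\<lambda>n. (u (nat (int (s (r (q n))) + i)) (F y) -
          u (nat (int (s (r (q n))) + (i - int (\<phi> y)))) y)\<^sup>2) \<longlonglongrightarrow> 0"
        by (rule tendsto_sandwich[OF _ ev tendsto_const elim(1)]) simp
      ultimately have "(\<psi> i (F y) - \<psi> (i - int (\<phi> y)) y)\<^sup>2 = 0" by (rule LIMSEQ_unique)
      then show ?case by simp
    qed
  qed
  then have "AE y in \<mu>. \<forall>i. \<psi> i (F y) = \<psi> (i - int (\<phi> y)) y"
    by (simp add: AE_all_countable)
  with goodD(2)[OF G] have "AE y in \<mu>. y \<in> G \<and> (\<forall>i. \<psi> i (F y) = \<psi> (i - int (\<phi> y)) y)"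
    by eventually_elim simp
  then obtain G' where G': "good G'" "\<And>y. y \<in> G' \<Longrightarrow> y \<in> G \<and> (\<forall>i. \<psi> i (F y) = \<psi> (i - int (\<phi> y)) y)"
  proof (rule good_subset_exists)
    fix G'
    assume "good G'" "\<And>y. y \<in> G' \<Longrightarrow> y \<in> G \<and> (\<forall>i. \<psi> i (F y) = \<psi> (i - int (\<phi> y)) y)"
    then show thesis by (rule that)
  qed
  show thesis
  proof (rule that[OF r G'(1)])
    show "G' \<subseteq> G" using G'(2) by blast
    show "(\<lambda>n. (tower_op ^^ nat (int (s (r n)) + i)) H y 0) \<longlonglongrightarrow> \<psi> i y" if "y \<in> G'" for y i
      using lim[of y i] G'(2)[OF that] by (simp add: u_def)
    show "\<psi> i \<in> borel_measurable \<mu>" for i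
      unfolding \<psi>_def[abs_def] u_def by (intro borel_measurable_lim_metric regular_functionsD(1)[OF C])
    show "\<bar>\<psi> i y\<bar> \<le> 3" if "y \<in> G'" for y i
    proof -
      have y: "y \<in> G" using G'(2)[OF that] by simp
      have "(\<lambda>n. \<bar>u (nat (int (s (r n)) + i)) y\<bar>) \<longlonglongrightarrow> \<bar>\<psi> i y\<bar>"
        by (intro tendsto_rabs lim y)
      moreover have "\<bar>u k y\<bar> \<le> 3" for k
        using u_bounds[OF y, of k] by simp
      ultimately show ?thesis by (intro LIMSEQ_le_const2) auto
    qed
    show "\<psi> i (F y) = \<psi> (i - int (\<phi> y)) y" if "y \<in> G'" for y i
      using G'(2)[OF that] by simp
    show "\<bar>\<psi> i y - \<psi> i y'\<bar> \<le> 3 * (exp (K * d y y') - 1)"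
      if a: "a \<in> \<alpha>" "y \<in> a" "y' \<in> a" "y \<in> G'" "y' \<in> G'" for a y y' i
    proof -
      have y: "y \<in> G" "y' \<in> G" using G'(2) a by auto
      have "\<bar>u k y - u k y'\<bar> \<le> 3 * (exp (K * d y y') - 1)" for k
        by (rule regular_diff_le[OF u_reg[OF a(1,2,3) y] u_reg[OF a(1,3,2) y(2,1)]])
          (use u_bounds[OF y(1), of k] u_bounds[OF y(2), of k] K in auto)
      moreover have "(\<lambda>n. \<bar>u (nat (int (s (r n)) + i)) y - u (nat (int (s (r n)) + i)) y'\<bar>)
          \<longlonglongrightarrow> \<bar>\<psi> i y - \<psi> i y'\<bar>"
        by (intro tendsto_rabs tendsto_diff lim y)
      ultimately show ?thesis by (intro LIMSEQ_le_const2) auto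
    qed
  qed
qed

end

end

section \<open>Rigidity of limits and aperiodicity\<close>

lemma sum_shift_periodic:
  fixes q :: "nat \<Rightarrow> 'a::ab_group_add"
  assumes "\<And>i. q (i + p) = q i"
  shows "(\<Sum>i<p. q (i + m)) = (\<Sum>i<p. q i)"
proof (induction m)
  case (Suc m)
  have "q m + (\<Sum>i<p. q (Suc i + m)) = (\<Sum>i<Suc p. q (i + m))"
    by (simp only: sum.lessThan_Suc_shift) simp
  also have "\<dots> = (\<Sum>i<p. q (i + m)) + q m"
    using assms[of m] by (simp add: add.commute)
  finally show ?case using Suc by simp
qed simp

text \<open>Summing the Fourier coefficients over all \<open>p\<close>-th roots of unity isolates the term of index \<open>0\<close>,
  by orthogonality of characters.\<close>

lemma zeroth_term_eq_mean:
  fixes x :: "nat \<Rightarrow> real"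
  assumes p: "0 < p"
    and zero: "\<And>z :: complex. z ^ p = 1 \<Longrightarrow> z \<noteq> 1 \<Longrightarrow> (\<Sum>i<p. z ^ i * of_real (x i)) = 0"
  shows "real p * x 0 = (\<Sum>i<p. x i)"
proof -
  define w where "w k = cis (2 * pi * real k / real p)" for k
  have bij: "bij_betw w {..<p} {z. z ^ p = 1}"
    unfolding w_def[abs_def] by (rule Complex.bij_betw_roots_unity[OF p])
  have w0: "w 0 = 1" by (simp add: w_def)
  have root: "w k ^ p = 1" if "k < p" for k
    using bij_betwE[OF bij] that by auto
  have w1: "w k \<noteq> 1" if "k < p" "k \<noteq> 0" for k
  proof
    assume "w k = 1"
    then have "w k = w 0" by (simp add: w0)
    then show False using bij_betw_imp_inj_on[OF bij] that p by (auto dest: inj_onD)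
  qed
  have sym: "w k ^ i = w i ^ k" for i k
    by (simp add: w_def Complex.DeMoivre mult.commute mult.left_commute)
  have col: "(\<Sum>k<p. w k ^ i) = (if i = 0 then of_nat p else 0)" if "i < p" for i
  proof (cases "i = 0")
    case False
    have "(\<Sum>k<p. w k ^ i) = (\<Sum>k<p. w i ^ k)" by (simp add: sym)
    also have "\<dots> = 0"
      using w1[OF that False] root[OF that] by (simp add: sum_gp_strict)
    finally show ?thesis using False by simp
  qed simp
  have "(\<Sum>k<p. \<Sum>i<p. w k ^ i * of_real (x i)) = (\<Sum>k<p. if k = 0 then of_real (\<Sum>i<p. x i) else 0)"
  proof (intro sum.cong refl)
    fix k assume "k \<in> {..<p}"
    then show "(\<Sum>i<p. w k ^ i * of_real (x i)) = (if k = 0 then of_real (\<Sum>i<p. x i) else 0)"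
      using zero[OF root w1, of k] by (simp add: w0)
  qed
  also have "\<dots> = of_real (\<Sum>i<p. x i)"
    using p by simp
  finally have "of_real (\<Sum>i<p. x i) = (\<Sum>k<p. \<Sum>i<p. w k ^ i * of_real (x i))" ..
  also have "\<dots> = (\<Sum>i<p. (\<Sum>k<p. w k ^ i) * of_real (x i))"
    by (subst sum.swap) (simp add: sum_distrib_right)
  also have "\<dots> = (\<Sum>i<p. if i = 0 then of_nat p * of_real (x i) else 0)"
    using col by (intro sum.cong) auto
  also have "\<dots> = of_real (real p * x 0)"
    using p by simp
  finally show ?thesis by (simp only: of_real_eq_iff)
qed

context gibbs_markov_tower
begin

text \<open>Testing against the conjugate sign of the difference yields its \<open>L\<^sup>1\<close> norm.\<close>

lemma transfer_op_unique:
  fixes u u' :: "'x \<Rightarrow> complex"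
  assumes u: "integrable \<mu> u" "integrable \<mu> u'"
    and eq: "\<And>w. w \<in> borel_measurable \<mu> \<Longrightarrow> \<exists>B. \<forall>y. norm (w y) \<le> B \<Longrightarrow>
      (\<integral>y. u y * w y \<partial>\<mu>) = (\<integral>y. u' y * w y \<partial>\<mu>)"
  shows "AE y in \<mu>. u y = u' y"
proof -
  have [measurable]: "u \<in> borel_measurable \<mu>" "u' \<in> borel_measurable \<mu>" using u by auto
  define w where "w y = cnj (sgn (u y - u' y))" for y
  have w [measurable]: "w \<in> borel_measurable \<mu>"
  proof -
    have "(\<lambda>y. sgn (u y - u' y)) \<in> borel_measurable \<mu>"
      unfolding sgn_div_norm by measurable
    then show ?thesis
      unfolding w_def by (rule measurable_compose) (intro borel_measurable_continuous_onI continuous_intros)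
  qed
  have wb: "norm (w y) \<le> 1" for y by (simp add: w_def norm_sgn)
  have int: "integrable \<mu> (\<lambda>y. v y * w y)" if "integrable \<mu> v" for v
    by (rule Bochner_Integration.integrable_bound[OF that])
      (use that wb in \<open>auto simp: norm_mult mult_left_le\<close>)
  have z: "z * cnj (sgn z) = of_real (norm z)" for z :: complex
  proof (cases "z = 0")
    case False
    have "z * cnj (sgn z) = (z * cnj z) / of_real (norm z)"
      by (simp add: sgn_eq)
    also have "\<dots> = of_real (norm z)"
      using False by (simp add: complex_norm_square[symmetric] power2_eq_square)
    finally show ?thesis .
  qed simp
  have "(\<integral>y. of_real (norm (u y - u' y)) \<partial>\<mu>) = (\<integral>y. u y * w y - u' y * w y \<partial>\<mu>)"
    by (rule Bochner_Integration.integral_cong) (auto simp: w_def z simp flip: left_diff_distrib)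
  also have "\<dots> = 0"
    using eq[OF w] wb int u by auto
  finally have "(\<integral>y. norm (u y - u' y) \<partial>\<mu>) = 0"
    by (simp only: integral_complex_of_real of_real_eq_0_iff)
  then have "AE y in \<mu>. norm (u y - u' y) = 0"
    using u by (subst (asm) integral_nonneg_eq_0_iff_AE) auto
  then show ?thesis by simp
qed

text \<open>The operator is defined by an arbitrary choice; by uniqueness, any candidate that satisfies the
  duality relation agrees with the chosen one.\<close>

lemma transfer_op_eqI:
  assumes u: "integrable \<mu> u"
    and eq: "\<And>w. w \<in> borel_measurable \<mu> \<Longrightarrow> \<exists>B. \<forall>y. norm (w y) \<le> B \<Longrightarrow>
      (\<integral>y. u y * w y \<partial>\<mu>) = (\<integral>y. v y * w (F y) \<partial>\<mu>)"
  shows "AE y in \<mu>. transfer_op \<mu> F v y = u y"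
proof -
  let ?P = "\<lambda>u. integrable \<mu> u \<and>
        (\<forall>w\<in>borel_measurable \<mu>. (\<exists>B. \<forall>y. norm (w y) \<le> B) \<longrightarrow>
           (\<integral>y. u y * w y \<partial>\<mu>) = (\<integral>y. v y * w (F y) \<partial>\<mu>))"
  have "?P u" using u eq by blast
  from someI[of ?P, OF this] have P: "?P (transfer_op \<mu> F v)"
    unfolding transfer_op_def .
  show ?thesis
  proof (rule transfer_op_unique)
    show "integrable \<mu> (transfer_op \<mu> F v)" using P by (rule conjunct1)
    fix w :: "'x \<Rightarrow> complex"
    assume w: "w \<in> borel_measurable \<mu>" "\<exists>B. \<forall>y. norm (w y) \<le> B"
    show "(\<integral>y. transfer_op \<mu> F v y * w y \<partial>\<mu>) = (\<integral>y. u y * w y \<partial>\<mu>)"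
      unfolding eq[OF w] using P[THEN conjunct2, THEN bspec, OF w(1)] w(2) by simp
  qed (rule u)
qed

text \<open>The density of the part of the base that reaches a given point after return time \<open>n\<close>.\<close>

definition return_density :: "nat \<Rightarrow> 'x \<Rightarrow> real" where
  "return_density n = real_ruelle (\<lambda>x. indicator {x. \<phi> x = n} x)"

lemma return_density_measurable [measurable]: "return_density n \<in> borel_measurable \<mu>"
  unfolding return_density_def by measurable

context
  fixes G assumes G: "good G"
begin

lemma ennreal_return_density:
  "y \<in> G \<Longrightarrow> ennreal (return_density n y) = ruelle (\<lambda>x. indicator {x. \<phi> x = n} x) y"
  unfolding return_density_def
  by (subst ennreal_real_ruelle[OF G, where B=1]) (auto simp: indicator_def intro!: arg_cong2[of _ _ _ _ ruelle])

lemma return_density_nonneg: "0 \<le> return_density n y"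
  by (simp add: return_density_def real_ruelle_nonneg)

text \<open>The sets of constant return time exhaust the base, so the densities add up to the transfer operator of
  the constant \<open>1\<close>.\<close>

lemma return_density_sums:
  assumes y: "y \<in> G"
  shows "(\<lambda>n. return_density (Suc n) y) sums 1"
proof -
  let ?q = "\<lambda>n x. indicator {x. \<phi> x = Suc n} x :: ennreal"
  have "branch_op a (\<lambda>x. \<Sum>n. ?q n x) y = (\<Sum>n. branch_op a (?q n) y)" for a
    by (simp add: branch_op_def)
  then have "ruelle (\<lambda>x. \<Sum>n. ?q n x) y = (\<Sum>n. ruelle (?q n) y)"
    unfolding ruelle_def by (simp add: nn_integral_suminf)
  moreover have "(\<Sum>n. ?q n x) = 1" if x: "x \<in> G" for x
  proof -
    obtain p where p: "\<phi> x = Suc p" using phi_good[OF G x] by (cases "\<phi> x") auto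
    have "(\<Sum>n. ?q n x) = (\<Sum>n\<in>{p}. ?q n x)"
      by (rule suminf_finite) (use p in auto)
    then show ?thesis using p by simp
  qed
  then have "ruelle (\<lambda>x. \<Sum>n. ?q n x) y = ruelle (\<lambda>_. 1) y"
    by (intro antisym ruelle_mono[OF G y]) auto
  ultimately have "(\<Sum>n. ennreal (return_density (Suc n) y)) = 1"
    using goodD(9)[OF G y] by (simp add: ennreal_return_density[OF y])
  then have "(\<lambda>n. ennreal (return_density (Suc n) y)) sums ennreal 1"
    using summable_sums[OF summableI, of "\<lambda>n. ennreal (return_density (Suc n) y)"] by simp
  then show ?thesis
    by (subst (asm) sums_ennreal) (auto simp: return_density_nonneg)
qed

lemma return_density_le_1: "y \<in> G \<Longrightarrow> return_density n y \<le> 1"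
  unfolding return_density_def by (rule real_ruelle_le[OF G]) auto

lemma integral_return_density:
  fixes w :: "'x \<Rightarrow> complex"
  assumes [measurable]: "w \<in> borel_measurable \<mu>"
  shows "(\<integral>x. indicator {x. \<phi> x = n} x *\<^sub>R w (F x) \<partial>\<mu>) = (\<integral>y. return_density n y *\<^sub>R w y \<partial>\<mu>)"
proof -
  let ?q = "\<lambda>x. indicator {x. \<phi> x = n} x :: real"
  have [measurable]: "?q \<in> borel_measurable \<mu>" by measurable
  have "distr (density \<mu> ?q) \<mu> F = density \<mu> (return_density n)"
  proof (rule measure_eqI)
    fix A assume "A \<in> sets (distr (density \<mu> ?q) \<mu> F)"
    then have [measurable]: "A \<in> sets \<mu>" by simp
    have "emeasure (distr (density \<mu> ?q) \<mu> F) A = emeasure (density \<mu> ?q) (F -` A \<inter> space \<mu>)"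
      by (subst emeasure_distr) auto
    also have "\<dots> = (\<integral>\<^sup>+x. ennreal (?q x) * indicator (F -` A \<inter> space \<mu>) x \<partial>\<mu>)"
      by (rule emeasure_density) measurable
    also have "\<dots> = (\<integral>\<^sup>+x. indicator {x. \<phi> x = n} x * indicator A (F x) \<partial>\<mu>)"
      by (rule nn_integral_cong) (auto simp: indicator_def)
    also have "\<dots> = (\<integral>\<^sup>+y. ruelle (\<lambda>x. indicator {x. \<phi> x = n} x) y * indicator A y \<partial>\<mu>)"
      by (rule ruelle_duality) measurable
    also have "\<dots> = (\<integral>\<^sup>+y. ennreal (return_density n y) * indicator A y \<partial>\<mu>)"
      by (rule nn_integral_cong_AE)
        (use goodD(2)[OF G] in eventually_elim, simp add: ennreal_return_density)
    also have "\<dots> = emeasure (density \<mu> (return_density n)) A"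
      by (rule emeasure_density[symmetric]) measurable
    finally show "emeasure (distr (density \<mu> ?q) \<mu> F) A = emeasure (density \<mu> (return_density n)) A" .
  qed simp
  then have "(\<integral>y. w y \<partial>distr (density \<mu> ?q) \<mu> F) = (\<integral>y. w y \<partial>density \<mu> (return_density n))"
    by simp
  also have "(\<integral>y. w y \<partial>distr (density \<mu> ?q) \<mu> F) = (\<integral>x. w (F x) \<partial>density \<mu> ?q)"
    by (rule integral_distr) measurable
  also have "\<dots> = (\<integral>x. ?q x *\<^sub>R w (F x) \<partial>\<mu>)"
    by (rule integral_density) auto
  also have "(\<integral>y. w y \<partial>density \<mu> (return_density n)) = (\<integral>y. return_density n y *\<^sub>R w y \<partial>\<mu>)"
    by (rule integral_density) (auto simp: return_density_nonneg)
  finally show ?thesis .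
qed

text \<open>Where the return time is \<open>n\<close>, \<open>h\<close> equals \<open>(h \<circ> F) / z ^ n\<close>, and functions of \<open>F\<close> pass
  through the transfer operator. The \<open>n\<close>-th term of the series is thus \<open>h\<close> times the \<open>n\<close>-th return
  density.\<close>

lemma transfer_series_fixed:
  assumes h [measurable]: "h \<in> borel_measurable \<mu>" and bound: "\<And>y. norm (h y) \<le> B"
    and z: "z \<noteq> 0" and eig: "\<And>y. y \<in> G \<Longrightarrow> h (F y) = z ^ \<phi> y * h y"
  shows "AE y in \<mu>. transfer_series \<mu> F \<phi> z h y = h y"
proof -
  have part: "AE y in \<mu>. transfer_part \<mu> F \<phi> n h y = of_real (return_density n y) * (h y / z ^ n)" for n
    unfolding transfer_part_def
  proof (rule transfer_op_eqI)
    show "integrable \<mu> (\<lambda>y. of_real (return_density n y) * (h y / z ^ n))"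
    proof (rule integrable_const_bound[where B="B / norm z ^ n"])
      show "AE y in \<mu>. norm (of_real (return_density n y) * (h y / z ^ n)) \<le> B / norm z ^ n"
        using goodD(2)[OF G]
      proof eventually_elim
        case (elim y)
        have "norm (of_real (return_density n y) * (h y / z ^ n)) = return_density n y * (norm (h y) / norm z ^ n)"
          by (simp add: norm_mult norm_divide norm_power return_density_nonneg)
        also have "\<dots> \<le> 1 * (B / norm z ^ n)"
          using return_density_le_1[OF elim, of n] bound[of y]
          by (intro mult_mono divide_right_mono) (auto simp: return_density_nonneg)
        finally show ?case by simp
      qed
    qed measurable
    fix w :: "'x \<Rightarrow> complex" assume [measurable]: "w \<in> borel_measurable \<mu>"
    have "(\<integral>y. of_real (return_density n y) * (h y / z ^ n) * w y \<partial>\<mu>) =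
        (\<integral>y. return_density n y *\<^sub>R (h y / z ^ n * w y) \<partial>\<mu>)"
      by (simp add: scaleR_conv_of_real mult.assoc)
    also have "\<dots> = (\<integral>x. indicator {x. \<phi> x = n} x *\<^sub>R (h (F x) / z ^ n * w (F x)) \<partial>\<mu>)"
      by (rule integral_return_density[symmetric]) measurable
    also have "\<dots> = (\<integral>y. indicator {y. \<phi> y = n} y * h y * w (F y) \<partial>\<mu>)"
    proof (rule integral_cong_AE)
      show "AE x in \<mu>. indicator {x. \<phi> x = n} x *\<^sub>R (h (F x) / z ^ n * w (F x)) =
          indicator {y. \<phi> y = n} x * h x * w (F x)"
        using goodD(2)[OF G] by eventually_elim (use eig z in \<open>auto simp: indicator_def\<close>)
    qed measurable
    finally show "(\<integral>y. of_real (return_density n y) * (h y / z ^ n) * w y \<partial>\<mu>) =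
      (\<integral>y. indicator {y. \<phi> y = n} y * h y * w (F y) \<partial>\<mu>)" .
  qed
  then have "AE y in \<mu>. \<forall>n. transfer_part \<mu> F \<phi> n h y = of_real (return_density n y) * (h y / z ^ n)"
    by (simp add: AE_all_countable)
  with goodD(2)[OF G] show ?thesis
  proof eventually_elim
    case (elim y)
    have "z ^ Suc n * transfer_part \<mu> F \<phi> (Suc n) h y = of_real (return_density (Suc n) y) * h y" for n
    proof -
      have "transfer_part \<mu> F \<phi> (Suc n) h y = of_real (return_density (Suc n) y) * (h y / z ^ Suc n)"
        using elim(2) by blast
      then show ?thesis using z by simp
    qed
    moreover have "(\<lambda>n. of_real (return_density (Suc n) y) * h y) sums (of_real 1 * h y)"
      by (intro sums_mult2 sums_of_real return_density_sums elim)
    ultimately have "(\<lambda>n. z ^ Suc n * transfer_part \<mu> F \<phi> (Suc n) h y) sums h y" by simp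
    then show ?case by (simp add: transfer_series_def sums_iff)
  qed
qed

text \<open>Points of different elements have distance \<open>1\<close>, so a bound for the values bounds the Lipschitz
  constant.\<close>

lemma piecewise_constant_BY:
  assumes h: "h \<in> borel_measurable \<mu>" and bound: "\<And>y. norm (h y) \<le> B"
    and const: "\<And>a y y'. a \<in> \<alpha> \<Longrightarrow> y \<in> a \<Longrightarrow> y' \<in> a \<Longrightarrow> y \<in> G \<Longrightarrow> y' \<in> G \<Longrightarrow> h y = h y'"
  shows "h \<in> BY \<mu> F \<alpha> \<theta>"
proof -
  have "AE y in \<mu>. \<not> y \<notin> G" using goodD(2)[OF G] by simp
  then have Z: "space \<mu> - G \<in> null_sets \<mu>"
    using goodD(1)[OF G] by (subst AE_iff_null_sets) (auto elim!: eventually_mono)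
  have sp: "space \<mu> - (space \<mu> - G) = G" using goodD(10)[OF G] by auto
  have "BY_norm \<mu> F \<alpha> \<theta> h \<le> lip_norm G d h"
    unfolding BY_norm_def using INF_lower[OF Z, of "\<lambda>N. lip_norm (space \<mu> - N) d h"] by (simp add: sp)
  also have "lip_norm G d h \<le> ennreal B + ennreal (2 * B)"
    unfolding lip_norm_def
  proof (intro add_mono SUP_least)
    show "ennreal (norm (h y)) \<le> ennreal B" for y
      using bound by (rule ennreal_leI)
    fix y y' assume y: "y \<in> G" "y' \<in> G - {y}"
    obtain a b where ab: "a \<in> \<alpha>" "y \<in> a" "b \<in> \<alpha>" "y' \<in> b"
      using goodD(6)[OF G] y by blast
    show "ennreal (norm (h y - h y') / d y y') \<le> ennreal (2 * B)"
    proof (cases "a = b")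
      case True
      then show ?thesis using const[of a y y'] ab y by simp
    next
      case False
      then have "separated_at \<alpha> F y y' 0"
        using ab by (auto simp: separated_at_def)
      then have "(LEAST n. separated_at \<alpha> F y y' n) = 0" by (rule Least_eq_0)
      with \<open>separated_at \<alpha> F y y' 0\<close> have "d y y' = 1"
        by (auto simp: sep_dist_eq)
      moreover have "norm (h y - h y') \<le> 2 * B"
        using norm_triangle_ineq4[of "h y" "h y'"] bound[of y] bound[of y'] by linarith
      ultimately show ?thesis by (auto intro: ennreal_leI)
    qed
  qed
  also have "\<dots> < \<infinity>" by (simp add: ennreal_add_eq_top less_top)
  finally show ?thesis using h by (simp add: BY_def)
qed

text \<open>Both \<open>h\<close> and \<open>0\<close> are fixed points of the operator, and \<open>1\<close> outside its spectrum allows only one.\<close>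

lemma aperiodic_eigenfunction_zero:
  fixes z :: complex
  assumes ap: "aperiodic \<mu> F \<phi> \<alpha> \<theta>" and z: "norm z = 1" "z \<noteq> 1"
    and h [measurable]: "h \<in> borel_measurable \<mu>" and bound: "\<And>y. norm (h y) \<le> B"
    and const: "\<And>a y y'. a \<in> \<alpha> \<Longrightarrow> y \<in> a \<Longrightarrow> y' \<in> a \<Longrightarrow> y \<in> G \<Longrightarrow> y' \<in> G \<Longrightarrow> h y = h y'"
    and eig: "\<And>y. y \<in> G \<Longrightarrow> h (F y) = z ^ \<phi> y * h y"
  shows "AE y in \<mu>. h y = 0"
proof -
  have z0: "z \<noteq> 0" using z by auto
  have "1 \<notin> spectrum_on \<mu> (BY \<mu> F \<alpha> \<theta>) (BY_norm \<mu> F \<alpha> \<theta>) (transfer_series \<mu> F \<phi> z)"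
    using ap z unfolding aperiodic_def by simp
  then obtain K :: real where K: "\<forall>u\<in>BY \<mu> F \<alpha> \<theta>. \<exists>v\<in>BY \<mu> F \<alpha> \<theta>.
            (AE y in \<mu>. 1 * v y - transfer_series \<mu> F \<phi> z v y = u y) \<and>
            BY_norm \<mu> F \<alpha> \<theta> v \<le> ennreal K * BY_norm \<mu> F \<alpha> \<theta> u \<and>
            (\<forall>v'\<in>BY \<mu> F \<alpha> \<theta>. (AE y in \<mu>. 1 * v' y - transfer_series \<mu> F \<phi> z v' y = u y) \<longrightarrow>
               (AE y in \<mu>. v' y = v y))"
    unfolding spectrum_on_def by blast
  have zero: "(\<lambda>_. 0) \<in> BY \<mu> F \<alpha> \<theta>"
    by (rule piecewise_constant_BY[where B=0]) auto
  have hBY: "h \<in> BY \<mu> F \<alpha> \<theta>"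
    by (rule piecewise_constant_BY[OF h bound const])
  obtain v where v: "\<forall>v'\<in>BY \<mu> F \<alpha> \<theta>. (AE y in \<mu>. 1 * v' y - transfer_series \<mu> F \<phi> z v' y = 0) \<longrightarrow>
               (AE y in \<mu>. v' y = v y)"
    using bspec[OF K zero] by blast
  have "AE y in \<mu>. transfer_series \<mu> F \<phi> z h y = h y"
    by (rule transfer_series_fixed[OF h bound z0]) (rule eig)
  then have "AE y in \<mu>. 1 * h y - transfer_series \<mu> F \<phi> z h y = 0"
    by eventually_elim simp
  then have 1: "AE y in \<mu>. h y = v y" using v hBY by blast
  have "AE y in \<mu>. transfer_series \<mu> F \<phi> z (\<lambda>_. 0) y = 0"
    by (rule transfer_series_fixed[where B=0]) (use z0 in auto)
  then have "AE y in \<mu>. 1 * 0 - transfer_series \<mu> F \<phi> z (\<lambda>_. 0) y = 0"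
    by eventually_elim simp
  then have 2: "AE y in \<mu>. 0 = v y" using bspec[OF v zero] by simp
  from 1 2 show ?thesis by eventually_elim simp
qed


end

text \<open>From here on \<open>\<psi>\<close> is a family as obtained in \<open>limit_cocycle\<close>.\<close>

context
  fixes G \<psi> K
  assumes G: "good G" and K: "0 \<le> K"
    and measurable_psi: "\<And>i :: int. \<psi> i \<in> borel_measurable \<mu>"
    and psi_bound: "\<And>y i. y \<in> G \<Longrightarrow> \<bar>\<psi> i y\<bar> \<le> (3 :: real)"
    and cocycle: "\<And>y i. y \<in> G \<Longrightarrow> \<psi> i (F y) = \<psi> (i - int (\<phi> y)) y"
    and psi_regular: "\<And>a y y' i. a \<in> \<alpha> \<Longrightarrow> y \<in> a \<Longrightarrow> y' \<in> a \<Longrightarrow> y \<in> G \<Longrightarrow> y' \<in> G \<Longrightarrow>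
      \<bar>\<psi> i y - \<psi> i y'\<bar> \<le> 3 * (exp (K * d y y') - 1)"
begin

text \<open>Pulling back along an inverse branch contracts distances by \<open>\<theta>\<close> and only shifts the index of
  the family, so the Lipschitz constant, which is uniform in the index, can be improved by the factor
  \<open>\<theta>\<close> indefinitely.\<close>

lemma cocycle_constant_on_elements:
  assumes "a \<in> \<alpha>" "y \<in> a" "y' \<in> a" "y \<in> G" "y' \<in> G"
  shows "\<psi> i y = \<psi> i y'"
proof -
  define M where "M = 3 * (K * exp K)"
  have exp_le: "exp x - 1 \<le> x * exp x" for x :: real
    using exp_ge_add_one_self[of "- x"] by (simp add: exp_minus field_simps)
  have "\<bar>\<psi> i y - \<psi> i y'\<bar> \<le> M * \<theta> ^ n * d y y'" for n
    using assms
  proof (induction n arbitrary: a y y' i)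
    case 0
    have "exp (K * d y y') - 1 \<le> K * d y y' * exp (K * d y y')" by (rule exp_le)
    also have "\<dots> \<le> K * d y y' * exp K"
      using K dist_nonneg[of y y'] dist_le_1[of y y'] by (intro mult_left_mono) (auto intro: mult_left_le)
    finally have "3 * (exp (K * d y y') - 1) \<le> 3 * (K * d y y' * exp K)" by simp
    also have "\<dots> = M * d y y'" by (simp add: M_def)
    finally have "3 * (exp (K * d y y') - 1) \<le> M * d y y'" .
    with psi_regular[OF 0, of i] show ?case by simp
  next
    case (Suc n)
    obtain c x where x: "c \<in> \<alpha>" "x \<in> c" "x \<in> G" "F x = y"
      by (rule good_branch[OF G Suc.prems(4)])
    then have "y \<in> F ` (c - N)" using goodD(5)[OF G] by auto
    then have y': "y' \<in> F ` (c - N)"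
      by (rule goodD(8)[OF G x(1) Suc.prems(1,2,4,3,5)])
    let ?x' = "inv_branch c y'"
    note x' = inv_branch_good[OF G x(1) Suc.prems(5) y']
    have "\<psi> i y = \<psi> (i - int (\<phi> x)) x"
      using cocycle[OF x(3), of i] x(4) by simp
    moreover have "\<psi> i y' = \<psi> (i - int (\<phi> x)) ?x'"
      using cocycle[OF x'(1), of i] x'(3) phi_eq[OF x(1,2) x'(2)] by simp
    ultimately have "\<bar>\<psi> i y - \<psi> i y'\<bar> \<le> M * \<theta> ^ n * d x ?x'"
      using Suc.IH[OF x(1,2) x'(2) x(3) x'(1)] by simp
    also have "d x ?x' = \<theta> * d y y'"
      using dist_step[OF G x(1,2) x'(2) x(3) x'(1)] x(4) x'(3) by simp
    finally show ?case by (simp add: mult_ac)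
  qed
  moreover have "(\<lambda>n. M * \<theta> ^ n * d y y') \<longlonglongrightarrow> M * 0 * d y y'"
    using theta by (intro tendsto_intros LIMSEQ_power_zero) auto
  ultimately have "\<bar>\<psi> i y - \<psi> i y'\<bar> \<le> 0"
    by (intro LIMSEQ_le_const[where a="\<bar>\<psi> i y - \<psi> i y'\<bar>"]) auto
  then show ?thesis by simp
qed

lemma cocycle_power:
  "y \<in> G \<Longrightarrow> \<exists>m\<ge>n. \<forall>i. \<psi> i ((F ^^ n) y) = \<psi> (i - int m) y"
proof (induction n)
  case (Suc n)
  then obtain m where m: "m \<ge> n" "\<And>i. \<psi> i ((F ^^ n) y) = \<psi> (i - int m) y" by blast
  let ?y = "(F ^^ n) y"
  have y: "?y \<in> G" by (rule F_power_good[OF G Suc.prems])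
  have "\<psi> i ((F ^^ Suc n) y) = \<psi> (i - int (\<phi> ?y + m)) y" for i
    using cocycle[OF y, of i] m(2)[of "i - int (\<phi> ?y)"] by (simp add: algebra_simps)
  then show ?case
    using m(1) phi_good[OF G y] by (intro exI[of _ "\<phi> ?y + m"]) auto
qed (intro exI[of _ 0], simp)

text \<open>The elements of \<open>x\<close> and \<open>y\<close> are joined by an orbit, along which only the index moves; within an
  element the family does not vary. A nonzero shift is guaranteed even for \<open>x = y\<close>, which is what
  yields a period.\<close>

lemma cocycle_shift:
  assumes a: "a \<in> \<alpha>" "x \<in> a" "x \<in> G" and b: "b \<in> \<alpha>" "y \<in> b" "y \<in> G"
  obtains m where "1 \<le> m" "\<And>i. \<psi> i y = \<psi> (i - int m) x"
proof -
  obtain z n where z: "z \<in> a" "z \<in> G" "1 \<le> n" "(F ^^ n) z \<in> b"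
    by (rule ergodic_connects[OF G a(1) b(1)])
  obtain m where m: "m \<ge> n" "\<And>i. \<psi> i ((F ^^ n) z) = \<psi> (i - int m) z"
    using cocycle_power[OF z(2), of n] by blast
  show thesis
  proof (rule that)
    show "1 \<le> m" using m(1) z(3) by simp
    show "\<psi> i y = \<psi> (i - int m) x" for i
      using cocycle_constant_on_elements[OF b(1,2) z(4) b(3) F_power_good[OF G z(2)], of i] m(2)[of i]
        cocycle_constant_on_elements[OF a(1) z(1) a(2) z(2) a(3), of "i - int m"] by simp
  qed
qed

lemma good_nonempty: obtains a x where "a \<in> \<alpha>" "x \<in> a" "x \<in> G"
proof -
  have "\<not> (AE y in \<mu>. False)" by simp
  then obtain x where "x \<in> G"
    using goodD(2)[OF G] by (metis (mono_tags, lifting) eventually_mono)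
  with goodD(6)[OF G] that show thesis by blast
qed

lemma cocycle_periodic:
  obtains p where "1 \<le> p" "\<And>y i. y \<in> G \<Longrightarrow> \<psi> (i + int p) y = \<psi> i y"
proof -
  obtain a x where a: "a \<in> \<alpha>" "x \<in> a" "x \<in> G" by (rule good_nonempty)
  obtain p where p: "1 \<le> p" "\<And>i. \<psi> i x = \<psi> (i - int p) x"
    using cocycle_shift[OF a a] by blast
  show thesis
  proof (rule that[OF p(1)])
    fix y i assume y: "y \<in> G"
    obtain b where b: "b \<in> \<alpha>" "y \<in> b" using goodD(6)[OF G y] by blast
    obtain m where m: "\<And>i. \<psi> i y = \<psi> (i - int m) x"
      using cocycle_shift[OF a b y] by blast
    show "\<psi> (i + int p) y = \<psi> i y"
      using m[of "i + int p"] m[of i] p(2)[of "i + int p - int m"] by (simp add: algebra_simps)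
  qed
qed

text \<open>The discrete Fourier coefficients of the periodic family over the common period solve the
  eigenvalue equation; aperiodicity kills all of them but the zeroth.\<close>

lemma fourier_coefficient_zero:
  fixes z :: complex
  assumes ap: "aperiodic \<mu> F \<phi> \<alpha> \<theta>" and p: "1 \<le> p"
    and per: "\<And>y i. y \<in> G \<Longrightarrow> \<psi> (i + int p) y = \<psi> i y"
    and z: "z ^ p = 1" "z \<noteq> 1" and y: "y \<in> G"
  shows "(\<Sum>i<p. z ^ i * of_real (\<psi> (int i) y)) = 0"
proof -
  define h where "h y = (if y \<in> G then \<Sum>i<p. z ^ i * of_real (\<psi> (int i) y) else 0)" for y
  have "norm z ^ p = 1" using z(1) by (metis norm_one norm_power)
  then have nz: "norm z = 1"
    using p power_eq_imp_eq_base[of "norm z" p 1] by simp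
  have const: "h y = h y'" if "a \<in> \<alpha>" "y \<in> a" "y' \<in> a" "y \<in> G" "y' \<in> G" for a y y'
    using cocycle_constant_on_elements[OF that] that by (simp add: h_def)
  have "AE y in \<mu>. h y = 0"
  proof (rule aperiodic_eigenfunction_zero[OF G ap nz z(2)])
    have [measurable]: "G \<in> sets \<mu>" by (rule goodD(1)[OF G])
    have [measurable]: "(\<lambda>y. \<psi> i y) \<in> borel_measurable \<mu>" for i by (rule measurable_psi)
    show "h \<in> borel_measurable \<mu>"
      unfolding h_def by measurable
    show "norm (h y) \<le> 3 * real p" for y
    proof (cases "y \<in> G")
      case True
      have "norm (h y) \<le> (\<Sum>i<p. norm (z ^ i * of_real (\<psi> (int i) y)))"
        using True by (simp add: h_def norm_sum)
      also have "\<dots> \<le> (\<Sum>i<p. 3)"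
        using psi_bound[OF True] nz by (intro sum_mono) (simp add: norm_mult norm_power)
      finally show ?thesis by simp
    qed (simp add: h_def)
    show "h y = h y'" if "a \<in> \<alpha>" "y \<in> a" "y' \<in> a" "y \<in> G" "y' \<in> G" for a y y'
      by (rule const[OF that])
    show "h (F y) = z ^ \<phi> y * h y" if y: "y \<in> G" for y
    proof -
      define q where "q i = z ^ i * complex_of_real (\<psi> (int i - int (\<phi> y)) y)" for i
      have "q (i + p) = q i" for i
        using per[OF y, of "int i - int (\<phi> y)"] z(1) by (simp add: q_def power_add algebra_simps)
      then have "(\<Sum>i<p. q (i + \<phi> y)) = (\<Sum>i<p. q i)" by (rule sum_shift_periodic)
      also have "(\<Sum>i<p. q i) = h (F y)"
        using goodD(3)[OF G y] by (simp add: h_def q_def cocycle[OF y])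
      also have "(\<Sum>i<p. q (i + \<phi> y)) = z ^ \<phi> y * h y"
        using y by (simp add: h_def q_def sum_distrib_left power_add mult_ac)
      finally show ?thesis ..
    qed
  qed
  obtain a where a: "a \<in> \<alpha>" "y \<in> a" using goodD(6)[OF G y] by blast
  have "\<not> (AE x in \<mu>. x \<notin> a)"
    by (rule alpha_not_null[OF a(1)])
  moreover have "AE x in \<mu>. h x = 0 \<and> x \<in> G"
    using \<open>AE y in \<mu>. h y = 0\<close> goodD(2)[OF G] by eventually_elim simp
  ultimately obtain x where x: "x \<in> a" "h x = 0" "x \<in> G"
    by (metis (mono_tags, lifting) eventually_mono)
  then have "h y = 0" using const[OF a(1) x(1) a(2) x(3) y] by simp
  then show ?thesis using y by (simp add: h_def)
qed

lemma cocycle_constant: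
  assumes ap: "aperiodic \<mu> F \<phi> \<alpha> \<theta>"
  obtains c where "\<And>y i. y \<in> G \<Longrightarrow> \<psi> i y = c"
proof -
  obtain p where p: "1 \<le> p" and per: "\<And>y i. y \<in> G \<Longrightarrow> \<psi> (i + int p) y = \<psi> i y"
    using cocycle_periodic by blast
  have mean: "real p * \<psi> j y = (\<Sum>i<p. \<psi> (int i) y)" if y: "y \<in> G" for y j
  proof -
    \<comment> \<open>A negative shift \<open>j\<close> is replaced by a congruent nonnegative one.\<close>
    define k where "k = nat (j mod int p)"
    have per_mult: "\<psi> (i + int p * int n) y = \<psi> i y" for i n
    proof (induction n)
      case (Suc n)
      then show ?case using per[OF y, of "i + int p * int n"] by (simp add: algebra_simps)
    qed simp
    have per_mult': "\<psi> (i + int p * l) y = \<psi> i y" for i l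
    proof (cases "0 \<le> l")
      case True
      then show ?thesis using per_mult[of i "nat l"] by simp
    next
      case False
      then show ?thesis using per_mult[of "i + int p * l" "nat (- l)"] by simp
    qed
    have "\<psi> j y = \<psi> (int k + int p * (j div int p)) y"
      using p by (simp add: k_def)
    also have "\<dots> = \<psi> (int k) y" by (rule per_mult')
    finally have jk: "\<psi> j y = \<psi> (int k) y" .
    have "real p * \<psi> (int (0 + k)) y = (\<Sum>i<p. \<psi> (int (i + k)) y)"
    proof (rule zeroth_term_eq_mean[of p "\<lambda>i. \<psi> (int (i + k)) y"])
      fix z :: complex assume z: "z ^ p = 1" "z \<noteq> 1"
      then have "z \<noteq> 0" using p by (auto simp: power_0_left)
      define q where "q i = z ^ i * complex_of_real (\<psi> (int i) y)" for i
      have "q (i + p) = q i" for i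
        using per[OF y, of "int i"] z(1) by (simp add: q_def power_add algebra_simps)
      then have "(\<Sum>i<p. q (i + k)) = (\<Sum>i<p. q i)" by (rule sum_shift_periodic)
      also have "\<dots> = 0"
        unfolding q_def by (rule fourier_coefficient_zero[OF ap p per z y])
      finally have "z ^ k * (\<Sum>i<p. z ^ i * complex_of_real (\<psi> (int (i + k)) y)) = 0"
        by (simp add: q_def sum_distrib_left power_add mult_ac)
      with \<open>z \<noteq> 0\<close> show "(\<Sum>i<p. z ^ i * complex_of_real (\<psi> (int (i + k)) y)) = 0"
        by simp
    qed (use p in simp)
    also have "\<dots> = (\<Sum>i<p. \<psi> (int i) y)"
      using per[OF y] by (intro sum_shift_periodic) simp
    finally show ?thesis using jk by simp
  qed
  have indep: "\<psi> i y = \<psi> j y" if "y \<in> G" for i j y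
  proof -
    have "real p * \<psi> i y = real p * \<psi> j y" using mean[OF that] by simp
    then show ?thesis using p by simp
  qed
  obtain a x where a: "a \<in> \<alpha>" "x \<in> a" "x \<in> G" by (rule good_nonempty)
  show thesis
  proof (rule that[of "\<psi> 0 x"])
    fix y i assume y: "y \<in> G"
    obtain b where b: "b \<in> \<alpha>" "y \<in> b" using goodD(6)[OF G y] by blast
    obtain m where "\<And>i. \<psi> i y = \<psi> (i - int m) x"
      using cocycle_shift[OF a b y] by blast
    then show "\<psi> i y = \<psi> 0 x" using indep[OF a(3)] by simp
  qed
qed

end

end

section \<open>Uniform mixing on the tower\<close>

context gibbs_markov_tower
begin

definition phi_mean :: real where
  "phi_mean = (\<integral>y. real (\<phi> y) \<partial>\<mu>)"

lemma phi_mean_pos: "0 < phi_mean"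
  unfolding phi_mean_def by (rule phi_integral_pos)

definition tower_corr :: "('x \<Rightarrow> nat \<Rightarrow> real) \<Rightarrow> ('x \<Rightarrow> nat \<Rightarrow> real) \<Rightarrow> nat \<Rightarrow> real" where
  "tower_corr H W n =
     tower_int (\<lambda>y l. H y l * (koopman ^^ n) W y l) - tower_int H * tower_int W / phi_mean"

context
  fixes G assumes G: "good G"
begin

lemma tower_int_tendsto:
  assumes Hn: "\<And>n. tower_bounded G (H n)"
    and bound: "\<And>n y l. y \<in> G \<Longrightarrow> l < \<phi> y \<Longrightarrow> \<bar>H n y l\<bar> \<le> B"
    and lim: "AE y in \<mu>. \<forall>l<\<phi> y. (\<lambda>n. H n y l) \<longlonglongrightarrow> 0"
  shows "(\<lambda>n. tower_int (H n)) \<longlonglongrightarrow> 0"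
proof -
  have "(\<lambda>n. \<integral>y. (\<Sum>l<\<phi> y. H n y l) \<partial>\<mu>) \<longlonglongrightarrow> (\<integral>y. 0 \<partial>\<mu>)"
  proof (rule integral_dominated_convergence[where w="\<lambda>y. B * real (\<phi> y)"])
    show "integrable \<mu> (\<lambda>y. B * real (\<phi> y))" using phi_integrable by simp
    show "(\<lambda>y. \<Sum>l<\<phi> y. H n y l) \<in> borel_measurable \<mu>" for n
      using tower_bounded_integrable[OF G Hn] by auto
    show "AE y in \<mu>. (\<lambda>n. \<Sum>l<\<phi> y. H n y l) \<longlonglongrightarrow> 0"
      using lim by eventually_elim (rule tendsto_null_sum, simp)
    show "AE y in \<mu>. norm (\<Sum>l<\<phi> y. H n y l) \<le> B * real (\<phi> y)" for n
      using goodD(2)[OF G]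
    proof eventually_elim
      case (elim y)
      have "norm (\<Sum>l<\<phi> y. H n y l) \<le> (\<Sum>l<\<phi> y. norm (H n y l))" by (rule norm_sum)
      also have "\<dots> \<le> (\<Sum>l<\<phi> y. B)" using bound[OF elim] by (intro sum_mono) simp
      finally show ?case by (simp add: mult.commute)
    qed
  qed simp
  then show ?thesis by (simp add: tower_int_def)
qed

lemma tower_op_power_tendsto_mean:
  assumes ap: "aperiodic \<mu> F \<phi> \<alpha> \<theta>"
    and H: "H \<in> regular_functions K G" and K: "0 \<le> K" "C0 + \<theta> * K \<le> K"
  shows "(\<lambda>n. tower_int (\<lambda>y l. \<bar>(tower_op ^^ n) H y l - tower_int H / phi_mean\<bar>)) \<longlonglongrightarrow> 0"
proof (rule ccontr)
  define D where "D = (\<lambda>c n. tower_int (\<lambda>y l. \<bar>(tower_op ^^ n) H y l - c\<bar>))"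
  let ?c = "tower_int H / phi_mean"
  note C = tower_op_power_regular[OF G H K]
  have b: "tower_bounded G (\<lambda>y l. (tower_op ^^ n) H y l - c)" for n c
    by (intro tower_bounded_diff[OF G] tower_bounded_const[OF G] regular_functions_bounded[OF G C])
  have D0: "0 \<le> D c n" for c n
    unfolding D_def by (rule tower_int_nonneg[OF G tower_bounded_abs[OF G b]]) simp
  assume "\<not> (\<lambda>n. tower_int (\<lambda>y l. \<bar>(tower_op ^^ n) H y l - ?c\<bar>)) \<longlonglongrightarrow> 0"
  then have "\<not> (D ?c) \<longlonglongrightarrow> 0" by (simp add: D_def)
  then obtain e where e: "0 < e" "\<And>n0. \<exists>n\<ge>n0. e \<le> D ?c n"
    using D0 by (auto simp: LIMSEQ_iff not_less)
  have "infinite {n. e \<le> D ?c n}"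
    using e(2) by (auto simp: infinite_nat_iff_unbounded_le)
  then obtain s :: "nat \<Rightarrow> nat" where s: "strict_mono s" "\<And>n. e \<le> D ?c (s n)"
    using infinite_enumerate by blast
  show False
  proof (rule limit_cocycle[OF G H K s(1)])
    fix r \<psi> G'
    assume r: "strict_mono (r :: nat \<Rightarrow> nat)" and G': "good G'" "G' \<subseteq> G"
      and lim: "\<And>y (i :: int). y \<in> G' \<Longrightarrow>
        (\<lambda>n. (tower_op ^^ nat (int (s (r n)) + i)) H y 0) \<longlonglongrightarrow> \<psi> i y"
      and psi: "\<And>i. \<psi> i \<in> borel_measurable \<mu>" "\<And>y i. y \<in> G' \<Longrightarrow> \<bar>\<psi> i y\<bar> \<le> 3"
        "\<And>y i. y \<in> G' \<Longrightarrow> \<psi> i (F y) = \<psi> (i - int (\<phi> y)) y"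
        "\<And>a y y' i. a \<in> \<alpha> \<Longrightarrow> y \<in> a \<Longrightarrow> y' \<in> a \<Longrightarrow> y \<in> G' \<Longrightarrow> y' \<in> G' \<Longrightarrow>
          \<bar>\<psi> i y - \<psi> i y'\<bar> \<le> 3 * (exp (K * d y y') - 1)"
    obtain c where c: "\<And>y i. y \<in> G' \<Longrightarrow> \<psi> i y = c"
    proof (rule cocycle_constant[OF G'(1) K(1)])
      show "\<psi> i \<in> borel_measurable \<mu>" for i by (rule psi(1))
      show "\<bar>\<psi> i y\<bar> \<le> 3" if "y \<in> G'" for y i by (rule psi(2)[OF that])
      show "\<psi> i (F y) = \<psi> (i - int (\<phi> y)) y" if "y \<in> G'" for y i by (rule psi(3)[OF that])
      show "\<bar>\<psi> i y - \<psi> i y'\<bar> \<le> 3 * (exp (K * d y y') - 1)"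
        if "a \<in> \<alpha>" "y \<in> a" "y' \<in> a" "y \<in> G'" "y' \<in> G'" for a y y' i by (rule psi(4)[OF that])
      show "aperiodic \<mu> F \<phi> \<alpha> \<theta>" by (rule ap)
      fix c assume "\<And>y i. y \<in> G' \<Longrightarrow> \<psi> i y = c"
      then show thesis by (rule that)
    qed
    have t: "strict_mono (\<lambda>n. s (r n))"
      using strict_mono_o[OF s(1) r] by (simp add: o_def)
    have level: "(\<lambda>n. (tower_op ^^ s (r n)) H y l) \<longlonglongrightarrow> c" if y: "y \<in> G'" for y l
    proof -
      have "(\<lambda>n. (tower_op ^^ nat (int (s (r n)) + (- int l))) H y 0) \<longlonglongrightarrow> c"
        using lim[OF y, of "- int l"] c[OF y] by simp
      moreover have "\<forall>\<^sub>F n in sequentially.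
          (tower_op ^^ nat (int (s (r n)) + (- int l))) H y 0 = (tower_op ^^ s (r n)) H y l"
      proof (rule eventually_sequentiallyI)
        fix n assume "l \<le> n"
        then have "l \<le> s (r n)" using seq_suble[OF t, of n] by simp
        then have "(tower_op ^^ s (r n)) H y l = (tower_op ^^ (s (r n) - l)) H y 0"
          and "nat (int (s (r n)) + (- int l)) = s (r n) - l"
          by (rule tower_op_power_level[OF G], simp)
        then show "(tower_op ^^ nat (int (s (r n)) + (- int l))) H y 0 = (tower_op ^^ s (r n)) H y l"
          by (simp only:)
      qed
      ultimately show ?thesis by (rule Lim_transform_eventually)
    qed
    have Dc: "(\<lambda>n. D c (s (r n))) \<longlonglongrightarrow> 0"
      unfolding D_def
    proof (rule tower_int_tendsto[where B="3 + \<bar>c\<bar>"])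
      show "tower_bounded G (\<lambda>y l. \<bar>(tower_op ^^ s (r n)) H y l - c\<bar>)" for n
        by (rule tower_bounded_abs[OF G b])
      show "\<bar>\<bar>(tower_op ^^ s (r n)) H y l - c\<bar>\<bar> \<le> 3 + \<bar>c\<bar>" if "y \<in> G" "l < \<phi> y" for n y l
        using regular_functionsD(2,3)[OF C[of "s (r n)"] that] by linarith
      show "AE y in \<mu>. \<forall>l<\<phi> y. (\<lambda>n. \<bar>(tower_op ^^ s (r n)) H y l - c\<bar>) \<longlonglongrightarrow> 0"
        using goodD(2)[OF G'(1)]
        by eventually_elim (auto intro!: tendsto_rabs_zero LIM_zero level)
    qed
    have "\<bar>tower_int H - c * phi_mean\<bar> \<le> D c n" for n
    proof -
      have "tower_int (\<lambda>y l. (tower_op ^^ n) H y l - c) = tower_int H - c * phi_mean"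
        by (subst tower_int_diff[OF G regular_functions_bounded[OF G C] tower_bounded_const[OF G]])
          (simp add: tower_int_tower_op_power[OF G H K] tower_int_const[OF G] phi_mean_def)
      then show ?thesis
        using tower_int_abs[OF G b, of n c] by (simp add: D_def)
    qed
    then have "\<bar>tower_int H - c * phi_mean\<bar> \<le> 0"
      by (intro LIMSEQ_le_const[OF Dc]) auto
    then have "c = ?c" using phi_mean_pos by (simp add: field_simps)
    then have "e \<le> 0"
      using s(2) by (intro LIMSEQ_le_const[OF Dc]) auto
    with e(1) show False by simp
  qed
qed

lemma koopman_power_invariant:
  assumes "\<And>y l. y \<in> G \<Longrightarrow> l < \<phi> y \<Longrightarrow> P (W y l)" "y \<in> G" "l < \<phi> y"
  shows "P ((koopman ^^ n) W y l)"
  using assms(2,3)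
  by (induction n arbitrary: y l) (auto simp: assms(1) koopman_def phi_good[OF G] goodD(3)[OF G])

context
  fixes W :: "'x \<Rightarrow> nat \<Rightarrow> real"
  assumes W: "tower_bounded G W"
    and W01: "\<And>y l. y \<in> G \<Longrightarrow> l < \<phi> y \<Longrightarrow> 0 \<le> W y l \<and> W y l \<le> 1"
begin

lemma tower_int_mult_le:
  assumes "tower_bounded G H"
  shows "\<bar>tower_int (\<lambda>y l. H y l * (koopman ^^ n) W y l)\<bar> \<le> tower_int (\<lambda>y l. \<bar>H y l\<bar>)"
proof -
  note b = tower_bounded_mult[OF G assms tower_bounded_koopman_power[OF G W]]
  have "\<bar>tower_int (\<lambda>y l. H y l * (koopman ^^ n) W y l)\<bar> \<le>
      tower_int (\<lambda>y l. \<bar>H y l * (koopman ^^ n) W y l\<bar>)"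
    by (rule tower_int_abs[OF G b])
  also have "\<dots> \<le> tower_int (\<lambda>y l. \<bar>H y l\<bar>)"
  proof (rule tower_int_mono[OF G tower_bounded_abs[OF G b] tower_bounded_abs[OF G assms]])
    fix y l assume "y \<in> G" "l < \<phi> y"
    then have "0 \<le> (koopman ^^ n) W y l \<and> (koopman ^^ n) W y l \<le> 1"
      by (intro koopman_power_invariant[where P="\<lambda>x. 0 \<le> x \<and> x \<le> 1"] W01)
    then show "\<bar>H y l * (koopman ^^ n) W y l\<bar> \<le> \<bar>H y l\<bar>"
      by (auto simp: abs_mult mult_left_le)
  qed
  finally show ?thesis .
qed

text \<open>Duality moves the dynamics to \<open>H\<close>, and \<open>W\<close> is bounded by \<open>1\<close>.\<close>

lemma tower_corr_le:
  assumes H: "H \<in> regular_functions K G" and K: "0 \<le> K" "C0 + \<theta> * K \<le> K"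
  shows "\<bar>tower_corr H W n\<bar> \<le>
    tower_int (\<lambda>y l. \<bar>(tower_op ^^ n) H y l - tower_int H / phi_mean\<bar>)"
proof -
  let ?c = "tower_int H / phi_mean"
  note b = regular_functions_bounded[OF G tower_op_power_regular[OF G H K, of n]]
  have "tower_corr H W n = tower_int (\<lambda>y l. (tower_op ^^ n) H y l * W y l) - ?c * tower_int W"
    unfolding tower_corr_def using koopman_power_duality[OF G H K W] W01 by simp
  also have "\<dots> = tower_int (\<lambda>y l. ((tower_op ^^ n) H y l - ?c) * (koopman ^^ 0) W y l)"
    unfolding left_diff_distrib funpow_0
    by (subst tower_int_diff[OF G tower_bounded_mult[OF G b W] tower_bounded_cmult[OF G W]],
        subst tower_int_cmult[OF G W], rule refl)
  finally show ?thesis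
    using tower_int_mult_le[OF tower_bounded_diff[OF G b tower_bounded_const[OF G, of ?c]], of 0]
    by simp
qed

lemma tower_corr_diff_le:
  assumes H: "tower_bounded G H" "tower_bounded G V"
  shows "\<bar>tower_corr H W n - tower_corr V W n\<bar> \<le> 2 * tower_int (\<lambda>y l. \<bar>H y l - V y l\<bar>)"
proof -
  let ?E = "tower_int (\<lambda>y l. \<bar>H y l - V y l\<bar>)"
  note b = tower_bounded_diff[OF G H]
  have 1: "\<bar>tower_int (\<lambda>y l. H y l * (koopman ^^ n) W y l) - tower_int (\<lambda>y l. V y l * (koopman ^^ n) W y l)\<bar> \<le> ?E"
    using tower_int_mult_le[OF b, of n]
    by (simp add: left_diff_distrib tower_int_diff[OF G] tower_bounded_mult[OF G] H
        tower_bounded_koopman_power[OF G W])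
  have "\<bar>tower_int H - tower_int V\<bar> \<le> ?E"
    using tower_int_abs[OF G b] by (simp add: tower_int_diff[OF G H])
  moreover have "0 \<le> tower_int W / phi_mean" "tower_int W / phi_mean \<le> 1"
    using tower_int_nonneg[OF G W] tower_int_mono[OF G W tower_bounded_const[OF G], of 1] W01 phi_mean_pos
    by (auto simp: tower_int_const[OF G] phi_mean_def)
  ultimately have "\<bar>tower_int H - tower_int V\<bar> * (tower_int W / phi_mean) \<le> ?E * 1"
    by (intro mult_mono) auto
  then have 2: "\<bar>(tower_int H - tower_int V) * (tower_int W / phi_mean)\<bar> \<le> ?E"
    using \<open>0 \<le> tower_int W / phi_mean\<close> by (simp only: abs_mult abs_of_nonneg mult_1_right)
  have "tower_corr H W n - tower_corr V W n =
      (tower_int (\<lambda>y l. H y l * (koopman ^^ n) W y l) - tower_int (\<lambda>y l. V y l * (koopman ^^ n) W y l))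
      - (tower_int H - tower_int V) * (tower_int W / phi_mean)"
    by (simp add: tower_corr_def left_diff_distrib diff_divide_distrib)
  then show ?thesis using 1 2 by linarith
qed

end

text \<open>A sequence of counterexamples at times tending to infinity would have a pointwise limit \<open>V\<close>
  along a subsequence. Replacing its members by \<open>V\<close> changes the correlations by a multiple of the
  vanishing \<open>L\<^sup>1\<close> distance, at whatever time; but the correlations of \<open>V\<close> tend to zero.\<close>

lemma tower_corr_uniform:
  assumes ap: "aperiodic \<mu> F \<phi> \<alpha> \<theta>" and K: "0 \<le> K" "C0 + \<theta> * K \<le> K" and e: "0 < e"
  shows "\<exists>n0. \<forall>n\<ge>n0. \<forall>H\<in>regular_functions K G. \<forall>W. tower_bounded G W \<longrightarrow>
    (\<forall>y\<in>G. \<forall>l<\<phi> y. 0 \<le> W y l \<and> W y l \<le> 1) \<longrightarrow> \<bar>tower_corr H W n\<bar> \<le> e"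
proof (rule ccontr)
  assume "\<not> ?thesis"
  then have "\<forall>j. \<exists>n H W. n \<ge> j \<and> H \<in> regular_functions K G \<and> tower_bounded G W \<and>
      (\<forall>y\<in>G. \<forall>l<\<phi> y. 0 \<le> W y l \<and> W y l \<le> 1) \<and> \<not> \<bar>tower_corr H W n\<bar> \<le> e"
    by blast
  then obtain n H W where n: "\<And>j :: nat. n j \<ge> j" and H: "\<And>j. H j \<in> regular_functions K G"
    and W: "\<And>j. tower_bounded G (W j)" "\<And>j. \<forall>y\<in>G. \<forall>l<\<phi> y. 0 \<le> W j y l \<and> W j y l \<le> 1"
    and bad: "\<And>j. \<not> \<bar>tower_corr (H j) (W j) (n j)\<bar> \<le> e"
    by metis
  define f where "f j l y = (if l < \<phi> y then H j y l else 0)" for j l y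
  obtain r where r: "strict_mono r" and conv: "\<And>l y. y \<in> G \<Longrightarrow> convergent (\<lambda>j. f (r j) l y)"
  proof (rule regular_convergent_subsequence[OF G K(1), of f 3])
    show "0 \<le> f j l y" "f j l y \<le> 3" if "y \<in> G" for j l y
      using regular_functionsD(2,3)[OF H[of j] that, of l] by (auto simp: f_def)
    show "f j l y \<le> exp (K * d y y') * f j l y'"
      if "a \<in> \<alpha>" "y \<in> a" "y' \<in> a" "y \<in> G" "y' \<in> G" for j l a y y'
      using regular_functionsD(4)[OF H[of j] that, of l] phi_eq[OF that(1-3)] by (auto simp: f_def)
  qed (blast intro: that)
  define V where "V y l = lim (\<lambda>j. f (r j) l y)" for y l
  have f_lim: "(\<lambda>j. f (r j) l y) \<longlonglongrightarrow> V y l" if "y \<in> G" for y l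
    using conv[OF that] unfolding V_def by (simp add: convergent_LIMSEQ_iff)
  have lim: "(\<lambda>j. H (r j) y l) \<longlonglongrightarrow> V y l" if "y \<in> G" "l < \<phi> y" for y l
    using f_lim[OF that(1), of l] that(2) by (simp add: f_def)
  have V: "V \<in> regular_functions K G"
    unfolding regular_functions_def
  proof (intro CollectI conjI allI ballI impI)
    have [measurable]: "(\<lambda>y. H j y l) \<in> borel_measurable \<mu>" for j l by (rule regular_functionsD(1)[OF H])
    have "f (r j) l \<in> borel_measurable \<mu>" for j l
      unfolding f_def by measurable
    then show "(\<lambda>y. V y l) \<in> borel_measurable \<mu>" for l
      unfolding V_def by (rule borel_measurable_lim_metric)
    fix y l assume l: "l < \<phi> y"
    show "1 \<le> V y l" if "y \<in> G"
      using regular_functionsD(2)[OF H that l] by (intro LIMSEQ_le_const[OF lim[OF that l]]) auto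
    show "V y l \<le> 3" if "y \<in> G"
      using regular_functionsD(3)[OF H that l] by (intro LIMSEQ_le_const2[OF lim[OF that l]]) auto
    fix a y' assume "a \<in> \<alpha>" "y \<in> a \<inter> G" "y' \<in> a \<inter> G"
    then have a: "a \<in> \<alpha>" "y \<in> a" "y' \<in> a" "y \<in> G" "y' \<in> G" by auto
    have l': "l < \<phi> y'" using l phi_eq[OF a(1-3)] by simp
    show "V y l \<le> exp (K * d y y') * V y' l"
      by (rule LIMSEQ_le[OF lim[OF a(4) l] tendsto_mult_left[OF lim[OF a(5) l']]])
        (use regular_functionsD(4)[OF H a l] in auto)
  qed
  have "(\<lambda>j. tower_int (\<lambda>y l. \<bar>H (r j) y l - V y l\<bar>)) \<longlonglongrightarrow> 0"
  proof (rule tower_int_tendsto[where B=2])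
    show "tower_bounded G (\<lambda>y l. \<bar>H (r j) y l - V y l\<bar>)" for j
      by (rule tower_bounded_abs[OF G tower_bounded_diff[OF G regular_functions_bounded[OF G H] regular_functions_bounded[OF G V]]])
    show "\<bar>\<bar>H (r j) y l - V y l\<bar>\<bar> \<le> 2" if "y \<in> G" "l < \<phi> y" for j y l
      using regular_functionsD(2,3)[OF H[of "r j"] that] regular_functionsD(2,3)[OF V that] by (simp add: abs_le_iff)
    show "AE y in \<mu>. \<forall>l<\<phi> y. (\<lambda>j. \<bar>H (r j) y l - V y l\<bar>) \<longlonglongrightarrow> 0"
      using goodD(2)[OF G] by eventually_elim (auto intro!: tendsto_rabs_zero LIM_zero lim)
  qed
  moreover have "(\<lambda>j. tower_int (\<lambda>y l. \<bar>(tower_op ^^ n (r j)) V y l - tower_int V / phi_mean\<bar>)) \<longlonglongrightarrow> 0"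
  proof (rule filterlim_compose[OF tower_op_power_tendsto_mean[OF ap V K]])
    have "j \<le> n (r j)" for j
      using seq_suble[OF r, of j] n[of "r j"] by simp
    then show "filterlim (\<lambda>j. n (r j)) at_top sequentially"
      by (intro filterlim_at_top_mono[OF filterlim_ident]) auto
  qed
  ultimately have "(\<lambda>j. 2 * tower_int (\<lambda>y l. \<bar>H (r j) y l - V y l\<bar>) +
      tower_int (\<lambda>y l. \<bar>(tower_op ^^ n (r j)) V y l - tower_int V / phi_mean\<bar>)) \<longlonglongrightarrow> 2 * 0 + 0"
    by (intro tendsto_intros)
  moreover have "e \<le> 2 * tower_int (\<lambda>y l. \<bar>H (r j) y l - V y l\<bar>) +
      tower_int (\<lambda>y l. \<bar>(tower_op ^^ n (r j)) V y l - tower_int V / phi_mean\<bar>)" for j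
  proof -
    have W': "0 \<le> W (r j) y l \<and> W (r j) y l \<le> 1" if "y \<in> G" "l < \<phi> y" for y l
      using W(2) that by blast
    have bH: "tower_bounded G (H (r j))" by (rule regular_functions_bounded[OF G H])
    have bV: "tower_bounded G V" by (rule regular_functions_bounded[OF G V])
    have "\<bar>tower_corr V (W (r j)) (n (r j))\<bar> \<le>
        tower_int (\<lambda>y l. \<bar>(tower_op ^^ n (r j)) V y l - tower_int V / phi_mean\<bar>)"
      by (rule tower_corr_le[OF W(1) W' V K])
    moreover have "\<bar>tower_corr (H (r j)) (W (r j)) (n (r j)) - tower_corr V (W (r j)) (n (r j))\<bar> \<le>
        2 * tower_int (\<lambda>y l. \<bar>H (r j) y l - V y l\<bar>)"
      by (rule tower_corr_diff_le[OF W(1) W' bH bV])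
    ultimately show ?thesis
      using bad[of "r j"] by linarith
  qed
  ultimately have "e \<le> 2 * 0 + 0" by (intro LIMSEQ_le_const) auto
  with e show False by simp
qed

end

end

section \<open>Observables on the underlying space\<close>

text \<open>The rate is the supremum over \<open>S\<close>, enlarged by a null sequence to make it positive.\<close>

lemma uniform_rate:
  fixes c :: "nat \<Rightarrow> 'b \<Rightarrow> real"
  assumes bound: "\<And>n x. x \<in> S \<Longrightarrow> c n x \<le> B"
    and unif: "\<And>e. 0 < e \<Longrightarrow> \<exists>n0. \<forall>n\<ge>n0. \<forall>x\<in>S. c n x \<le> e"
  obtains a :: "nat \<Rightarrow> real"
    where "\<And>n. 0 < a n" "a \<longlonglongrightarrow> 0" "\<And>n x. x \<in> S \<Longrightarrow> c n x \<le> a n"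
proof -
  define b where "b n = (SUP r\<in>insert 0 (c n ` S). r)" for n
  have bdd: "bdd_above (insert 0 (c n ` S))" for n
    using bound by (intro bdd_aboveI[of _ "max 0 B"]) (auto simp: le_max_iff_disj)
  have b0: "0 \<le> b n" and bc: "x \<in> S \<Longrightarrow> c n x \<le> b n" for n x
    using bdd[of n] by (auto simp: b_def intro: cSup_upper)
  have "b \<longlonglongrightarrow> 0"
  proof (rule LIMSEQ_I)
    fix e :: real assume "0 < e"
    then obtain n0 where n0: "\<forall>n\<ge>n0. \<forall>x\<in>S. c n x \<le> e / 2" using unif[of "e / 2"] by auto
    have "b n \<le> e / 2" if "n \<ge> n0" for n
      unfolding b_def using n0 that \<open>0 < e\<close> by (intro cSup_least) auto
    then have "norm (b n - 0) < e" if "n \<ge> n0" for n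
      using that b0[of n] \<open>0 < e\<close> by force
    then show "\<exists>n0. \<forall>n\<ge>n0. norm (b n - 0) < e" by blast
  qed
  then have "(\<lambda>n. b n + inverse (real (Suc n))) \<longlonglongrightarrow> 0 + 0"
    by (intro tendsto_add LIMSEQ_inverse_real_of_nat)
  moreover have "0 < b n + inverse (real (Suc n))" for n
    using b0[of n] by (intro add_nonneg_pos) auto
  moreover have "c n x \<le> b n + inverse (real (Suc n))" if "x \<in> S" for n x
    using bc[OF that, of n] by (simp add: add_increasing2)
  ultimately show thesis by (intro that) auto
qed

context gibbs_markov_tower
begin

lemma koopman_power_affine:
  "(koopman ^^ n) (\<lambda>y l. b * U y l + c) = (\<lambda>y l. b * (koopman ^^ n) U y l + c)"
  by (induction n) (auto simp: koopman_def fun_eq_iff)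

lemma good_subset_bounded:
  assumes "good G" "AE y in \<mu>. \<forall>l<\<phi> y. P y l"
  obtains G' where "good G'" "G' \<subseteq> G" "\<And>y l. y \<in> G' \<Longrightarrow> l < \<phi> y \<Longrightarrow> P y l"
proof (rule good_subset_exists[of "\<lambda>y. y \<in> G \<and> (\<forall>l<\<phi> y. P y l)"])
  show "AE y in \<mu>. y \<in> G \<and> (\<forall>l<\<phi> y. P y l)"
    using goodD(2)[OF assms(1)] assms(2) by eventually_elim simp
  fix G' assume "good G'" "\<And>y. y \<in> G' \<Longrightarrow> y \<in> G \<and> (\<forall>l<\<phi> y. P y l)"
  then show thesis by (intro that[of G']) auto
qed

context
  fixes G assumes G: "good G"
begin

lemma koopman_power_cong:
  assumes "\<And>y l. y \<in> G \<Longrightarrow> l < \<phi> y \<Longrightarrow> W y l = W' y l" "y \<in> G" "l < \<phi> y"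
  shows "(koopman ^^ n) W y l = (koopman ^^ n) W' y l"
  using assms(2,3)
  by (induction n arbitrary: y l) (auto simp: assms(1) koopman_def phi_good[OF G] goodD(3)[OF G])

lemma tower_corr_cong:
  assumes V: "tower_bounded G V" "tower_bounded G V'" and W: "tower_bounded G W" "tower_bounded G W'"
    and eqV: "\<And>y l. y \<in> G \<Longrightarrow> l < \<phi> y \<Longrightarrow> V y l = V' y l"
    and eqW: "\<And>y l. y \<in> G \<Longrightarrow> l < \<phi> y \<Longrightarrow> W y l = W' y l"
  shows "tower_corr V W n = tower_corr V' W' n"
proof -
  have m: "(\<lambda>y. X y l) \<in> borel_measurable \<mu>" if "tower_bounded G X" for X l
    using that by (simp add: tower_bounded_def)
  note mult = tower_bounded_mult[OF G _ tower_bounded_koopman_power[OF G]]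
  have "tower_int V = tower_int V'"
    by (rule tower_int_cong[OF G eqV m[OF V(1)] m[OF V(2)]])
  moreover have "tower_int W = tower_int W'"
    by (rule tower_int_cong[OF G eqW m[OF W(1)] m[OF W(2)]])
  moreover have "tower_int (\<lambda>y l. V y l * (koopman ^^ n) W y l) = tower_int (\<lambda>y l. V' y l * (koopman ^^ n) W' y l)"
  proof (rule tower_int_cong[OF G])
    show "V y l * (koopman ^^ n) W y l = V' y l * (koopman ^^ n) W' y l" if "y \<in> G" "l < \<phi> y" for y l
      using eqV[OF that] koopman_power_cong[OF eqW that] by simp
  qed (rule m[OF mult[OF V(1) W(1)]], rule m[OF mult[OF V(2) W(2)]])
  ultimately show ?thesis by (simp add: tower_corr_def)
qed

text \<open>Invariance of the measure makes the contributions of the constants cancel.\<close>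

lemma tower_corr_affine:
  assumes H: "tower_bounded G H" and U: "tower_bounded G U"
    and U0: "\<And>y l. y \<in> G \<Longrightarrow> l < \<phi> y \<Longrightarrow> 0 \<le> U y l"
  shows "tower_corr (\<lambda>y l. b * H y l + c) (\<lambda>y l. b' * U y l + c') n = b * b' * tower_corr H U n"
proof -
  let ?K = "(koopman ^^ n) U"
  note bK = tower_bounded_koopman_power[OF G U, of n]
  have IK: "tower_int ?K = tower_int U"
  proof (induction n)
    case (Suc n)
    have "tower_int ((koopman ^^ Suc n) U) = tower_int ((koopman ^^ n) U)"
      using tower_int_koopman[OF G tower_bounded_koopman_power[OF G U] koopman_power_nonneg[OF G U0]]
      by simp
    with Suc show ?case by simp
  qed simp
  have aff: "tower_int (\<lambda>y l. b * X y l + c) = b * tower_int X + c * phi_mean"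
    if "tower_bounded G X" for b c X
    by (simp add: tower_int_add[OF G tower_bounded_cmult[OF G that] tower_bounded_const[OF G]]
        tower_int_cmult[OF G that] tower_int_const[OF G] phi_mean_def)
  have "tower_int (\<lambda>y l. (b * H y l + c) * (b' * ?K y l + c')) =
      tower_int (\<lambda>y l. b * b' * (H y l * ?K y l) + ((b * c' * H y l) + (c * b' * ?K y l + c * c')))"
    by (simp add: algebra_simps)
  also have "\<dots> = b * b' * tower_int (\<lambda>y l. H y l * ?K y l) +
      (b * c' * tower_int H + (c * b' * tower_int ?K + c * c' * phi_mean))"
    by (subst tower_int_add[OF G], (intro tower_bounded_add[OF G] tower_bounded_cmult[OF G]
          tower_bounded_mult[OF G] tower_bounded_const[OF G] H bK)+,
        subst tower_int_add[OF G], (intro tower_bounded_add[OF G] tower_bounded_cmult[OF G]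
          tower_bounded_mult[OF G] tower_bounded_const[OF G] H bK)+)
      (simp add: aff[OF bK] tower_int_cmult[OF G] H tower_bounded_mult[OF G H bK])
  finally have 1: "tower_int (\<lambda>y l. (b * H y l + c) * (b' * ?K y l + c')) =
      b * b' * tower_int (\<lambda>y l. H y l * ?K y l) +
      (b * c' * tower_int H + (c * b' * tower_int U + c * c' * phi_mean))"
    by (simp add: IK)
  show ?thesis
    unfolding tower_corr_def koopman_power_affine 1 aff[OF H] aff[OF U]
    using phi_mean_pos by (simp add: field_simps)
qed

end

end

locale suspended_tower = gibbs_markov_tower +
  fixes M :: "'a measure" and T :: "'a \<Rightarrow> 'a" and Y :: "'a set"
  assumes T_measurable [measurable]: "T \<in> measurable M M"
    and Y_sets: "Y \<in> sets M"
    and sets_mu: "sets \<mu> = sets (restrict_space M Y)"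
    and F_eq: "F = return_map T \<phi>"
begin

lemma space_mu: "space \<mu> = Y"
  using sets_eq_imp_space_eq[OF sets_mu] sets.sets_into_space[OF Y_sets]
  by (auto simp: space_restrict_space)

lemma T_power_measurable: "T ^^ l \<in> measurable M M"
proof (induction l)
  case (Suc l)
  then show ?case using measurable_comp[OF Suc T_measurable] by simp
qed (simp add: id_def)

lemma T_power_base_measurable: "T ^^ l \<in> measurable \<mu> M"
  using measurable_restrict_space1[OF T_power_measurable[of l], of Y]
  by (simp add: measurable_cong_sets[OF sets_mu refl])

lemma level_measurable:
  "v \<in> measurable M borel \<Longrightarrow> (\<lambda>y. v ((T ^^ l) y)) \<in> measurable \<mu> borel"
  by (rule measurable_compose[OF T_power_base_measurable])

lemma phi_mean_eq: "mean_return \<mu> \<phi> = phi_mean"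
  by (simp add: mean_return_def phi_mean_def)

abbreviation \<Delta> :: "('a \<times> nat) measure" where
  "\<Delta> \<equiv> tower_measure \<mu> \<phi>"

lemma pair_measurable:
  fixes h :: "'a \<times> nat \<Rightarrow> 'c"
  assumes "\<And>l. (\<lambda>y. h (y, l)) \<in> measurable \<mu> M'"
  shows "h \<in> measurable (\<mu> \<Otimes>\<^sub>M count_space UNIV) M'"
proof -
  have "(\<lambda>p. h (fst p, snd p)) \<in> measurable (\<mu> \<Otimes>\<^sub>M count_space UNIV) M'"
    by (rule measurable_compose_countable[of "\<lambda>i p. h (fst p, i)" _ _ snd])
      (auto intro: measurable_compose[OF measurable_fst assms])
  then show ?thesis by simp
qed

lemma tower_sets: "tower \<mu> \<phi> \<in> sets (\<mu> \<Otimes>\<^sub>M count_space UNIV)"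
proof -
  have "tower \<mu> \<phi> = {p \<in> space (\<mu> \<Otimes>\<^sub>M count_space UNIV). snd p < \<phi> (fst p)}"
    by (auto simp: tower_def space_pair_measure)
  moreover have "Measurable.pred (\<mu> \<Otimes>\<^sub>M count_space UNIV) (\<lambda>p. snd p < \<phi> (fst p))"
    by (rule pair_measurable) simp
  ultimately show ?thesis by (simp add: pred_def)
qed

lemma space_Delta: "space \<Delta> = tower \<mu> \<phi>"
  using sets.sets_into_space[OF tower_sets]
  by (auto simp: tower_measure_def space_scale_measure space_restrict_space)

lemma Delta_measurable:
  fixes h :: "'a \<times> nat \<Rightarrow> 'c"
  assumes "\<And>l. (\<lambda>y. h (y, l)) \<in> measurable \<mu> M'"
  shows "h \<in> measurable \<Delta> M'"
  using measurable_restrict_space1[OF pair_measurable[OF assms], of "tower \<mu> \<phi>"]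
  unfolding tower_measure_def by (simp add: measurable_def space_scale_measure)

lemma tower_proj_measurable: "tower_proj T \<in> measurable \<Delta> M"
  by (rule Delta_measurable) (simp add: tower_proj_def T_power_base_measurable)

lemma nn_integral_Delta:
  assumes h: "\<And>l. (\<lambda>y. h (y, l)) \<in> borel_measurable \<mu>"
  shows "(\<integral>\<^sup>+p. h p \<partial>\<Delta>) = ennreal (1 / phi_mean) * (\<integral>\<^sup>+y. (\<Sum>l<\<phi> y. h (y, l)) \<partial>\<mu>)"
proof -
  interpret C: sigma_finite_measure "count_space UNIV :: nat measure"
    by (rule sigma_finite_measure_count_space)
  note [measurable] = pair_measurable[OF h] tower_sets
  have "(\<integral>\<^sup>+p. h p \<partial>\<Delta>) = ennreal (1 / phi_mean) *
      (\<integral>\<^sup>+p. h p * indicator (tower \<mu> \<phi>) p \<partial>(\<mu> \<Otimes>\<^sub>M count_space UNIV))"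
    unfolding tower_measure_def phi_mean_eq
    by (subst nn_integral_scale_measure)
      (auto simp: nn_integral_restrict_space intro: measurable_restrict_space1)
  also have "(\<integral>\<^sup>+p. h p * indicator (tower \<mu> \<phi>) p \<partial>(\<mu> \<Otimes>\<^sub>M count_space UNIV)) =
      (\<integral>\<^sup>+y. \<integral>\<^sup>+l. h (y, l) * indicator (tower \<mu> \<phi>) (y, l) \<partial>count_space UNIV \<partial>\<mu>)"
    by (rule C.nn_integral_fst[symmetric]) measurable
  also have "\<dots> = (\<integral>\<^sup>+y. (\<Sum>l<\<phi> y. h (y, l)) \<partial>\<mu>)"
  proof (rule nn_integral_cong)
    fix y assume y: "y \<in> space \<mu>"
    have "(\<integral>\<^sup>+l. h (y, l) * indicator (tower \<mu> \<phi>) (y, l) \<partial>count_space UNIV) =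
        (\<Sum>l<\<phi> y. h (y, l) * indicator (tower \<mu> \<phi>) (y, l))"
      by (rule nn_integral_count_space') (auto simp: tower_def)
    also have "\<dots> = (\<Sum>l<\<phi> y. h (y, l))"
      by (intro sum.cong) (use y in \<open>auto simp: tower_def\<close>)
    finally show "(\<integral>\<^sup>+l. h (y, l) * indicator (tower \<mu> \<phi>) (y, l) \<partial>count_space UNIV) =
        (\<Sum>l<\<phi> y. h (y, l))" .
  qed
  finally show ?thesis .
qed

lemma prob_space_Delta: "prob_space \<Delta>"
proof
  have "emeasure \<Delta> (space \<Delta>) = (\<integral>\<^sup>+p. 1 \<partial>\<Delta>)" by simp
  also have "\<dots> = ennreal (1 / phi_mean) * (\<integral>\<^sup>+y. ennreal (real (\<phi> y)) \<partial>\<mu>)"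
    by (subst nn_integral_Delta) (auto simp: ennreal_of_nat_eq_real_of_nat)
  also have "(\<integral>\<^sup>+y. ennreal (real (\<phi> y)) \<partial>\<mu>) = ennreal phi_mean"
    unfolding phi_mean_def by (rule nn_integral_eq_integral[OF phi_integrable]) simp
  also have "ennreal (1 / phi_mean) * ennreal phi_mean = 1"
    using phi_mean_pos by (simp flip: ennreal_mult)
  finally show "emeasure \<Delta> (space \<Delta>) = 1" .
qed

lemma AE_Delta_iff:
  assumes P: "\<And>l. Measurable.pred \<mu> (\<lambda>y. P y l)"
  shows "(AE p in \<Delta>. P (fst p) (snd p)) \<longleftrightarrow> (AE y in \<mu>. \<forall>l<\<phi> y. P y l)"
proof -
  let ?h = "\<lambda>p. indicator {p. \<not> P (fst p) (snd p)} p :: ennreal"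
  have h: "(\<lambda>y. ?h (y, l)) \<in> borel_measurable \<mu>" for l
    using P[of l] by (simp add: indicator_def) measurable
  have "(AE p in \<Delta>. P (fst p) (snd p)) \<longleftrightarrow> (AE p in \<Delta>. ?h p = 0)"
    by (simp add: indicator_def)
  also have "\<dots> \<longleftrightarrow> (\<integral>\<^sup>+p. ?h p \<partial>\<Delta>) = 0"
    by (rule nn_integral_0_iff_AE[symmetric]) (rule Delta_measurable[OF h])
  also have "\<dots> \<longleftrightarrow> (\<integral>\<^sup>+y. (\<Sum>l<\<phi> y. ?h (y, l)) \<partial>\<mu>) = 0"
    using phi_mean_pos by (subst nn_integral_Delta[OF h]) (simp add: ennreal_eq_0_iff)
  also have "\<dots> \<longleftrightarrow> (AE y in \<mu>. (\<Sum>l<\<phi> y. ?h (y, l)) = 0)"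
    by (rule nn_integral_0_iff_AE)
      (rule measurable_compose_countable[of "\<lambda>i y. \<Sum>l<i. ?h (y, l)"], use h in auto)
  also have "\<dots> \<longleftrightarrow> (AE y in \<mu>. \<forall>l<\<phi> y. P y l)"
  proof -
    have "(\<Sum>l<\<phi> y. ?h (y, l)) = 0 \<longleftrightarrow> (\<forall>l<\<phi> y. P y l)" for y
      by (auto simp: sum_eq_0_iff indicator_def simp del: sum_of_bool_eq)
    then show ?thesis by simp
  qed
  finally show ?thesis .
qed

lemma integral_Delta:
  assumes G: "good G" and H: "tower_bounded G H"
  shows "integrable \<Delta> (\<lambda>p. H (fst p) (snd p))"
    and "(\<integral>p. H (fst p) (snd p) \<partial>\<Delta>) = tower_int H / phi_mean"
proof -
  interpret D: prob_space \<Delta> by (rule prob_space_Delta)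
  have base: "integrable \<Delta> (\<lambda>p. H (fst p) (snd p)) \<and>
      (\<integral>p. H (fst p) (snd p) \<partial>\<Delta>) = tower_int H / phi_mean"
    if H: "tower_bounded G H" and H0: "\<And>y l. y \<in> G \<Longrightarrow> l < \<phi> y \<Longrightarrow> 0 \<le> H y l" for H
  proof -
    obtain B where mH: "\<And>l. (\<lambda>y. H y l) \<in> borel_measurable \<mu>"
      and B: "\<And>y l. y \<in> G \<Longrightarrow> l < \<phi> y \<Longrightarrow> \<bar>H y l\<bar> \<le> B"
      using H by (rule tower_boundedE) blast
    have meas: "(\<lambda>p. H (fst p) (snd p)) \<in> borel_measurable \<Delta>"
      by (rule Delta_measurable) (simp add: mH)
    have "AE y in \<mu>. \<forall>l<\<phi> y. 0 \<le> H y l \<and> \<bar>H y l\<bar> \<le> B"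
      using goodD(2)[OF G] by eventually_elim (use B H0 in blast)
    then have AE: "AE p in \<Delta>. 0 \<le> H (fst p) (snd p) \<and> \<bar>H (fst p) (snd p)\<bar> \<le> B"
      by (subst AE_Delta_iff) (use mH in measurable)
    have "integrable \<Delta> (\<lambda>p. H (fst p) (snd p))"
      by (rule D.integrable_const_bound[where B=B]) (use AE meas in \<open>auto elim!: eventually_mono\<close>)
    moreover have "(\<integral>p. H (fst p) (snd p) \<partial>\<Delta>) = enn2real (\<integral>\<^sup>+p. ennreal (H (fst p) (snd p)) \<partial>\<Delta>)"
      by (rule integral_eq_nn_integral[OF meas]) (use AE in \<open>auto elim!: eventually_mono\<close>)
    moreover have "(\<integral>\<^sup>+p. ennreal (H (fst p) (snd p)) \<partial>\<Delta>) =
        ennreal (1 / phi_mean) * (\<integral>\<^sup>+y. (\<Sum>l<\<phi> y. ennreal (H y l)) \<partial>\<mu>)"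
      by (subst nn_integral_Delta) (use mH in auto)
    moreover have "(\<integral>\<^sup>+y. (\<Sum>l<\<phi> y. ennreal (H y l)) \<partial>\<mu>) = (\<integral>\<^sup>+y. ennreal (\<Sum>l<\<phi> y. H y l) \<partial>\<mu>)"
      by (rule nn_integral_cong_AE)
        (use goodD(2)[OF G] in eventually_elim, use H0 in \<open>auto intro!: sum_ennreal\<close>)
    moreover have "tower_int H = enn2real (\<integral>\<^sup>+y. ennreal (\<Sum>l<\<phi> y. H y l) \<partial>\<mu>)"
      unfolding tower_int_def
      by (rule integral_eq_nn_integral[OF tower_sum_measurable[OF mH]])
        (use goodD(2)[OF G] in eventually_elim, use H0 in \<open>auto intro!: sum_nonneg\<close>)
    ultimately show ?thesis
      using phi_mean_pos by (simp add: enn2real_mult)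
  qed
  obtain B where B: "\<And>y l. y \<in> G \<Longrightarrow> l < \<phi> y \<Longrightarrow> \<bar>H y l\<bar> \<le> B"
    using H by (rule tower_boundedE) blast
  have b: "tower_bounded G (\<lambda>y l. H y l + B)"
    by (rule tower_bounded_add[OF G H tower_bounded_const[OF G]])
  have pos: "0 \<le> H y l + B" if "y \<in> G" "l < \<phi> y" for y l
    using B[OF that] by (simp add: abs_le_iff)
  have 1: "integrable \<Delta> (\<lambda>p. H (fst p) (snd p) + B)"
    and 2: "(\<integral>p. H (fst p) (snd p) + B \<partial>\<Delta>) = tower_int (\<lambda>y l. H y l + B) / phi_mean"
    using base[OF b pos] by auto
  show int: "integrable \<Delta> (\<lambda>p. H (fst p) (snd p))"
    using Bochner_Integration.integrable_diff[OF 1 D.integrable_const[of B]] by simp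
  have "tower_int (\<lambda>y l. H y l + B) = tower_int H + B * phi_mean"
    by (simp add: tower_int_add[OF G H tower_bounded_const[OF G]] tower_int_const[OF G] phi_mean_def)
  then show "(\<integral>p. H (fst p) (snd p) \<partial>\<Delta>) = tower_int H / phi_mean"
    using 2 int phi_mean_pos by (simp add: add_divide_distrib D.prob_space)
qed

text \<open>The projection of the tower to \<open>X\<close> is a semiconjugacy, so the lift of an observable along the tower
  map is the lift of its composition with \<open>T ^^ n\<close>.\<close>

lemma koopman_power_level:
  assumes "y \<in> space \<mu>" "l < \<phi> y"
  shows "(koopman ^^ n) (\<lambda>y l. w ((T ^^ l) y)) y l = w ((T ^^ n) ((T ^^ l) y))"
  using assms
proof (induction n arbitrary: y l)
  case (Suc n)
  show ?case
  proof (cases "Suc l < \<phi> y")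
    case True
    then have "(koopman ^^ Suc n) (\<lambda>y l. w ((T ^^ l) y)) y l = w ((T ^^ n) ((T ^^ Suc l) y))"
      using Suc.IH[OF Suc.prems(1) True] True by (simp add: koopman_def[of "_ :: 'a \<Rightarrow> nat \<Rightarrow> real" y l])
    then show ?thesis by (simp add: funpow_swap1)
  next
    case False
    then have phi: "\<phi> y = Suc l" using Suc.prems(2) by simp
    then have Fy: "F y = (T ^^ Suc l) y"
      by (simp only: F_eq return_map_def)
    have "0 < \<phi> (F y)" using phi_pos[OF F_space[OF Suc.prems(1)]] by simp
    then have "(koopman ^^ Suc n) (\<lambda>y l. w ((T ^^ l) y)) y l = w ((T ^^ n) ((T ^^ 0) (F y)))"
      using Suc.IH[OF F_space[OF Suc.prems(1)], of 0] False
      by (simp add: koopman_def[of "_ :: 'a \<Rightarrow> nat \<Rightarrow> real" y l])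
    also have "\<dots> = w ((T ^^ Suc n) ((T ^^ l) y))"
      unfolding Fy by (simp add: funpow_swap1)
    finally show ?thesis .
  qed
qed simp

lemma base_measure_integral:
  fixes v :: "'a \<Rightarrow> real"
  assumes "v \<in> borel_measurable M"
  shows "(\<integral>x. v x \<partial>base_measure M T \<mu> \<phi>) = (\<integral>p. v ((T ^^ snd p) (fst p)) \<partial>\<Delta>)"
  unfolding base_measure_def
  by (subst integral_distr[OF tower_proj_measurable assms]) (simp add: tower_proj_def case_prod_unfold)

lemma correlation_eq_tower_corr:
  assumes G: "good G" and v: "v \<in> borel_measurable M" and w: "w \<in> borel_measurable M"
    and bv: "tower_bounded G (\<lambda>y l. v ((T ^^ l) y))" and bw: "tower_bounded G (\<lambda>y l. w ((T ^^ l) y))"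
  shows "correlation (base_measure M T \<mu> \<phi>) T v w n =
    tower_corr (\<lambda>y l. v ((T ^^ l) y)) (\<lambda>y l. w ((T ^^ l) y)) n / phi_mean"
proof -
  let ?V = "\<lambda>y l. v ((T ^^ l) y)" and ?W = "\<lambda>y l. w ((T ^^ l) y)"
  have "(\<lambda>x. v x * w ((T ^^ n) x)) \<in> borel_measurable M"
    using v measurable_compose[OF T_power_measurable w] by measurable
  then have "(\<integral>x. v x * w ((T ^^ n) x) \<partial>base_measure M T \<mu> \<phi>) =
      (\<integral>p. ?V (fst p) (snd p) * w ((T ^^ n) ((T ^^ snd p) (fst p))) \<partial>\<Delta>)"
    by (rule base_measure_integral)
  also have "\<dots> = (\<integral>p. ?V (fst p) (snd p) * (koopman ^^ n) ?W (fst p) (snd p) \<partial>\<Delta>)"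
    by (rule Bochner_Integration.integral_cong)
      (auto simp: space_Delta tower_def koopman_power_level)
  also have "\<dots> = tower_int (\<lambda>y l. ?V y l * (koopman ^^ n) ?W y l) / phi_mean"
    by (rule integral_Delta(2)[OF G tower_bounded_mult[OF G bv tower_bounded_koopman_power[OF G bw]]])
  finally show ?thesis
    by (simp add: correlation_def tower_corr_def base_measure_integral[OF v] base_measure_integral[OF w]
        integral_Delta(2)[OF G bv] integral_Delta(2)[OF G bw] diff_divide_distrib)
qed


lemma AE_base_measure_levels:
  assumes P [measurable]: "Measurable.pred M P" and AE: "AE x in base_measure M T \<mu> \<phi>. P x"
  shows "AE y in \<mu>. \<forall>l<\<phi> y. P ((T ^^ l) y)"
proof -
  have "AE p in \<Delta>. P ((T ^^ snd p) (fst p))"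
    using AE unfolding base_measure_def
    by (subst (asm) AE_distr_iff[OF tower_proj_measurable])
      (auto simp: tower_proj_def case_prod_unfold)
  then show ?thesis
    by (subst (asm) AE_Delta_iff[of "\<lambda>y l. P ((T ^^ l) y)"])
      (auto intro: measurable_compose[OF T_power_base_measurable P])
qed

lemma Linf_bound:
  assumes w: "w \<in> Linf (base_measure M T \<mu> \<phi>)"
  shows "0 \<le> real_of_ereal (Linf_norm (base_measure M T \<mu> \<phi>) w)"
    and "AE x in base_measure M T \<mu> \<phi>. \<bar>w x\<bar> \<le> real_of_ereal (Linf_norm (base_measure M T \<mu> \<phi>) w)"
proof -
  let ?X = "base_measure M T \<mu> \<phi>"
  interpret X: prob_space ?X
    unfolding base_measure_def by (rule prob_space.prob_space_distr[OF prob_space_Delta tower_proj_measurable])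
  have L: "Linf_norm ?X w < \<infinity>" using w by (simp add: Linf_def)
  have AE: "AE x in ?X. ereal \<bar>w x\<bar> \<le> Linf_norm ?X w"
    unfolding Linf_norm_def by (rule esssup_AE)
  then show b: "AE x in ?X. \<bar>w x\<bar> \<le> real_of_ereal (Linf_norm ?X w)"
  proof eventually_elim
    case (elim x)
    with L show ?case by (cases "Linf_norm ?X w") auto
  qed
  show "0 \<le> real_of_ereal (Linf_norm ?X w)"
  proof (rule ccontr)
    assume "\<not> ?thesis"
    then have "\<not> \<bar>w x\<bar> \<le> real_of_ereal (Linf_norm ?X w)" for x
      using abs_ge_zero[of "w x"] by linarith
    then have "AE x in ?X. False" using b by (elim eventually_mono) blast
    then show False by simp
  qed
qed

text \<open>Where \<open>d y y'\<close> vanishes, the difference quotient in the norm is \<open>0\<close> by convention and bounds nothing;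
  hence the restriction to positive distance.\<close>

lemma BX_bounds:
  assumes v: "v \<in> BX M T \<phi> \<alpha> \<theta>" and a: "a \<in> \<alpha>"
    and y: "y \<in> a" "l < \<phi> y"
  shows "\<bar>v ((T ^^ l) y)\<bar> \<le> enn2real (BX_norm T \<phi> \<alpha> \<theta> v)"
    and "y' \<in> a \<Longrightarrow> 0 < d y y' \<Longrightarrow>
      \<bar>v ((T ^^ l) y) - v ((T ^^ l) y')\<bar> \<le> enn2real (BX_norm T \<phi> \<alpha> \<theta> v) * d y y'"
proof -
  let ?B = "BX_norm T \<phi> \<alpha> \<theta> v"
  have fin: "?B < \<infinity>" using v by (simp add: BX_def)
  then have B: "ennreal (enn2real ?B) = ?B" by simp
  have "lip_norm a d (\<lambda>y. v ((T ^^ l) y)) \<le> ?B"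
    unfolding BX_norm_def F_eq by (rule SUP_upper2[OF a SUP_upper]) (use y in auto)
  then have 1: "(SUP y\<in>a. ennreal (norm (v ((T ^^ l) y)))) \<le> ?B"
    and 2: "(SUP y\<in>a. SUP y'\<in>a - {y}. ennreal (norm (v ((T ^^ l) y) - v ((T ^^ l) y')) / d y y')) \<le> ?B"
    unfolding lip_norm_def by (auto intro: order_trans[rotated] simp: add_increasing add_increasing2)
  have "ennreal (norm (v ((T ^^ l) y))) \<le> ennreal (enn2real ?B)"
    unfolding B by (rule order_trans[OF SUP_upper[OF y(1)] 1])
  then show "\<bar>v ((T ^^ l) y)\<bar> \<le> enn2real ?B"
    by (simp add: ennreal_le_iff)
  assume y': "y' \<in> a" and d: "0 < d y y'"
  show "\<bar>v ((T ^^ l) y) - v ((T ^^ l) y')\<bar> \<le> enn2real ?B * d y y'"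
  proof (cases "y' = y")
    case False
    then have "ennreal (norm (v ((T ^^ l) y) - v ((T ^^ l) y')) / d y y') \<le>
        (SUP y\<in>a. SUP y'\<in>a - {y}. ennreal (norm (v ((T ^^ l) y) - v ((T ^^ l) y')) / d y y'))"
      using y(1) y' by (intro SUP_upper2[OF y(1) SUP_upper]) auto
    also note 2
    also have "?B = ennreal (enn2real ?B)" by (rule B[symmetric])
    finally have "norm (v ((T ^^ l) y) - v ((T ^^ l) y')) / d y y' \<le> enn2real ?B"
      by (simp add: ennreal_le_iff)
    then show ?thesis using d by (simp add: field_simps)
  qed (use d in simp)
qed


text \<open>Scaled and shifted, the observable \<open>v\<close> lifts to a regular function and \<open>w\<close> to a function
  with values in the unit interval; constants do not contribute to correlations.\<close>

lemma correlation_normalized: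
  assumes G: "good G" and K: "1 \<le> K" and v: "v \<in> BX M T \<phi> \<alpha> \<theta>"
    and w: "w \<in> borel_measurable M" and s: "0 < s" "AE x in base_measure M T \<mu> \<phi>. \<bar>w x\<bar> \<le> s"
  obtains H U where "H \<in> regular_functions K G" "tower_bounded G U" "\<And>y l. 0 \<le> U y l \<and> U y l \<le> 1"
    "\<And>n. correlation (base_measure M T \<mu> \<phi>) T v w n =
      2 * (enn2real (BX_norm T \<phi> \<alpha> \<theta> v) + 1) * s / phi_mean * tower_corr H U n"
proof -
  define B where "B = enn2real (BX_norm T \<phi> \<alpha> \<theta> v) + 1"
  have B: "0 < B" "enn2real (BX_norm T \<phi> \<alpha> \<theta> v) \<le> B"
    by (simp_all add: B_def add_nonneg_pos)
  define V where "V y l = v ((T ^^ l) y)" for y l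
  define W where "W y l = w ((T ^^ l) y)" for y l
  define H where "H y l = V y l / B + 2" for y l
  \<comment> \<open>Truncation makes the bounds hold everywhere and changes \<open>W\<close> on a null set only.\<close>
  define U where "U y l = (max (- 1) (min 1 (W y l / s)) + 1) / 2" for y l
  have vM: "v \<in> borel_measurable M" using v by (simp add: BX_def)
  have mV [measurable]: "(\<lambda>y. V y l) \<in> borel_measurable \<mu>" for l
    unfolding V_def by (rule level_measurable[OF vM])
  have mW [measurable]: "(\<lambda>y. W y l) \<in> borel_measurable \<mu>" for l
    unfolding W_def by (rule level_measurable[OF w])
  have V_bound: "\<bar>V y l\<bar> \<le> B" if y: "y \<in> G" "l < \<phi> y" for y l
  proof -
    obtain a where "a \<in> \<alpha>" "y \<in> a" using goodD(6)[OF G y(1)] by blast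
    from BX_bounds(1)[OF v this y(2)] show ?thesis using B(2) by (simp add: V_def)
  qed
  have H: "H \<in> regular_functions K G"
    unfolding regular_functions_def
  proof (intro CollectI conjI allI ballI impI)
    show "(\<lambda>y. H y l) \<in> borel_measurable \<mu>" for l
      unfolding H_def by measurable
    fix y l assume l: "l < \<phi> y"
    have H_bounds: "1 \<le> H y l" "H y l \<le> 3" if "y \<in> G" "l < \<phi> y" for y l
      using V_bound[OF that] B(1) by (auto simp: H_def abs_le_iff field_simps)
    show "1 \<le> H y l" "H y l \<le> 3" if "y \<in> G"
      using H_bounds[OF that l] by auto
    fix a y' assume "a \<in> \<alpha>" "y \<in> a \<inter> G" "y' \<in> a \<inter> G"
    then have a: "a \<in> \<alpha>" "y \<in> a" "y' \<in> a" "y \<in> G" "y' \<in> G" by auto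
    have l': "l < \<phi> y'" using l phi_eq[OF a(1-3)] by simp
    have dn: "0 \<le> d y y'" by (rule dist_nonneg)
    have "V y l - V y' l \<le> B * d y y'"
    proof (cases "y = y'")
      case False
      have "\<bar>V y l - V y' l\<bar> \<le> enn2real (BX_norm T \<phi> \<alpha> \<theta> v) * d y y'"
        unfolding V_def by (rule BX_bounds(2)[OF v a(1,2) l a(3) dist_pos[OF G a(4,5) False]])
      also have "\<dots> \<le> B * d y y'" using B(2) dn by (rule mult_right_mono)
      finally show ?thesis by simp
    qed (use B dn in simp)
    then have "V y l / B \<le> (V y' l + B * d y y') / B"
      using B(1) by (intro divide_right_mono) auto
    then have "H y l \<le> H y' l + d y y'"
      using B(1) by (simp add: H_def add_divide_distrib)
    also have "\<dots> \<le> H y' l + d y y' * H y' l"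
      using H_bounds(1)[OF a(5) l'] dn by (simp add: mult_le_cancel_left1)
    also have "\<dots> = (1 + d y y') * H y' l" by (simp add: algebra_simps)
    also have "\<dots> \<le> exp (K * d y y') * H y' l"
    proof (rule mult_right_mono)
      have "1 + d y y' \<le> 1 + K * d y y'" using K dn by (simp add: mult_le_cancel_right1)
      also have "\<dots> \<le> exp (K * d y y')" by (rule exp_ge_add_one_self)
      finally show "1 + d y y' \<le> exp (K * d y y')" .
      show "0 \<le> H y' l" using H_bounds(1)[OF a(5) l'] by simp
    qed
    finally show "H y l \<le> exp (K * d y y') * H y' l" .
  qed
  have U01: "0 \<le> U y l \<and> U y l \<le> 1" for y l
    by (auto simp: U_def)
  have mU: "(\<lambda>y. U y l) \<in> borel_measurable \<mu>" for l
    unfolding U_def by measurable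
  have bU: "tower_bounded G' U" for G'
    unfolding tower_bounded_def using mU U01 by (intro conjI allI exI[of _ 1]) (auto simp: abs_le_iff intro: order_trans[of _ 0])
  have "Measurable.pred M (\<lambda>x. \<bar>w x\<bar> \<le> s)" using w by measurable
  from AE_base_measure_levels[OF this s(2)]
  obtain G' where G': "good G'" "G' \<subseteq> G" and W_bound: "\<And>y l. y \<in> G' \<Longrightarrow> l < \<phi> y \<Longrightarrow> \<bar>W y l\<bar> \<le> s"
    unfolding W_def using good_subset_bounded[OF G, of "\<lambda>y l. \<bar>w ((T ^^ l) y)\<bar> \<le> s"] by blast
  have bV: "tower_bounded G' V"
    unfolding tower_bounded_def using mV V_bound G'(2) by blast
  have bW: "tower_bounded G' W"
    unfolding tower_bounded_def using mW W_bound by blast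
  have bH: "tower_bounded G' H"
    using regular_functions_bounded[OF G H] G'(2) unfolding tower_bounded_def by blast
  have corr: "correlation (base_measure M T \<mu> \<phi>) T v w n = 2 * B * s / phi_mean * tower_corr H U n" for n
  proof -
    have "correlation (base_measure M T \<mu> \<phi>) T v w n = tower_corr V W n / phi_mean"
      using correlation_eq_tower_corr[OF G'(1) vM w] bV bW unfolding V_def[abs_def] W_def[abs_def] by blast
    also have "tower_corr V W n =
        tower_corr (\<lambda>y l. B * H y l + (- 2 * B)) (\<lambda>y l. 2 * s * U y l + (- s)) n"
    proof (rule tower_corr_cong[OF G'(1) bV _ bW])
      show "tower_bounded G' (\<lambda>y l. B * H y l + (- 2 * B))" "tower_bounded G' (\<lambda>y l. 2 * s * U y l + (- s))"
        by (intro tower_bounded_add[OF G'(1)] tower_bounded_cmult[OF G'(1)]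
            tower_bounded_const[OF G'(1)] bH bU)+
      show "V y l = B * H y l + (- 2 * B)" for y l
        using B(1) by (simp add: H_def field_simps)
      show "W y l = 2 * s * U y l + (- s)" if "y \<in> G'" "l < \<phi> y" for y l
      proof -
        have "- 1 \<le> W y l / s" "W y l / s \<le> 1"
          using W_bound[OF that] s(1) by (auto simp: field_simps abs_le_iff)
        then show ?thesis using s(1) by (simp add: U_def field_simps)
      qed
    qed
    also have "\<dots> = B * (2 * s) * tower_corr H U n"
      by (rule tower_corr_affine[OF G'(1) bH bU]) (use U01 in blast)
    finally show ?thesis by simp
  qed
  show thesis
    by (rule that[OF H bU U01 corr[unfolded B_def]])
qed

end

theorem theorem1p4:
  fixes M \<mu> :: "'x measure" and T :: "'x \<Rightarrow> 'x" and Y :: "'x set"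
    and \<phi> :: "'x \<Rightarrow> nat" and \<alpha> :: "'x set set" and \<theta> :: real
  defines "F \<equiv> return_map T \<phi>"
    and "\<mu>X \<equiv> base_measure M T \<mu> \<phi>"
  assumes T: "T \<in> measurable M M"
    and Y: "Y \<in> sets M"
    and phi: "\<phi> \<in> measurable (restrict_space M Y) (count_space UNIV)"
    and phi_pos: "\<And>y. y \<in> Y \<Longrightarrow> 1 \<le> \<phi> y"
    and return: "\<And>y. y \<in> Y \<Longrightarrow> F y \<in> Y"
    and mu: "prob_space \<mu>" "sets \<mu> = sets (restrict_space M Y)"
    and ergodic: "ergodic_measure \<mu> F"
    and phi_L1: "integrable \<mu> (\<lambda>y. real (\<phi> y))"
    and partition: "partition_mod_null \<mu> \<alpha>"
    and phi_const: "\<And>a. a \<in> \<alpha> \<Longrightarrow> \<exists>k. \<forall>y\<in>a. \<phi> y = k"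
    and theta: "0 < \<theta>" "\<theta> < 1"
    and GM: "gibbs_markov \<mu> F \<alpha> \<theta>"
    and aperiodic: "aperiodic \<mu> F \<phi> \<alpha> \<theta>"
    and tail: "(\<lambda>n. measure \<mu> {y \<in> Y. \<phi> y > n}) \<in> O(\<lambda>n. 1 / (real n * ln (real n)))"
  shows "\<exists>a::nat \<Rightarrow> real. (\<forall>n. 0 < a n) \<and> a \<longlonglongrightarrow> 0 \<and>
           (\<forall>v\<in>BX M T \<phi> \<alpha> \<theta>. \<exists>C>0. \<forall>w\<in>Linf \<mu>X. \<forall>n\<ge>1.
              \<bar>correlation \<mu>X T v w n\<bar> \<le> C * real_of_ereal (Linf_norm \<mu>X w) * a n)"
proof -
  have space_mu: "space \<mu> = Y"
    using sets_eq_imp_space_eq[OF mu(2)] sets.sets_into_space[OF Y]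
    by (auto simp: space_restrict_space)
  obtain N g C0 where N: "N \<in> null_sets \<mu>"
    and inj: "\<forall>a\<in>\<alpha>. inj_on F (a - N)"
    and img: "\<forall>a\<in>\<alpha>. \<forall>A\<in>sets \<mu>. A \<subseteq> a - N \<longrightarrow>
           F ` A \<in> sets \<mu> \<and> (emeasure \<mu> (F ` A) = 0 \<longleftrightarrow> emeasure \<mu> A = 0)"
    and markov: "\<forall>a\<in>\<alpha>. \<exists>\<beta>\<subseteq>\<alpha>. AE y in \<mu>. y \<in> F ` (a - N) \<longleftrightarrow> y \<in> \<Union>\<beta>"
    and sep: "\<forall>y\<in>space \<mu> - N. \<forall>y'\<in>space \<mu> - N. y \<noteq> y' \<longrightarrow> sep_time \<alpha> F y y' \<noteq> \<infinity>"
    and g: "g \<in> borel_measurable \<mu>" "\<forall>y\<in>space \<mu>. 0 < g y"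
      "density (comp_measure \<mu> F ((\<lambda>a. a - N) ` \<alpha>)) (\<lambda>y. ennreal (g y)) = \<mu>"
      "\<forall>a\<in>\<alpha>. \<forall>y\<in>a - N. \<forall>y'\<in>a - N.
              \<bar>ln (g y) - ln (g y')\<bar> \<le> C0 * sep_dist \<theta> \<alpha> F (F y) (F y')"
    using GM unfolding gibbs_markov_def by (elim bexE exE conjE) (rule that)
  interpret prob_space \<mu> by (rule mu(1))
  interpret suspended_tower \<mu> F \<phi> \<alpha> \<theta> N g C0 M T Y
  proof unfold_locales
    show "ergodic_measure \<mu> F" "partition_mod_null \<mu> \<alpha>" "0 < \<theta>" "\<theta> < 1" "N \<in> null_sets \<mu>"
      "g \<in> borel_measurable \<mu>" "density (comp_measure \<mu> F ((\<lambda>a. a - N) ` \<alpha>)) (\<lambda>y. ennreal (g y)) = \<mu>"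
      "integrable \<mu> (\<lambda>y. real (\<phi> y))" "T \<in> measurable M M" "Y \<in> sets M"
      "sets \<mu> = sets (restrict_space M Y)" "F = return_map T \<phi>"
      by (fact ergodic partition theta N g mu phi_L1 T Y F_def[THEN meta_eq_to_obj_eq] | simp)+
    show "\<phi> \<in> measurable \<mu> (count_space UNIV)"
      using phi by (simp add: measurable_cong_sets[OF mu(2) refl])
    show "inj_on F (a - N)" if "a \<in> \<alpha>" for a using inj that by blast
    show "F ` A \<in> sets \<mu>" if "a \<in> \<alpha>" "A \<in> sets \<mu>" "A \<subseteq> a - N" for a A
      using img that by blast
    show "F ` A \<in> null_sets \<mu>" if "a \<in> \<alpha>" "A \<in> null_sets \<mu>" "A \<subseteq> a - N" for a A
      using img[rule_format, of a A] that by (auto simp: null_sets_def)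
    show "\<exists>\<beta>\<subseteq>\<alpha>. AE y in \<mu>. y \<in> F ` (a - N) \<longleftrightarrow> y \<in> \<Union>\<beta>" if "a \<in> \<alpha>" for a
      using markov that by (rule bspec)
    show "sep_time \<alpha> F y y' \<noteq> \<infinity>" if "y \<in> space \<mu> - N" "y' \<in> space \<mu> - N" "y \<noteq> y'" for y y'
      using sep that by blast
    show "0 < g y" if "y \<in> space \<mu>" for y using g(2) that by blast
    show "\<bar>ln (g y) - ln (g y')\<bar> \<le> C0 * sep_dist \<theta> \<alpha> F (F y) (F y')"
      if "a \<in> \<alpha>" "y \<in> a - N" "y' \<in> a - N" for a y y'
      using g(4) that by blast
    show "1 \<le> \<phi> y" if "y \<in> space \<mu>" for y using phi_pos that space_mu by blast
    show "\<exists>k. \<forall>y\<in>a. \<phi> y = k" if "a \<in> \<alpha>" for a using phi_const[OF that] .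
  qed
  obtain G where G: "good G"
    using good_exists[of "{}"] by auto
  \<comment> \<open>Chosen such that \<open>C0 + \<theta> * K \<le> K\<close>, with room for the unit constant of normalized observables.\<close>
  define K where "K = 1 + \<bar>C0\<bar> / (1 - \<theta>)"
  have K1: "1 \<le> K" using theta by (simp add: K_def)
  have "K * (1 - \<theta>) = 1 - \<theta> + \<bar>C0\<bar>"
    using theta by (simp add: K_def distrib_right)
  then have K: "0 \<le> K" "C0 + \<theta> * K \<le> K" using theta K1 by (simp_all add: algebra_simps abs_if split: if_splits)
  define S where "S = {(H, U). H \<in> regular_functions K G \<and> tower_bounded G U \<and>
    (\<forall>y\<in>G. \<forall>l<\<phi> y. 0 \<le> U y l \<and> U y l \<le> 1)}"
  obtain a :: "nat \<Rightarrow> real" where a: "\<And>n. 0 < a n" "a \<longlonglongrightarrow> 0"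
    "\<And>n p. p \<in> S \<Longrightarrow> (case p of (H, U) \<Rightarrow> \<bar>tower_corr H U n\<bar>) \<le> a n"
  proof (rule uniform_rate[of S "\<lambda>n p. case p of (H, U) \<Rightarrow> \<bar>tower_corr H U n\<bar>" "2 * (3 * phi_mean)"])
    fix n p assume "p \<in> S"
    then obtain H U where p: "p = (H, U)" and H: "H \<in> regular_functions K G" and U: "tower_bounded G U"
      and U01: "\<And>y l. y \<in> G \<Longrightarrow> l < \<phi> y \<Longrightarrow> 0 \<le> U y l \<and> U y l \<le> 1"
      by (auto simp: S_def)
    note bH = regular_functions_bounded[OF G H]
    have "\<bar>tower_corr H U n - tower_corr (\<lambda>_ _. 0) U n\<bar> \<le> 2 * tower_int (\<lambda>y l. \<bar>H y l - 0\<bar>)"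
      by (rule tower_corr_diff_le[OF G U U01 bH tower_bounded_const[OF G]])
    moreover have "tower_corr (\<lambda>_ _. 0) U n = 0"
      by (simp add: tower_corr_def tower_int_def)
    moreover have "tower_int (\<lambda>y l. \<bar>H y l - 0\<bar>) \<le> tower_int (\<lambda>_ _. 3)"
    proof (rule tower_int_mono[OF G])
      show "tower_bounded G (\<lambda>y l. \<bar>H y l - 0\<bar>)"
        using tower_bounded_abs[OF G bH] by simp
      show "\<bar>H y l - 0\<bar> \<le> 3" if "y \<in> G" "l < \<phi> y" for y l
        using regular_functionsD(2,3)[OF H that] by simp
    qed (rule tower_bounded_const[OF G])
    ultimately show "(case p of (H, U) \<Rightarrow> \<bar>tower_corr H U n\<bar>) \<le> 2 * (3 * phi_mean)"
      by (simp add: p tower_int_const[OF G] phi_mean_def)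
  next
    fix e :: real assume "0 < e"
    from tower_corr_uniform[OF G aperiodic K this]
    show "\<exists>n0. \<forall>n\<ge>n0. \<forall>p\<in>S. (case p of (H, U) \<Rightarrow> \<bar>tower_corr H U n\<bar>) \<le> e"
      by (fastforce simp: S_def)
  qed (rule that)
  show ?thesis
  proof (intro exI[of _ a] conjI allI ballI)
    show "0 < a n" for n by (rule a(1))
    show "a \<longlonglongrightarrow> 0" by (rule a(2))
    fix v assume v: "v \<in> BX M T \<phi> \<alpha> \<theta>"
    define C where "C = 2 * (enn2real (BX_norm T \<phi> \<alpha> \<theta> v) + 1) / phi_mean"
    have C: "0 < C" unfolding C_def using phi_mean_pos by (simp add: add_nonneg_pos)
    have "\<bar>correlation \<mu>X T v w n\<bar> \<le> C * real_of_ereal (Linf_norm \<mu>X w) * a n"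
      if w: "w \<in> Linf \<mu>X" for w n
    proof (rule field_le_epsilon)
      fix e :: real assume e: "0 < e"
      \<comment> \<open>The norm of \<open>w\<close> may vanish, so it is enlarged by a margin that costs at most \<open>e\<close>.\<close>
      define s where "s = real_of_ereal (Linf_norm \<mu>X w) + e / (C * a n)"
      have margin: "0 < e / (C * a n)" using e C a(1)[of n] by simp
      have s: "0 < s" "AE x in base_measure M T \<mu> \<phi>. \<bar>w x\<bar> \<le> s"
        using Linf_bound[OF w[unfolded \<mu>X_def]] margin
        by (auto simp: s_def \<mu>X_def add_nonneg_pos elim!: eventually_mono)
      have wM: "w \<in> borel_measurable M"
        using w by (simp add: Linf_def \<mu>X_def base_measure_def)
      obtain H U where H: "H \<in> regular_functions K G" "tower_bounded G U" "\<And>y l. 0 \<le> U y l \<and> U y l \<le> 1"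
        and corr: "\<And>n. correlation (base_measure M T \<mu> \<phi>) T v w n =
          2 * (enn2real (BX_norm T \<phi> \<alpha> \<theta> v) + 1) * s / phi_mean * tower_corr H U n"
        using correlation_normalized[OF G K1 v wM s] by blast
      have "\<bar>tower_corr H U n\<bar> \<le> a n"
        using a(3)[of "(H, U)" n] H by (simp add: S_def)
      then have "C * s * \<bar>tower_corr H U n\<bar> \<le> C * s * a n"
        using C s(1) by (intro mult_left_mono) auto
      moreover have "\<bar>correlation \<mu>X T v w n\<bar> = C * s * \<bar>tower_corr H U n\<bar>"
      proof -
        have "correlation \<mu>X T v w n = C * s * tower_corr H U n"
          by (simp add: corr \<mu>X_def C_def)
        then show ?thesis using C s(1) by (simp add: abs_mult)
      qed
      moreover have "C * s * a n = C * real_of_ereal (Linf_norm \<mu>X w) * a n + e"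
        using C a(1)[of n] by (simp add: s_def distrib_left distrib_right)
      ultimately show "\<bar>correlation \<mu>X T v w n\<bar> \<le> C * real_of_ereal (Linf_norm \<mu>X w) * a n + e"
        by simp
    qed
    with C show "\<exists>C>0. \<forall>w\<in>Linf \<mu>X. \<forall>n\<ge>1.
        \<bar>correlation \<mu>X T v w n\<bar> \<le> C * real_of_ereal (Linf_norm \<mu>X w) * a n"
      by blast
  qed
qed

end
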